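(* For $\mu\in\mathcal N_G$ put $\mathbb A(F)_\mu:=\{c\in\mathbb A(F): r(d_c)=\mu\}$ and $\mathbb A(F)_{\le\mu}:=\{c\in\mathbb A(F): r(d_c)\le\mu\}$. Then: (1) The sets $\mathbb A(F)_\mu$ ($\mu\in\mathcal N_G$) are non-empty and $\mathbb A(F)=\coprod_{\mu\in\mathcal N_G}\mathbb A(F)_\mu$. (2) For every $\mu\in\mathcal N_G$, $\mathbb A(F)_{\le\mu}=\coprod_{\{\nu\in\mathcal N_G:\,\nu\le\mu\}}\mathbb A(F)_\nu$. (3) For every $\mu\in\mathcal N_G$, $\mathbb A(F)_{\le\mu}$ consists of the $n$-tuples $(c_1,\dots,c_n)\in F^l\times(F^\times)^{n-l}=\mathbb A(F)$ such that $\mathrm{val}\,c_i\le\langle\omega_i,\mu\rangle$ for $i=1,\dots,l$, and $\mathrm{val}\,c_i=\langle\omega_i,\mu\rangle$ for $i=l+1,\dots,n$. (4) For every $\mu\in\mathcal N_G$, $\mathbb A(F)_\mu$ consists of the $n$-tuples $(c_1,\dots,c_n)\in F^l\times(F^\times)^{n-l}=\mathbb A(F)$ such that $\mathrm{val}\,c_i\le\langle\omega_i,\mu\rangle$ for all $i\in I_\mu$, and $\mathrm{val}\,c_i=\langle\omega_i,\mu\rangle$ for all $i\in\{1,\dots,n\}\setminus I_\mu$, where $I_\mu:=\{i\in\{1,\dots,l\}:\langle\alpha_i,\mu\rangle=0\}$. (5) Let $\mu\in\mathcal N_G$, let $c\in\mathbb A(F)$ and choose $a\in A(\bar F)$ such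 that $c(a)=c$. Then $c\in\mathbb A(F)_\mu$ if and only if $\mu$ is the unique dominant element in the $W$-orbit of $\nu_a$.
   Context: Field: $\mathcal O$ is a complete discrete valuation ring with uniformizer $\pi$ and algebraically closed residue field $k=\mathcal O/\pi\mathcal O$; $F$ is its fraction field and $\bar F$ an algebraic closure. The convention is the negative of the usual valuation: $\mathrm{val}:F^\times\to\mathbb Z$ is normalized by $\mathrm{val}(\pi)=-1$, extended to $\mathrm{val}:\bar F^\times\to\mathbb Q$, with $\mathrm{val}(0)=-\infty$. Group: $G$ is a split connected reductive group over $\mathcal O$ with simply connected derived group $G_{\mathrm{sc}}$; $A\subset B$ are a split maximal torus and a Borel subgroup (over $\mathcal O$); $W$ is the Weyl group of $A$ in $G$; $D=G/G_{\mathrm{sc}}$ (a split torus), $A_{\mathrm{sc}}=A\cap G_{\mathrm{sc}}$, so that $0\to X^*(D)\to X^*(A)\to X^*(A_{\mathrm{sc}})\to 0$ is exact. $\alpha_1,\dots,\alpha_l$ are the simple roots, with set $\Delta$; $\alpha_1^\vee,\dots,\alpha_l^\vee$ the simple coroots (a $\mathbb Z$-basis of $X_*(A_{\mathrm{sc}})$), $\varpi_1,\dots,\varpi_l\in X^*(A_{\mathrm{sc}})$ the dual basis (fundamental weights). For $1\le i\le l$, $\omega_i\in X^*(A)$ is a chosen extension of $\varpi_i$ to $A$, and $\omega_{l+1},\dots,\omega_n$ is a chosen basis of $X^*(D)$, where $n=\dim A$; then $\omega_1,\dots,\omega_n$ is a $\mathbb Z$-basis of $X^*(A)$. $\mathfrak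 a=X_*(A)\otimes\mathbb R$, $\mathfrak a_{\mathbb Q}=X_*(A)\otimes\mathbb Q$, with a fixed $W$-invariant Euclidean inner product on $\mathfrak a$. $x\in\mathfrak a$ is dominant if $\langle\alpha_i,x\rangle\ge0$ for $1\le i\le l$; $\mathfrak a_{\mathrm{dom}}$ is the set of dominant elements. For $x,y\in\mathfrak a$, $x\le y$ means that $y-x$ is a non-negative (real) linear combination of simple coroots. The set $\mathcal N_G$: a standard parabolic $P=MN$ is a parabolic subgroup containing $B$, with unipotent radical $N$ and $M$ the Levi subgroup containing $A$; $\Delta=\Delta_M\sqcup\Delta_N$ with $\Delta_M$ the simple roots of $M$ and $\Delta_N$ the simple roots of $G$ occurring in $\mathrm{Lie}(N)$. $\mathfrak a_M=\{x\in\mathfrak a:\langle\alpha,x\rangle=0\ \forall\alpha\in\Delta_M\}$; $p_M:\mathfrak a\to\mathfrak a_M$ is the projection along the span of the simple coroots of $M$; $\Lambda_M$ is the quotient of $X_*(A)$ by the coroot lattice of $M$, identified with the lattice $p_M(X_*(A))\subset\mathfrak a_M$; $\mathfrak a_P^+=\{x\in\mathfrak a_M:\langle\alpha,x\rangle>0\ \forall\alpha\in\Delta_N\}$; $\Lambda_P^+=\Lambda_M\cap\mathfrak a_P^+$. Then $\mathcal N_G=\coprod_P\Lambda_P^+\subset\mathfrak a_{\mathrm{dom}}$, over all standard parabolic subgroups $P$. Map $r$: for $x\in\mathfrak a$, $r(x)$ is the unique point of $\mathfrak a_{\mathrm{dom}}$ closest to $x$. Identify $\mathfrak a$ with $\mathbb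 R^n$ by $x\mapsto(\langle\omega_1,x\rangle,\dots,\langle\omega_n,x\rangle)$. Let $\tilde{\mathbb R}=\mathbb R\cup\{-\infty\}$, with the intervals $[-\infty,a)$ as neighborhood base at $-\infty$. The map $r:\mathbb R^n\to\mathfrak a_{\mathrm{dom}}$ extends (uniquely) to a continuous map, still called $r$, $\tilde{\mathbb R}^l\times\mathbb R^{n-l}\to\mathfrak a_{\mathrm{dom}}$. Adjoint quotient: for $\lambda\in X^*(A)$ write $e^\lambda$ for $\lambda$ viewed as a regular function on $A$. Put $c_i=\sum_{\lambda\in W\omega_i}e^\lambda$ (sum over the Weyl group orbit of $\omega_i$), for $i=1,\dots,n$. The map $c=(c_1,\dots,c_n):A\to\mathbb A^l\times\mathbb G_m^{n-l}$ identifies $\mathbb A:=A/W$ with $\mathbb A^l\times\mathbb G_m^{n-l}$, so $\mathbb A(F)=F^l\times(F^\times)^{n-l}$ and similarly over $\bar F$. For $a\in A(\bar F)$, $\nu_a\in\mathfrak a_{\mathbb Q}$ is defined by $\langle\lambda,\nu_a\rangle=\mathrm{val}\,\lambda(a)$ for all $\lambda\in X^*(A)$. For $c=(c_1,\dots,c_n)\in\mathbb A(\bar F)$, put $d_c=(\mathrm{val}\,c_1,\dots,\mathrm{val}\,c_n)\in(\mathbb Q\cup\{-\infty\})^l\times\mathbb Q^{n-l}$. *)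

theory Defs
  imports
    "HOL-Analysis.Analysis"
    "HOL-Algebra.Algebraic_Closure_Type"
    "HOL-Computational_Algebra.Fraction_Field"
begin

section \<open>Complete discrete valuation rings and the valuation\<close>

definition is_dvr :: "'o::idom \<Rightarrow> bool" where
  "is_dvr \<pi> \<longleftrightarrow>
     principal_domain (ring_of_type_algebra :: 'o ring) \<and>
     \<pi> \<noteq> 0 \<and>
     {I. maximalideal I (ring_of_type_algebra :: 'o ring)} = {PIdl\<^bsub>ring_of_type_algebra\<^esub> \<pi>}"

definition adically_complete :: "'o::idom \<Rightarrow> bool" where
  "adically_complete \<pi> \<longleftrightarrow>
     (\<forall>s :: nat \<Rightarrow> 'o.
        (\<forall>N. \<exists>M. \<forall>i\<ge>M. \<forall>j\<ge>M. \<pi> ^ N dvd s i - s j) \<longrightarrow>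
        (\<exists>L. \<forall>N. \<exists>M. \<forall>i\<ge>M. \<pi> ^ N dvd s i - L))"

definition residue_ring_at :: "'o::idom \<Rightarrow> 'o set ring" where
  "residue_ring_at \<pi> = ring_of_type_algebra Quot (PIdl\<^bsub>ring_of_type_algebra\<^esub> \<pi>)"

text \<open>The valuation has the opposite of the usual sign: \<open>\<pi>\<close> has valuation \<open>-1\<close> and
  \<open>0\<close> has valuation \<open>-\<infinity>\<close>. Here \<open>u\<close> runs through the units of the valuation ring.\<close>

definition valF :: "'o::idom \<Rightarrow> 'o fract \<Rightarrow> ereal" where
  "valF \<pi> x =
     (if x = 0 then -\<infinity>
      else ereal (of_int (THE k::int. \<exists>u. u dvd 1 \<and> x = Fract u 1 * Fract \<pi> 1 powi (- k))))"

text \<open>\<open>w\<close> is the valuation of the algebraic closure that extends \<^const>\<open>valF\<close>. There is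
  exactly one, by completeness.\<close>

definition extends_val :: "'o::idom \<Rightarrow> ('o fract alg_closure \<Rightarrow> ereal) \<Rightarrow> bool" where
  "extends_val \<pi> w \<longleftrightarrow>
     w 0 = -\<infinity> \<and>
     (\<forall>x. x \<noteq> 0 \<longrightarrow> (\<exists>q\<in>\<rat>. w x = ereal q)) \<and>
     (\<forall>x y. w (x * y) = w x + w y) \<and>
     (\<forall>x y. w (x + y) \<le> max (w x) (w y)) \<and>
     (\<forall>x. w (to_ac x) = valF \<pi> x)"


section \<open>Abelian groups as modules over the integers\<close>

definition zmult :: "int \<Rightarrow> 'x \<Rightarrow> 'x::ab_group_add" where
  "zmult k x = (if 0 \<le> k then (\<Sum>j<nat k. x) else - (\<Sum>j<nat (- k). x))"

lemma zmult_int_diff: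
  "zmult (int a - int b) x = (\<Sum>j<a. x) - (\<Sum>j<b. x :: 'x::ab_group_add)"
proof -
  have shift: "(\<Sum>j<m + k. x) = (\<Sum>j<m. x) + (\<Sum>j<k. x)" for m k :: nat
    by (induction k) (simp_all add: add.assoc)
  show ?thesis
  proof (cases "b \<le> a")
    case True
    then obtain k where "a = b + k" by (metis le_Suc_ex)
    then show ?thesis using shift[of b k] by (simp add: zmult_def)
  next
    case False
    then obtain k where "b = a + k" "k > 0"
      using less_imp_add_positive[of a b] by auto
    then show ?thesis using shift[of a k] by (simp add: zmult_def)
  qed
qed

lemma zmult_add_left: "zmult (a + b) x = zmult a x + zmult b (x :: 'x::ab_group_add)"
proof -
  have shift: "(\<Sum>j<m + k. x) = (\<Sum>j<m. x) + (\<Sum>j<k. x)" for m k :: nat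
    by (induction k) (simp_all add: add.assoc)
  obtain p q where a: "a = int p - int q" using int_diff_cases by blast
  obtain r s where b: "b = int r - int s" using int_diff_cases by blast
  have "a + b = int (p + r) - int (q + s)" using a b by simp
  then have "zmult (a + b) x = (\<Sum>j<p + r. x) - (\<Sum>j<q + s. x)"
    by (simp only: zmult_int_diff)
  then show ?thesis unfolding a b zmult_int_diff by (simp add: shift algebra_simps)
qed

lemma zmult_add_right: "zmult a (x + y) = zmult a x + zmult a (y :: 'x::ab_group_add)"
  by (simp add: zmult_def sum.distrib)

lemma zmult_1: "zmult 1 x = (x :: 'x::ab_group_add)"
  by (simp add: zmult_def)

lemma zmult_0: "zmult 0 x = (0 :: 'x::ab_group_add)"
  by (simp add: zmult_def)

lemma zmult_minus: "zmult (- a) x = - zmult a (x :: 'x::ab_group_add)"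
  using zmult_add_left[of a "- a" x] by (simp add: zmult_0 eq_neg_iff_add_eq_0 add.commute)

lemma zmult_zmult: "zmult a (zmult b x) = zmult (a * b) (x :: 'x::ab_group_add)"
proof (induction a rule: int_induct[where k = 0])
  case base
  show ?case by (simp add: zmult_0)
next
  case (step1 i)
  then show ?case by (simp add: zmult_add_left zmult_1 distrib_right)
next
  case (step2 i)
  have "zmult (i - 1) (zmult b x) = zmult i (zmult b x) - zmult b x"
    using zmult_add_left[of i "- 1" "zmult b x"] by (simp add: zmult_minus zmult_1)
  moreover have "zmult ((i - 1) * b) x = zmult (i * b) x - zmult b x"
    using zmult_add_left[of "i * b" "- b" x] by (simp add: zmult_minus left_diff_distrib)
  ultimately show ?case using step2 by simp
qed

lemma module_zmult: "Modules.module (zmult :: int \<Rightarrow> 'x \<Rightarrow> 'x::ab_group_add)"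
  by unfold_locales
    (simp_all add: zmult_add_left zmult_add_right zmult_zmult zmult_1)

definition is_Z_basis :: "(nat \<Rightarrow> 'x::ab_group_add) \<Rightarrow> nat set \<Rightarrow> 'x set \<Rightarrow> bool" where
  "is_Z_basis b I S \<longleftrightarrow>
     inj_on b I \<and> \<not> Modules.module.dependent zmult (b ` I) \<and> Modules.module.span zmult (b ` I) = S"


section \<open>Based root data\<close>

text \<open>The group with its maximal torus \<open>A\<close> and Borel subgroup \<open>B\<close> is given by its based root
  datum. The type \<^typ>\<open>'x\<close> is the character lattice of \<open>A\<close>, the cocharacter lattice is its
  dual, \<open>\<langle>\<xi>, y\<rangle>\<close> is evaluation of \<open>y\<close> at \<open>\<xi>\<close>, and the simple roots of \<open>B\<close> are
  \<open>simple G 1, \<dots>, simple G (ssrank G)\<close>.\<close>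

record 'x based_root_datum =
  roots :: "'x set"
  coroot :: "'x \<Rightarrow> 'x \<Rightarrow> int"
  ssrank :: nat
  simple :: "nat \<Rightarrow> 'x"

definition cochars :: "('x::ab_group_add \<Rightarrow> int) set" where
  "cochars = {y. \<forall>\<xi> \<eta>. y (\<xi> + \<eta>) = y \<xi> + y \<eta>}"

definition root_refl :: "'x::ab_group_add based_root_datum \<Rightarrow> 'x \<Rightarrow> 'x \<Rightarrow> 'x" where
  "root_refl G \<alpha> \<xi> = \<xi> - zmult (coroot G \<alpha> \<xi>) \<alpha>"

definition coroot_refl :: "'x::ab_group_add based_root_datum \<Rightarrow> 'x \<Rightarrow> ('x \<Rightarrow> int) \<Rightarrow> 'x \<Rightarrow> int" where
  "coroot_refl G \<alpha> y = (\<lambda>\<xi>. y \<xi> - y \<alpha> * coroot G \<alpha> \<xi>)"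

definition is_reduced_root_datum :: "'x::ab_group_add based_root_datum \<Rightarrow> nat \<Rightarrow> bool" where
  "is_reduced_root_datum G n \<longleftrightarrow>
     (\<exists>b. is_Z_basis b {1..n} (UNIV :: 'x set)) \<and>
     finite (roots G) \<and>
     coroot G ` roots G \<subseteq> cochars \<and>
     inj_on (coroot G) (roots G) \<and>
     (\<forall>\<alpha>\<in>roots G. coroot G \<alpha> \<alpha> = 2) \<and>
     (\<forall>\<alpha>\<in>roots G. root_refl G \<alpha> ` roots G \<subseteq> roots G) \<and>
     (\<forall>\<alpha>\<in>roots G. coroot_refl G \<alpha> ` coroot G ` roots G \<subseteq> coroot G ` roots G) \<and>
     (\<forall>\<alpha>\<in>roots G. \<forall>k. zmult k \<alpha> \<in> roots G \<longrightarrow> k = 1 \<or> k = - 1)"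

definition is_root_base :: "'x::ab_group_add based_root_datum \<Rightarrow> bool" where
  "is_root_base G \<longleftrightarrow>
     simple G ` {1..ssrank G} \<subseteq> roots G \<and>
     inj_on (simple G) {1..ssrank G} \<and>
     \<not> Modules.module.dependent zmult (simple G ` {1..ssrank G}) \<and>
     (\<forall>\<beta>\<in>roots G. \<exists>m. \<beta> = (\<Sum>i=1..ssrank G. zmult (m i) (simple G i)) \<and>
        ((\<forall>i\<in>{1..ssrank G}. 0 \<le> m i) \<or> (\<forall>i\<in>{1..ssrank G}. m i \<le> 0)))"

definition is_based_root_datum :: "'x::ab_group_add based_root_datum \<Rightarrow> nat \<Rightarrow> bool" where
  "is_based_root_datum G n \<longleftrightarrow> is_reduced_root_datum G n \<and> is_root_base G"

text \<open>The derived group is simply connected if and only if the coroot lattice is saturated in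
  the cocharacter lattice, i.e. is the full cocharacter lattice of the maximal torus
  \<open>A \<inter> G_der\<close> of the derived group.\<close>

definition coroot_lattice :: "'x::ab_group_add based_root_datum \<Rightarrow> ('x \<Rightarrow> int) set" where
  "coroot_lattice G = {y. \<exists>m. y = (\<lambda>\<xi>. \<Sum>\<alpha>\<in>roots G. m \<alpha> * coroot G \<alpha> \<xi>)}"

definition simply_connected_derived :: "'x::ab_group_add based_root_datum \<Rightarrow> bool" where
  "simply_connected_derived G \<longleftrightarrow>
     (\<forall>y\<in>cochars. \<forall>k::int. k \<noteq> 0 \<longrightarrow> (\<lambda>\<xi>. k * y \<xi>) \<in> coroot_lattice G \<longrightarrow> y \<in> coroot_lattice G)"

inductive_set weyl_group :: "'x::ab_group_add based_root_datum \<Rightarrow> ('x \<Rightarrow> 'x) set"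
  for G :: "'x based_root_datum" where
  one: "id \<in> weyl_group G"
| step: "w \<in> weyl_group G \<Longrightarrow> \<alpha> \<in> roots G \<Longrightarrow> root_refl G \<alpha> \<circ> w \<in> weyl_group G"

abbreviation simple_coroot :: "'x::ab_group_add based_root_datum \<Rightarrow> nat \<Rightarrow> 'x \<Rightarrow> int" where
  "simple_coroot G i \<equiv> coroot G (simple G i)"

text \<open>The characters of \<open>D = A / A_sc\<close> are the characters of \<open>A\<close> that are trivial on
  \<open>A_sc\<close>, whose cocharacter lattice is spanned by the simple coroots.\<close>

definition chars_D :: "'x::ab_group_add based_root_datum \<Rightarrow> 'x set" where
  "chars_D G = {\<xi>. \<forall>i\<in>{1..ssrank G}. simple_coroot G i \<xi> = 0}"

definition is_weight_choice :: "'x::ab_group_add based_root_datum \<Rightarrow> nat \<Rightarrow> (nat \<Rightarrow> 'x) \<Rightarrow> bool" where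
  "is_weight_choice G n \<omega> \<longleftrightarrow>
     ssrank G \<le> n \<and>
     (\<forall>i\<in>{1..ssrank G}. \<forall>j\<in>{1..ssrank G}. simple_coroot G j (\<omega> i) = (if i = j then 1 else 0)) \<and>
     is_Z_basis \<omega> {ssrank G + 1..n} (chars_D G)"


section \<open>The real vector space \<open>\<aa>\<close>\<close>

text \<open>The space \<open>\<aa>\<close>, the tensor product of the cocharacter lattice with the reals, is the
  space of additive maps from the character lattice to the reals.\<close>

definition fa :: "('x::ab_group_add \<Rightarrow> real) set" where
  "fa = {x. \<forall>\<xi> \<eta>. x (\<xi> + \<eta>) = x \<xi> + x \<eta>}"

definition fa_lattice :: "('x::ab_group_add \<Rightarrow> real) set" where
  "fa_lattice = (\<lambda>y \<xi>. of_int (y \<xi>)) ` cochars"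

definition fa_dom :: "'x::ab_group_add based_root_datum \<Rightarrow> ('x \<Rightarrow> real) set" where
  "fa_dom G = {x\<in>fa. \<forall>i\<in>{1..ssrank G}. 0 \<le> x (simple G i)}"

definition dom_le :: "'x::ab_group_add based_root_datum \<Rightarrow> ('x \<Rightarrow> real) \<Rightarrow> ('x \<Rightarrow> real) \<Rightarrow> bool" where
  "dom_le G x y \<longleftrightarrow>
     (\<exists>t. (\<forall>i\<in>{1..ssrank G}. 0 \<le> t i) \<and>
          (\<forall>\<xi>. y \<xi> - x \<xi> = (\<Sum>i=1..ssrank G. t i * of_int (simple_coroot G i \<xi>))))"

definition weyl_act :: "('x \<Rightarrow> 'x) \<Rightarrow> ('x::ab_group_add \<Rightarrow> real) \<Rightarrow> 'x \<Rightarrow> real" where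
  "weyl_act w x = x \<circ> inv_into UNIV w"

definition is_invariant_inner ::
  "'x::ab_group_add based_root_datum \<Rightarrow> (('x \<Rightarrow> real) \<Rightarrow> ('x \<Rightarrow> real) \<Rightarrow> real) \<Rightarrow> bool" where
  "is_invariant_inner G ip \<longleftrightarrow>
     (\<forall>x\<in>fa. \<forall>y\<in>fa. ip x y = ip y x) \<and>
     (\<forall>x\<in>fa. \<forall>y\<in>fa. \<forall>z\<in>fa. \<forall>s t. ip (\<lambda>\<xi>. s * x \<xi> + t * y \<xi>) z = s * ip x z + t * ip y z) \<and>
     (\<forall>x\<in>fa. x \<noteq> (\<lambda>\<xi>. 0) \<longrightarrow> 0 < ip x x) \<and>
     (\<forall>w\<in>weyl_group G. \<forall>x\<in>fa. \<forall>y\<in>fa. ip (weyl_act w x) (weyl_act w y) = ip x y)"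


section \<open>The set \<open>N_G\<close>\<close>

text \<open>Standard parabolic subgroups \<open>P = MN\<close> correspond to subsets \<open>J\<close> of \<open>{1..ssrank G}\<close>:
  \<open>J\<close> indexes the simple roots of \<open>M\<close>, and its complement those occurring in the Lie algebra
  of \<open>N\<close>.\<close>

definition fa_M :: "'x::ab_group_add based_root_datum \<Rightarrow> nat set \<Rightarrow> ('x \<Rightarrow> real) set" where
  "fa_M G J = {x\<in>fa. \<forall>i\<in>J. x (simple G i) = 0}"

definition proj_M :: "'x::ab_group_add based_root_datum \<Rightarrow> nat set \<Rightarrow> ('x \<Rightarrow> real) \<Rightarrow> 'x \<Rightarrow> real" where
  "proj_M G J x =
     (THE y. y \<in> fa_M G J \<and>
        (\<exists>t. \<forall>\<xi>. x \<xi> - y \<xi> = (\<Sum>i\<in>J. t i * of_int (simple_coroot G i \<xi>))))"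

definition Lambda_M :: "'x::ab_group_add based_root_datum \<Rightarrow> nat set \<Rightarrow> ('x \<Rightarrow> real) set" where
  "Lambda_M G J = proj_M G J ` fa_lattice"

definition fa_P_plus :: "'x::ab_group_add based_root_datum \<Rightarrow> nat set \<Rightarrow> ('x \<Rightarrow> real) set" where
  "fa_P_plus G J = {x\<in>fa_M G J. \<forall>i\<in>{1..ssrank G} - J. 0 < x (simple G i)}"

definition NG :: "'x::ab_group_add based_root_datum \<Rightarrow> ('x \<Rightarrow> real) set" where
  "NG G = (\<Union>J\<in>Pow {1..ssrank G}. Lambda_M G J \<inter> fa_P_plus G J)"


section \<open>The retraction \<open>r\<close>\<close>

definition retr ::
  "'x::ab_group_add based_root_datum \<Rightarrow> (('x \<Rightarrow> real) \<Rightarrow> ('x \<Rightarrow> real) \<Rightarrow> real) \<Rightarrow> ('x \<Rightarrow> real) \<Rightarrow> 'x \<Rightarrow> real"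
  where
  "retr G ip x =
     (THE y. y \<in> fa_dom G \<and>
        (\<forall>z\<in>fa_dom G. ip (\<lambda>\<xi>. x \<xi> - y \<xi>) (\<lambda>\<xi>. x \<xi> - y \<xi>) \<le> ip (\<lambda>\<xi>. x \<xi> - z \<xi>) (\<lambda>\<xi>. x \<xi> - z \<xi>)))"

definition coords :: "nat \<Rightarrow> (nat \<Rightarrow> 'x::ab_group_add) \<Rightarrow> ('x \<Rightarrow> real) \<Rightarrow> nat \<Rightarrow> ereal" where
  "coords n \<omega> x = (\<lambda>i\<in>{1..n}. ereal (x (\<omega> i)))"

definition ext_space :: "nat \<Rightarrow> nat \<Rightarrow> (nat \<Rightarrow> ereal) set" where
  "ext_space l n = (\<Pi>\<^sub>E i\<in>{1..n}. if i \<le> l then - {\<infinity>} else range ereal)"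

text \<open>The extension of \<^const>\<open>retr\<close> to \<^const>\<open>ext_space\<close> is unique there, because
  \<^const>\<open>ext_space\<close> is the closure of the image of \<^const>\<open>coords\<close> in it. The topologies are
  the product topologies of the function types, which on \<^const>\<open>fa\<close> is the usual one because
  the character lattice is finitely generated.\<close>

definition retr_ext ::
  "'x::ab_group_add based_root_datum \<Rightarrow> nat \<Rightarrow> (nat \<Rightarrow> 'x) \<Rightarrow> (('x \<Rightarrow> real) \<Rightarrow> ('x \<Rightarrow> real) \<Rightarrow> real) \<Rightarrow>
     (nat \<Rightarrow> ereal) \<Rightarrow> 'x \<Rightarrow> real" where
  "retr_ext G n \<omega> ip =
     (SOME f. continuous_on (ext_space (ssrank G) n) f \<and>
        f ` ext_space (ssrank G) n \<subseteq> fa_dom G \<and>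
        (\<forall>x\<in>fa. f (coords n \<omega> x) = retr G ip x))"


section \<open>The adjoint quotient\<close>

text \<open>A point of the split torus \<open>A\<close> over a field is a homomorphism from the character lattice
  to the multiplicative group of the field.\<close>

definition torus :: "('x::ab_group_add \<Rightarrow> 'f::field) set" where
  "torus = {a. (\<forall>\<xi> \<eta>. a (\<xi> + \<eta>) = a \<xi> * a \<eta>) \<and> (\<forall>\<xi>. a \<xi> \<noteq> 0)}"

definition orbit_sum ::
  "'x::ab_group_add based_root_datum \<Rightarrow> (nat \<Rightarrow> 'x) \<Rightarrow> nat \<Rightarrow> ('x \<Rightarrow> 'f::field) \<Rightarrow> 'f" where
  "orbit_sum G \<omega> i a = (\<Sum>\<xi>\<in>(\<lambda>w. w (\<omega> i)) ` weyl_group G. a \<xi>)"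

text \<open>The orbit sums identify \<open>A / W\<close> with the product of an affine space of dimension \<open>l\<close> and
  a split torus of dimension \<open>n - l\<close>; the following are the points of that product.\<close>

definition adj_quot :: "nat \<Rightarrow> nat \<Rightarrow> (nat \<Rightarrow> 'f::field) set" where
  "adj_quot l n = (\<Pi>\<^sub>E i\<in>{1..n}. if i \<le> l then UNIV else - {0})"

definition adj_map ::
  "'x::ab_group_add based_root_datum \<Rightarrow> nat \<Rightarrow> (nat \<Rightarrow> 'x) \<Rightarrow> ('x \<Rightarrow> 'f::field) \<Rightarrow> nat \<Rightarrow> 'f" where
  "adj_map G n \<omega> a = (\<lambda>i\<in>{1..n}. orbit_sum G \<omega> i a)"

definition dvec :: "'o::idom \<Rightarrow> nat \<Rightarrow> (nat \<Rightarrow> 'o fract) \<Rightarrow> nat \<Rightarrow> ereal" where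
  "dvec \<pi> n c = (\<lambda>i\<in>{1..n}. valF \<pi> (c i))"

definition nu ::
  "('o::idom fract alg_closure \<Rightarrow> ereal) \<Rightarrow> ('x::ab_group_add \<Rightarrow> 'o fract alg_closure) \<Rightarrow> 'x \<Rightarrow> real" where
  "nu w a = (\<lambda>\<xi>. real_of_ereal (w (a \<xi>)))"

definition AF_eq ::
  "'o::idom \<Rightarrow> 'x::ab_group_add based_root_datum \<Rightarrow> nat \<Rightarrow> (nat \<Rightarrow> 'x) \<Rightarrow>
     (('x \<Rightarrow> real) \<Rightarrow> ('x \<Rightarrow> real) \<Rightarrow> real) \<Rightarrow> ('x \<Rightarrow> real) \<Rightarrow> (nat \<Rightarrow> 'o fract) set" where
  "AF_eq \<pi> G n \<omega> ip \<mu> = {c\<in>adj_quot (ssrank G) n. retr_ext G n \<omega> ip (dvec \<pi> n c) = \<mu>}"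

definition AF_le ::
  "'o::idom \<Rightarrow> 'x::ab_group_add based_root_datum \<Rightarrow> nat \<Rightarrow> (nat \<Rightarrow> 'x) \<Rightarrow>
     (('x \<Rightarrow> real) \<Rightarrow> ('x \<Rightarrow> real) \<Rightarrow> real) \<Rightarrow> ('x \<Rightarrow> real) \<Rightarrow> (nat \<Rightarrow> 'o fract) set" where
  "AF_le \<pi> G n \<omega> ip \<mu> = {c\<in>adj_quot (ssrank G) n. dom_le G (retr_ext G n \<omega> ip (dvec \<pi> n c)) \<mu>}"

definition I_mu :: "'x::ab_group_add based_root_datum \<Rightarrow> ('x \<Rightarrow> real) \<Rightarrow> nat set" where
  "I_mu G \<mu> = {i\<in>{1..ssrank G}. \<mu> (simple G i) = 0}"

end

theory Submission
  imports Defs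
begin

text \<open>The point \<open>r(d)\<close> has a description without distances. Write \<open>y\<^sub>i\<close> for the value of
\<open>y\<close> at \<open>\<omega>\<^sub>i\<close>. For a point \<open>d\<close> of the extended coordinate space consider the dominant \<open>y\<close> with
\<open>d\<^sub>i \<le> y\<^sub>i\<close> for \<open>i \<le> l\<close> and \<open>d\<^sub>i = y\<^sub>i\<close> for \<open>i > l\<close>. The off-diagonal entries of
the Cartan matrix are non-positive, so the coordinatewise infimum of all these \<open>y\<close> is again one of
them. This least dominant majorant of \<open>d\<close> is characterised among all majorants by complementarity:
\<open>y\<^sub>i = d\<^sub>i\<close> whenever \<open>\<langle>\<alpha>\<^sub>i, y\<rangle> \<noteq> 0\<close> (\<open>least_dom_iff\<close>). When all coordinates of \<open>d\<close> are real,
that is, \<open>d\<close> is a point \<open>x\<close> of \<open>\<aa>\<close>, complementarity says that \<open>y - x\<close> is a non-negative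
combination of simple coroots orthogonal to \<open>y\<close>, which is the variational characterisation of the
nearest dominant point (\<open>retr_eq_least_dom\<close>). The least dominant majorant depends continuously on
\<open>d\<close>, also at \<open>-\<infinity>\<close>, so it is the extension of the retraction (\<open>retr_ext_eq\<close>).

The description of the sets \<open>A(F)_{\<le>\<mu>}\<close> by inequalities says that the majorant is least, and the
description of the sets \<open>A(F)_\<mu>\<close> is complementarity. For the decomposition into strata, an element
\<open>\<mu>\<close> of \<open>\<aa>\<close> lies in \<open>N_G\<close> if and only if it is dominant and \<open>\<langle>\<omega>\<^sub>i, \<mu>\<rangle>\<close> is an integer for all
\<open>i\<close> outside \<open>I_\<mu>\<close> (\<open>NG_iff\<close>). Complementarity and the integrality of the valuation therefore put
\<open>r(d_c)\<close> in \<open>N_G\<close>. Conversely, \<open>\<mu>\<close> is reached from the point with \<open>c\<^sub>i = 0\<close> for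
\<open>i \<in> I_\<mu>\<close> and \<open>c\<^sub>i\<close> a power of the uniformizer otherwise.

For the comparison with the torus let \<open>y\<close> be the dominant element in the orbit of \<open>\<nu>_a\<close>. The terms of the orbit sum
\<open>c\<^sub>i\<close> have as valuations the numbers \<open>\<langle>w \<omega>\<^sub>i, y\<rangle>\<close>, and these are at most \<open>\<langle>\<omega>\<^sub>i, y\<rangle>\<close>. If
\<open>\<langle>\<alpha>\<^sub>i, y\<rangle> > 0\<close> or \<open>i > l\<close>, the maximum is attained by one term only, and the ultrametric
inequality turns into the equality \<open>val c\<^sub>i = \<langle>\<omega>\<^sub>i, y\<rangle>\<close> (\<open>orbit_sum_val\<close>). So \<open>y\<close> is a majorant of
\<open>d_c\<close> satisfying complementarity, and \<open>r(d_c) = y\<close>.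

The facts about root systems behind this all come from the invariant inner product, which
identifies a root with a positive multiple of its coroot (\<open>ip_coroot\<close>), and from the
fact that every element of the Weyl group is reached from the identity by multiplying on the
right with simple reflections \<open>s\<^sub>i\<close>, each time with \<open>v \<alpha>\<^sub>i\<close> positive for the current element
\<open>v\<close> (\<open>weyl_ascending_induct\<close>). That order of the factors makes it possible to compare \<open>y\<close> with
its Weyl conjugates one step at a time.\<close>

section \<open>Coordinates on the character lattice\<close>

lemma sum_mult_delta:
  fixes f :: "'a \<Rightarrow> real"
  assumes "finite S"
  shows "(\<Sum>i\<in>S. f i * (if i = j then 1 else 0)) = (if j \<in> S then f j else 0)"
    and "(\<Sum>i\<in>S. f i * (if j = i then 1 else 0)) = (if j \<in> S then f j else 0)"
  using assms by (simp_all add: if_distrib[of "\<lambda>x. _ * x"] cong: if_cong)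

locale weighted_datum =
  fixes G :: "'x::ab_group_add based_root_datum"
    and n :: nat
    and \<omega> :: "nat \<Rightarrow> 'x"
    and ip :: "('x \<Rightarrow> real) \<Rightarrow> ('x \<Rightarrow> real) \<Rightarrow> real"
  assumes datum: "is_based_root_datum G n"
    and weights: "is_weight_choice G n \<omega>"
    and inner: "is_invariant_inner G ip"
begin

(* Keeps the index sets {1..l} and {1..n} from being rewritten to {Suc 0..l} and {Suc 0..n}. *)
lemmas [simp del] = One_nat_def

abbreviation (input) l :: nat where "l \<equiv> ssrank G"
abbreviation \<alpha> :: "nat \<Rightarrow> 'x" where "\<alpha> i \<equiv> simple G i"

definition rcoroot :: "'x \<Rightarrow> 'x \<Rightarrow> real" where
  "rcoroot \<beta> \<xi> = of_int (coroot G \<beta> \<xi>)"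

lemma fa_add: "x \<in> fa \<Longrightarrow> x (\<xi> + \<eta>) = x \<xi> + x \<eta>"
  by (simp add: fa_def)

lemma fa_zero_arg: "x \<in> fa \<Longrightarrow> x 0 = 0"
  using fa_add[of x 0 0] by simp

lemma fa_minus: "x \<in> fa \<Longrightarrow> x (- \<xi>) = - x \<xi>"
  using fa_add[of x \<xi> "- \<xi>"] fa_zero_arg[of x] by simp

lemma fa_diff: "x \<in> fa \<Longrightarrow> x (\<xi> - \<eta>) = x \<xi> - x \<eta>"
  using fa_add[of x \<xi> "- \<eta>"] fa_minus[of x \<eta>] by simp

lemma fa_sum: "x \<in> fa \<Longrightarrow> x (\<Sum>i\<in>I. f i) = (\<Sum>i\<in>I. x (f i))"
  by (induction I rule: infinite_finite_induct) (simp_all add: fa_zero_arg fa_add)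

lemma fa_zmult: "x \<in> fa \<Longrightarrow> x (zmult k \<xi>) = of_int k * x \<xi>"
  by (cases "0 \<le> k") (simp_all add: zmult_def fa_sum fa_minus)

lemma diff_in_fa: "x \<in> fa \<Longrightarrow> y \<in> fa \<Longrightarrow> (\<lambda>\<xi>. x \<xi> - y \<xi>) \<in> fa"
  by (auto simp: fa_def algebra_simps)

lemma add_in_fa: "x \<in> fa \<Longrightarrow> y \<in> fa \<Longrightarrow> (\<lambda>\<xi>. x \<xi> + y \<xi>) \<in> fa"
  by (auto simp: fa_def algebra_simps)

lemma scale_in_fa: "x \<in> fa \<Longrightarrow> (\<lambda>\<xi>. s * x \<xi>) \<in> fa"
  by (auto simp: fa_def algebra_simps)

lemma zero_in_fa: "(\<lambda>\<xi>. 0) \<in> fa"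
  by (auto simp: fa_def)

lemma sum_in_fa: "(\<And>i. i \<in> I \<Longrightarrow> v i \<in> fa) \<Longrightarrow> (\<lambda>\<xi>. \<Sum>i\<in>I. t i * v i \<xi>) \<in> fa"
  by (simp add: fa_def distrib_left sum.distrib)

lemma root_facts:
  shows finite_roots: "finite (roots G)"
    and coroot_cochars: "\<beta> \<in> roots G \<Longrightarrow> coroot G \<beta> \<in> cochars"
    and coroot_self: "\<beta> \<in> roots G \<Longrightarrow> coroot G \<beta> \<beta> = 2"
    and refl_root: "\<beta> \<in> roots G \<Longrightarrow> \<gamma> \<in> roots G \<Longrightarrow> root_refl G \<beta> \<gamma> \<in> roots G"
    and root_multiple: "\<beta> \<in> roots G \<Longrightarrow> zmult k \<beta> \<in> roots G \<Longrightarrow> k = 1 \<or> k = - 1"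
  using datum unfolding is_based_root_datum_def is_reduced_root_datum_def by blast+

lemma simple_root: "i \<in> {1..l} \<Longrightarrow> \<alpha> i \<in> roots G"
  using datum by (auto simp: is_based_root_datum_def is_root_base_def)

lemma rcoroot_in_fa: "\<beta> \<in> roots G \<Longrightarrow> rcoroot \<beta> \<in> fa"
  using coroot_cochars by (auto simp: fa_def cochars_def rcoroot_def)

lemma rcoroot_self: "\<beta> \<in> roots G \<Longrightarrow> rcoroot \<beta> \<beta> = 2"
  by (simp add: rcoroot_def coroot_self)

lemma fa_refl: "x \<in> fa \<Longrightarrow> x (root_refl G \<beta> \<xi>) = x \<xi> - rcoroot \<beta> \<xi> * x \<beta>"
  by (simp add: root_refl_def fa_diff fa_zmult rcoroot_def)

lemma l_le_n: "l \<le> n"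
  using weights by (simp add: is_weight_choice_def)

lemma rcoroot_weight: "i \<in> {1..l} \<Longrightarrow> j \<in> {1..l} \<Longrightarrow> rcoroot (\<alpha> j) (\<omega> i) = (if i = j then 1 else 0)"
  using weights by (simp add: is_weight_choice_def rcoroot_def)

lemma central_weights: "is_Z_basis \<omega> {l+1..n} (chars_D G)"
  using weights by (simp add: is_weight_choice_def)

interpretation Z: Modules.module "zmult :: int \<Rightarrow> 'x \<Rightarrow> 'x"
  by (rule module_zmult)

lemma rcoroot_central_weight: "i \<in> {1..l} \<Longrightarrow> j \<in> {l+1..n} \<Longrightarrow> rcoroot (\<alpha> i) (\<omega> j) = 0"
proof -
  assume i: "i \<in> {1..l}" and j: "j \<in> {l+1..n}"
  have "\<omega> j \<in> Z.span (\<omega> ` {l+1..n})" using j by (intro Z.span_base) blast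
  then have "\<omega> j \<in> chars_D G" using central_weights by (simp add: is_Z_basis_def)
  then show ?thesis using i by (simp add: chars_D_def rcoroot_def)
qed

lemma rcoroot_simple_weight: "i \<in> {1..l} \<Longrightarrow> j \<in> {1..n} \<Longrightarrow> rcoroot (\<alpha> i) (\<omega> j) = (if i = j then 1 else 0)"
  using rcoroot_weight[of j i] rcoroot_central_weight[of i j] by (cases "j \<le> l") auto

lemma central_expansion:
  assumes "\<xi> \<in> chars_D G"
  obtains m where "\<xi> = (\<Sum>i=l+1..n. zmult (m i) (\<omega> i))"
proof -
  have inj: "inj_on \<omega> {l+1..n}" and sp: "\<xi> \<in> Z.span (\<omega> ` {l+1..n})"
    using assms central_weights by (simp_all add: is_Z_basis_def)
  obtain u where "\<xi> = (\<Sum>v\<in>\<omega> ` {l+1..n}. zmult (u v) v)"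
    using sp by (subst (asm) Z.span_finite) auto
  then have "\<xi> = (\<Sum>i=l+1..n. zmult (u (\<omega> i)) (\<omega> i))"
    using inj by (simp add: sum.reindex)
  then show ?thesis by (rule that)
qed

lemma central_independent:
  assumes "(\<Sum>i=l+1..n. zmult (m i) (\<omega> i)) = 0" "i \<in> {l+1..n}"
  shows "m i = 0"
proof -
  have inj: "inj_on \<omega> {l+1..n}" and indep: "\<not> Z.dependent (\<omega> ` {l+1..n})"
    using central_weights by (simp_all add: is_Z_basis_def)
  define u where "u v = m (the_inv_into {l+1..n} \<omega> v)" for v
  have u: "u (\<omega> i) = m i" if "i \<in> {l+1..n}" for i
    unfolding u_def using the_inv_into_f_f[OF inj that] by simp
  have "(\<Sum>v\<in>\<omega> ` {l+1..n}. zmult (u v) v) = (\<Sum>i=l+1..n. zmult (u (\<omega> i)) (\<omega> i))"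
    using inj by (simp add: sum.reindex)
  also have "\<dots> = (\<Sum>i=l+1..n. zmult (m i) (\<omega> i))"
    by (intro sum.cong) (simp_all add: u)
  finally have "(\<Sum>v\<in>\<omega> ` {l+1..n}. zmult (u v) v) = 0" using assms(1) by simp
  then have "u (\<omega> i) = 0"
    using indep assms(2) Z.independentD[of "\<omega> ` {l+1..n}" "\<omega> ` {l+1..n}" u "\<omega> i"] by blast
  then show ?thesis using u assms(2) by simp
qed

text \<open>Subtracting \<open>\<Sum> \<langle>\<xi>, \<alpha>\<^sub>i\<^sup>\<or>\<rangle> \<omega>\<^sub>i\<close> from \<open>\<xi>\<close> leaves a character that is killed by all simple coroots.
Such a character is a combination of the remaining \<open>\<omega>\<^sub>j\<close>. With the independence below, the
\<open>\<omega>\<^sub>i\<close> therefore form a basis of the character lattice, and points of \<open>\<aa>\<close> are coordinate vectors.\<close>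

lemma weight_expansion: "\<exists>m. \<xi> = (\<Sum>i=1..n. zmult (m i) (\<omega> i))"
proof -
  define \<eta> where "\<eta> = \<xi> - (\<Sum>i=1..l. zmult (coroot G (\<alpha> i) \<xi>) (\<omega> i))"
  have "coroot G (\<alpha> j) \<eta> = 0" if j: "j \<in> {1..l}" for j
  proof -
    have "rcoroot (\<alpha> j) \<eta> = rcoroot (\<alpha> j) \<xi> - (\<Sum>i=1..l. rcoroot (\<alpha> i) \<xi> * rcoroot (\<alpha> j) (\<omega> i))"
      unfolding \<eta>_def using rcoroot_in_fa[OF simple_root[OF j]]
      by (simp add: fa_diff fa_sum fa_zmult) (simp add: rcoroot_def)
    also have "(\<Sum>i=1..l. rcoroot (\<alpha> i) \<xi> * rcoroot (\<alpha> j) (\<omega> i)) =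
        (\<Sum>i=1..l. rcoroot (\<alpha> i) \<xi> * (if i = j then 1 else 0))"
      using j by (intro sum.cong) (simp_all add: rcoroot_weight)
    also have "rcoroot (\<alpha> j) \<xi> - \<dots> = 0" using j by (simp add: sum_mult_delta)
    finally show ?thesis by (simp add: rcoroot_def)
  qed
  then have "\<eta> \<in> chars_D G" by (simp add: chars_D_def)
  then obtain m where m: "\<eta> = (\<Sum>i=l+1..n. zmult (m i) (\<omega> i))" by (rule central_expansion)
  let ?m = "\<lambda>i. if i \<le> l then coroot G (\<alpha> i) \<xi> else m i"
  have "{1..n} = {1..l} \<union> {l+1..n}" using l_le_n by auto
  then have "(\<Sum>i=1..n. zmult (?m i) (\<omega> i)) =
      (\<Sum>i=1..l. zmult (?m i) (\<omega> i)) + (\<Sum>i=l+1..n. zmult (?m i) (\<omega> i))"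
    by (simp add: sum.union_disjoint)
  also have "\<dots> = (\<Sum>i=1..l. zmult (coroot G (\<alpha> i) \<xi>) (\<omega> i)) + \<eta>"
    unfolding m by (intro arg_cong2[where f = "(+)"] sum.cong) auto
  also have "\<dots> = \<xi>" by (simp add: \<eta>_def)
  finally show ?thesis by metis
qed

lemma weight_independent:
  assumes z: "(\<Sum>i=1..n. zmult (m i) (\<omega> i)) = 0" and i: "i \<in> {1..n}"
  shows "m i = 0"
proof -
  have simple: "m j = 0" if j: "j \<in> {1..l}" for j
  proof -
    have "0 = (\<Sum>i=1..n. of_int (m i) * rcoroot (\<alpha> j) (\<omega> i))"
      using fa_zero_arg[OF rcoroot_in_fa[OF simple_root[OF j]]] unfolding z[symmetric]
      by (simp add: fa_sum fa_zmult rcoroot_in_fa[OF simple_root[OF j]])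
    also have "\<dots> = (\<Sum>i=1..n. of_int (m i) * (if j = i then 1 else 0))"
      using j by (intro sum.cong) (simp_all add: rcoroot_simple_weight)
    also have "\<dots> = m j" using j l_le_n by (simp add: sum_mult_delta)
    finally show ?thesis by simp
  qed
  show ?thesis
  proof (cases "i \<le> l")
    case True
    then show ?thesis using simple i by simp
  next
    case False
    have "(\<Sum>i=l+1..n. zmult (m i) (\<omega> i)) = (\<Sum>i=1..n. zmult (m i) (\<omega> i))"
      using simple by (intro sum.mono_neutral_left) (auto simp: zmult_0)
    then show ?thesis using z central_independent[of m i] i False by simp
  qed
qed

definition wcoord :: "'x \<Rightarrow> nat \<Rightarrow> int" where
  "wcoord \<xi> = (SOME m. \<xi> = (\<Sum>i=1..n. zmult (m i) (\<omega> i)))"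

lemma wcoord: "(\<Sum>i=1..n. zmult (wcoord \<xi> i) (\<omega> i)) = \<xi>"
  unfolding wcoord_def using someI_ex[OF weight_expansion[of \<xi>]] by simp

lemma wcoord_unique:
  assumes "\<xi> = (\<Sum>i=1..n. zmult (m i) (\<omega> i))" "i \<in> {1..n}"
  shows "wcoord \<xi> i = m i"
proof -
  have "(\<Sum>i=1..n. zmult (wcoord \<xi> i - m i) (\<omega> i)) = 0"
    using assms(1) wcoord[of \<xi>] Z.scale_left_diff_distrib by (simp add: sum_subtractf)
  from weight_independent[OF this assms(2)] show ?thesis by simp
qed

lemma wcoord_add: "i \<in> {1..n} \<Longrightarrow> wcoord (\<xi> + \<eta>) i = wcoord \<xi> i + wcoord \<eta> i"
  by (rule wcoord_unique) (simp_all add: zmult_add_left sum.distrib wcoord)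

lemma wcoord_weight: "i \<in> {1..n} \<Longrightarrow> j \<in> {1..n} \<Longrightarrow> wcoord (\<omega> i) j = (if j = i then 1 else 0)"
proof (rule wcoord_unique)
  assume i: "i \<in> {1..n}"
  have "(\<Sum>j=1..n. zmult (if j = i then 1 else 0) (\<omega> j)) = (\<Sum>j=1..n. if j = i then \<omega> j else 0)"
    by (intro sum.cong) (auto simp: zmult_0 zmult_1)
  then show "\<omega> i = (\<Sum>j=1..n. zmult (if j = i then 1 else 0) (\<omega> j))" using i by simp
qed

definition from_coords :: "(nat \<Rightarrow> real) \<Rightarrow> 'x \<Rightarrow> real" where
  "from_coords v \<xi> = (\<Sum>i=1..n. v i * of_int (wcoord \<xi> i))"

lemma from_coords_in_fa: "from_coords v \<in> fa"
  by (simp add: fa_def from_coords_def wcoord_add algebra_simps sum.distrib)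

lemma from_coords_weight: "i \<in> {1..n} \<Longrightarrow> from_coords v (\<omega> i) = v i"
  by (simp add: from_coords_def wcoord_weight if_distrib[of real_of_int] if_distrib[of "\<lambda>x. _ * x"] cong: if_cong)

lemma fa_expand: "x \<in> fa \<Longrightarrow> x \<xi> = (\<Sum>i=1..n. x (\<omega> i) * of_int (wcoord \<xi> i))"
proof -
  assume x: "x \<in> fa"
  have "x \<xi> = x (\<Sum>i=1..n. zmult (wcoord \<xi> i) (\<omega> i))" by (simp only: wcoord)
  also have "\<dots> = (\<Sum>i=1..n. x (\<omega> i) * of_int (wcoord \<xi> i))"
    using x by (simp only: fa_sum fa_zmult mult.commute)
  finally show ?thesis .
qed

lemma fa_eqI:
  assumes "x \<in> fa" "y \<in> fa" "\<And>i. i \<in> {1..n} \<Longrightarrow> x (\<omega> i) = y (\<omega> i)"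
  shows "x = y"
proof
  fix \<xi>
  show "x \<xi> = y \<xi>" using assms by (simp add: fa_expand[of _ \<xi>])
qed

lemma coroot_comb_weight:
  assumes "J \<subseteq> {1..l}" "i \<in> {1..n}"
  shows "(\<Sum>j\<in>J. t j * rcoroot (\<alpha> j) (\<omega> i)) = (if i \<in> J then t i else 0)"
proof -
  have "(\<Sum>j\<in>J. t j * rcoroot (\<alpha> j) (\<omega> i)) = (\<Sum>j\<in>J. if j = i then t j else 0)"
    using assms by (intro sum.cong) (auto simp: rcoroot_simple_weight subset_iff)
  then show ?thesis using finite_subset[OF assms(1)] by simp
qed

lemma coroot_comb_in_fa: "J \<subseteq> {1..l} \<Longrightarrow> (\<lambda>\<xi>. \<Sum>j\<in>J. t j * rcoroot (\<alpha> j) \<xi>) \<in> fa"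
  by (rule sum_in_fa) (blast intro: rcoroot_in_fa simple_root)

text \<open>The coordinates with respect to the \<open>\<omega>\<^sub>i\<close> of a combination of simple coroots are its coefficients,
so the vanishing of all other coordinates detects membership in a span of simple coroots.\<close>

lemma coroot_span:
  assumes "x \<in> fa" and "J \<subseteq> {1..l}" and "\<And>j. j \<in> {1..n} - J \<Longrightarrow> x (\<omega> j) = 0"
  shows "x = (\<lambda>\<xi>. \<Sum>i\<in>J. x (\<omega> i) * rcoroot (\<alpha> i) \<xi>)"
  by (rule fa_eqI[OF assms(1) coroot_comb_in_fa[OF assms(2)]])
    (use assms in \<open>simp add: coroot_comb_weight\<close>)

lemma dom_le_iff:
  assumes "x \<in> fa" "y \<in> fa"
  shows "dom_le G x y \<longleftrightarrow>
    (\<forall>i\<in>{1..l}. x (\<omega> i) \<le> y (\<omega> i)) \<and> (\<forall>i\<in>{l+1..n}. x (\<omega> i) = y (\<omega> i))"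
proof
  assume "dom_le G x y"
  then obtain t where t: "\<And>i. i \<in> {1..l} \<Longrightarrow> 0 \<le> t i"
    and e: "\<And>\<xi>. y \<xi> - x \<xi> = (\<Sum>i\<in>{1..l}. t i * rcoroot (\<alpha> i) \<xi>)"
    unfolding dom_le_def rcoroot_def by blast
  have d: "y (\<omega> i) - x (\<omega> i) = (if i \<in> {1..l} then t i else 0)" if "i \<in> {1..n}" for i
    unfolding e by (rule coroot_comb_weight) (use that in auto)
  then show "(\<forall>i\<in>{1..l}. x (\<omega> i) \<le> y (\<omega> i)) \<and> (\<forall>i\<in>{l+1..n}. x (\<omega> i) = y (\<omega> i))"
  proof (intro conjI ballI)
    fix i assume i: "i \<in> {1..l}"
    then show "x (\<omega> i) \<le> y (\<omega> i)" using d[of i] t[OF i] l_le_n by simp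
  next
    fix i assume "i \<in> {l+1..n}"
    then show "x (\<omega> i) = y (\<omega> i)" using d[of i] by simp
  qed
next
  assume r: "(\<forall>i\<in>{1..l}. x (\<omega> i) \<le> y (\<omega> i)) \<and> (\<forall>i\<in>{l+1..n}. x (\<omega> i) = y (\<omega> i))"
  have "(\<lambda>\<xi>. y \<xi> - x \<xi>) = (\<lambda>\<xi>. \<Sum>i\<in>{1..l}. (y (\<omega> i) - x (\<omega> i)) * rcoroot (\<alpha> i) \<xi>)"
    by (rule coroot_span) (use r assms in \<open>auto intro: diff_in_fa\<close>)
  then have "\<forall>\<xi>. y \<xi> - x \<xi> = (\<Sum>i=1..l. (y (\<omega> i) - x (\<omega> i)) * of_int (coroot G (\<alpha> i) \<xi>))"
    unfolding rcoroot_def by meson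
  moreover have "\<forall>i\<in>{1..l}. 0 \<le> y (\<omega> i) - x (\<omega> i)" using r by simp
  ultimately show "dom_le G x y" unfolding dom_le_def by (intro exI conjI)
qed

section \<open>The invariant inner product\<close>

lemma refl_refl: "\<beta> \<in> roots G \<Longrightarrow> root_refl G \<beta> (root_refl G \<beta> \<xi>) = \<xi>"
proof -
  assume b: "\<beta> \<in> roots G"
  have "rcoroot \<beta> (root_refl G \<beta> \<xi>) = - rcoroot \<beta> \<xi>"
    using b by (simp add: fa_refl rcoroot_in_fa rcoroot_self)
  then have "coroot G \<beta> (root_refl G \<beta> \<xi>) = - coroot G \<beta> \<xi>"
    unfolding rcoroot_def by linarith
  then show ?thesis
    unfolding root_refl_def[of G \<beta> "root_refl G \<beta> \<xi>"]
    by (simp add: zmult_minus) (simp add: root_refl_def)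
qed

lemma refl_in_weyl: "\<beta> \<in> roots G \<Longrightarrow> root_refl G \<beta> \<in> weyl_group G"
  using weyl_group.step[OF weyl_group.one, of \<beta>] by (simp add: comp_def)

lemma refl_fa_in_fa: "\<beta> \<in> roots G \<Longrightarrow> x \<in> fa \<Longrightarrow> (\<lambda>\<xi>. x (root_refl G \<beta> \<xi>)) \<in> fa"
  using diff_in_fa[OF _ scale_in_fa[OF rcoroot_in_fa], of x \<beta> "x \<beta>"] by (simp add: fa_refl mult.commute)

lemma ip_sym: "x \<in> fa \<Longrightarrow> y \<in> fa \<Longrightarrow> ip x y = ip y x"
  and ip_lincomb: "x \<in> fa \<Longrightarrow> y \<in> fa \<Longrightarrow> z \<in> fa \<Longrightarrow>
    ip (\<lambda>\<xi>. s * x \<xi> + t * y \<xi>) z = s * ip x z + t * ip y z"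
  and ip_pos: "x \<in> fa \<Longrightarrow> x \<noteq> (\<lambda>\<xi>. 0) \<Longrightarrow> 0 < ip x x"
  and ip_weyl: "w \<in> weyl_group G \<Longrightarrow> x \<in> fa \<Longrightarrow> y \<in> fa \<Longrightarrow>
    ip (weyl_act w x) (weyl_act w y) = ip x y"
  using inner unfolding is_invariant_inner_def by blast+

lemma ip_refl:
  assumes "\<beta> \<in> roots G" "x \<in> fa" "y \<in> fa"
  shows "ip (\<lambda>\<xi>. x (root_refl G \<beta> \<xi>)) (\<lambda>\<xi>. y (root_refl G \<beta> \<xi>)) = ip x y"
proof -
  have "inv_into UNIV (root_refl G \<beta>) = root_refl G \<beta>"
    using refl_refl[OF assms(1)] by (intro inv_equality) auto
  then show ?thesis
    using ip_weyl[OF refl_in_weyl, of \<beta> x y] assms by (simp add: weyl_act_def comp_def)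
qed

lemma ip_zero: "z \<in> fa \<Longrightarrow> ip (\<lambda>\<xi>. 0) z = 0"
  using ip_lincomb[of z z z 0 0] by simp

lemma ip_add: "x \<in> fa \<Longrightarrow> y \<in> fa \<Longrightarrow> z \<in> fa \<Longrightarrow> ip (\<lambda>\<xi>. x \<xi> + y \<xi>) z = ip x z + ip y z"
  using ip_lincomb[of x y z 1 1] by simp

lemma ip_diff: "x \<in> fa \<Longrightarrow> y \<in> fa \<Longrightarrow> z \<in> fa \<Longrightarrow> ip (\<lambda>\<xi>. x \<xi> - y \<xi>) z = ip x z - ip y z"
  using ip_lincomb[of x y z 1 "-1"] by simp

lemma ip_scale: "x \<in> fa \<Longrightarrow> z \<in> fa \<Longrightarrow> ip (\<lambda>\<xi>. s * x \<xi>) z = s * ip x z"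
  using ip_lincomb[of x x z s 0] by simp

lemma ip_add_right: "x \<in> fa \<Longrightarrow> y \<in> fa \<Longrightarrow> z \<in> fa \<Longrightarrow> ip z (\<lambda>\<xi>. x \<xi> + y \<xi>) = ip z x + ip z y"
  using ip_add[of x y z] by (simp add: ip_sym add_in_fa)

lemma ip_diff_right: "x \<in> fa \<Longrightarrow> y \<in> fa \<Longrightarrow> z \<in> fa \<Longrightarrow> ip z (\<lambda>\<xi>. x \<xi> - y \<xi>) = ip z x - ip z y"
  using ip_diff[of x y z] by (simp add: ip_sym diff_in_fa)

lemma ip_scale_right: "x \<in> fa \<Longrightarrow> z \<in> fa \<Longrightarrow> ip z (\<lambda>\<xi>. s * x \<xi>) = s * ip z x"
  using ip_scale[of x z] by (simp add: ip_sym scale_in_fa)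

lemma ip_sum:
  assumes "\<And>i. i \<in> I \<Longrightarrow> v i \<in> fa" "z \<in> fa"
  shows "ip (\<lambda>\<xi>. \<Sum>i\<in>I. t i * v i \<xi>) z = (\<Sum>i\<in>I. t i * ip (v i) z)"
  using assms(1)
proof (induction I rule: infinite_finite_induct)
  case (insert i I)
  have "ip (\<lambda>\<xi>. t i * v i \<xi> + (\<Sum>i\<in>I. t i * v i \<xi>)) z
      = t i * ip (v i) z + ip (\<lambda>\<xi>. \<Sum>i\<in>I. t i * v i \<xi>) z"
    using ip_lincomb[of "v i" "\<lambda>\<xi>. \<Sum>i\<in>I. t i * v i \<xi>" z "t i" 1] insert.prems assms(2)
      sum_in_fa[of I v t] by simp
  then show ?case using insert by simp
qed (simp_all add: ip_zero assms(2))

lemma ip_le_zero: "x \<in> fa \<Longrightarrow> ip x x \<le> 0 \<Longrightarrow> x = (\<lambda>\<xi>. 0)"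
  using ip_pos[of x] by linarith

lemma rcoroot_norm_pos: "\<beta> \<in> roots G \<Longrightarrow> 0 < ip (rcoroot \<beta>) (rcoroot \<beta>)"
  using rcoroot_self[of \<beta>] by (intro ip_pos rcoroot_in_fa) auto

text \<open>The reflection in \<open>\<beta>\<close> is an isometry that negates \<open>\<beta>\<^sup>\<or>\<close>, which forces the inner product with
\<open>\<beta>\<^sup>\<or>\<close> to be proportional to evaluation at \<open>\<beta>\<close>.\<close>

lemma ip_coroot:
  assumes b: "\<beta> \<in> roots G" and x: "x \<in> fa"
  shows "2 * ip (rcoroot \<beta>) x = ip (rcoroot \<beta>) (rcoroot \<beta>) * x \<beta>"
proof -
  have "ip (rcoroot \<beta>) x = ip (\<lambda>\<xi>. rcoroot \<beta> (root_refl G \<beta> \<xi>)) (\<lambda>\<xi>. x (root_refl G \<beta> \<xi>))"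
    using ip_refl[OF b rcoroot_in_fa[OF b] x] by simp
  also have "\<dots> = ip (\<lambda>\<xi>. (-1) * rcoroot \<beta> \<xi>) (\<lambda>\<xi>. x \<xi> - x \<beta> * rcoroot \<beta> \<xi>)"
    by (simp add: fa_refl[OF rcoroot_in_fa[OF b]] fa_refl[OF x] rcoroot_self[OF b] mult.commute[of "x \<beta>"])
  also have "\<dots> = - (ip (rcoroot \<beta>) x - x \<beta> * ip (rcoroot \<beta>) (rcoroot \<beta>))"
    using b x by (subst ip_scale)
      (simp_all add: rcoroot_in_fa diff_in_fa scale_in_fa ip_diff_right ip_scale_right)
  finally show ?thesis by (simp add: algebra_simps)
qed

text \<open>The axioms only say that reflections permute the coroots as a set. Both sides, as vectors in \<open>\<aa>\<close>,
induce through the inner product a multiple of evaluation at \<open>s_\<gamma> \<beta>\<close>, with factor half their squared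
length. Two vectors with this property are equal.\<close>

lemma coroot_refl_root:
  assumes a: "\<gamma> \<in> roots G" and b: "\<beta> \<in> roots G"
  shows "coroot G (root_refl G \<gamma> \<beta>) \<xi> = coroot G \<beta> (root_refl G \<gamma> \<xi>)"
proof -
  let ?s = "root_refl G \<gamma>"
  define u where "u = rcoroot (?s \<beta>)"
  define v where "v = (\<lambda>\<xi>. rcoroot \<beta> (?s \<xi>))"
  have sb: "?s \<beta> \<in> roots G" using a b by (rule refl_root)
  have fa: "u \<in> fa" "v \<in> fa"
    unfolding u_def v_def using a b sb by (auto intro: rcoroot_in_fa refl_fa_in_fa)
  have vv: "ip v v = ip (rcoroot \<beta>) (rcoroot \<beta>)"
    unfolding v_def by (rule ip_refl) (use a b in \<open>auto intro: rcoroot_in_fa\<close>)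
  have pos_root: "0 < ip u u" "0 < ip v v"
    unfolding vv unfolding u_def using rcoroot_norm_pos sb b by auto
  have ux: "2 * ip u x = ip u u * x (?s \<beta>)" if "x \<in> fa" for x
    unfolding u_def using sb that by (rule ip_coroot)
  have vx: "2 * ip v x = ip v v * x (?s \<beta>)" if x: "x \<in> fa" for x
  proof -
    have "ip v x = ip (\<lambda>\<xi>. v (?s \<xi>)) (\<lambda>\<xi>. x (?s \<xi>))" using ip_refl[OF a fa(2) x] by simp
    also have "\<dots> = ip (rcoroot \<beta>) (\<lambda>\<xi>. x (?s \<xi>))" unfolding v_def using refl_refl[OF a] by simp
    finally show ?thesis using ip_coroot[OF b refl_fa_in_fa[OF a x]] vv by simp
  qed
  have e: "ip v v * ip u x = ip u u * ip v x" if "x \<in> fa" for x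
    using ux[OF that] vx[OF that] by (metis mult.left_commute mult_left_cancel zero_neq_numeral)
  have uv: "ip u v = ip u u" using e[OF fa(2)] pos_root by simp
  have vu: "ip u v = ip v v" using e[OF fa(1)] pos_root ip_sym[OF fa] by simp
  have "ip (\<lambda>\<xi>. u \<xi> - v \<xi>) (\<lambda>\<xi>. u \<xi> - v \<xi>) = 0"
    using fa uv vu by (simp add: ip_diff ip_diff_right diff_in_fa ip_sym[of v u])
  then have "(\<lambda>\<xi>. u \<xi> - v \<xi>) = (\<lambda>\<xi>. 0)" using ip_le_zero[OF diff_in_fa[OF fa]] by simp
  then have "u \<xi> = v \<xi>" by (simp add: fun_eq_iff)
  then show ?thesis by (simp add: u_def v_def rcoroot_def)
qed

text \<open>Gram-Schmidt, one vector at a time: a new vector \<open>v k\<close> is replaced by its component \<open>e\<close> orthogonal to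
the earlier ones. The earlier vectors may be dependent; if \<open>e\<close> vanishes, nothing has to be corrected.\<close>

lemma orthogonal_projection:
  assumes "finite J" "\<And>j. j \<in> J \<Longrightarrow> v j \<in> fa" "x \<in> fa"
  shows "\<exists>t. \<forall>i\<in>J. ip (\<lambda>\<xi>. x \<xi> - (\<Sum>j\<in>J. t j * v j \<xi>)) (v i) = 0"
  using assms
proof (induction J arbitrary: x)
  case empty
  then show ?case by simp
next
  case (insert k J)
  have vk: "v k \<in> fa" and vJ: "\<And>j. j \<in> J \<Longrightarrow> v j \<in> fa" using insert.prems by auto
  obtain t where t: "\<forall>i\<in>J. ip (\<lambda>\<xi>. x \<xi> - (\<Sum>j\<in>J. t j * v j \<xi>)) (v i) = 0"
    using insert.IH[OF vJ insert.prems(2)] by blast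
  obtain s where s: "\<forall>i\<in>J. ip (\<lambda>\<xi>. v k \<xi> - (\<Sum>j\<in>J. s j * v j \<xi>)) (v i) = 0"
    using insert.IH[OF vJ vk] by blast
  define p where "p = (\<lambda>\<xi>. x \<xi> - (\<Sum>j\<in>J. t j * v j \<xi>))"
  define e where "e = (\<lambda>\<xi>. v k \<xi> - (\<Sum>j\<in>J. s j * v j \<xi>))"
  define c where "c = ip p (v k) / ip e (v k)"
  define r where "r = (\<lambda>j. if j = k then c else t j - c * s j)"
  have fa: "p \<in> fa" "e \<in> fa"
    unfolding p_def e_def using vJ vk insert.prems(2) by (auto intro!: diff_in_fa sum_in_fa)
  have comb: "(\<lambda>\<xi>. x \<xi> - (\<Sum>j\<in>insert k J. r j * v j \<xi>)) = (\<lambda>\<xi>. p \<xi> - c * e \<xi>)"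
  proof
    fix \<xi>
    have "(\<Sum>j\<in>J. r j * v j \<xi>) = (\<Sum>j\<in>J. t j * v j \<xi> - c * (s j * v j \<xi>))"
      using insert.hyps by (intro sum.cong) (auto simp: r_def algebra_simps)
    also have "\<dots> = (\<Sum>j\<in>J. t j * v j \<xi>) - c * (\<Sum>j\<in>J. s j * v j \<xi>)"
      by (simp add: sum_subtractf sum_distrib_left)
    finally have "(\<Sum>j\<in>J. r j * v j \<xi>) = \<dots>" .
    then show "x \<xi> - (\<Sum>j\<in>insert k J. r j * v j \<xi>) = p \<xi> - c * e \<xi>"
      using insert.hyps by (simp add: p_def e_def r_def algebra_simps)
  qed
  have ek: "ip e (v k) = ip e e"
  proof -
    have "ip e e = ip e (v k) - ip e (\<lambda>\<xi>. \<Sum>j\<in>J. s j * v j \<xi>)"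
      unfolding e_def[of] by (rule ip_diff_right) (use vk vJ fa e_def in \<open>auto intro: sum_in_fa\<close>)
    also have "ip e (\<lambda>\<xi>. \<Sum>j\<in>J. s j * v j \<xi>) = (\<Sum>j\<in>J. s j * ip (v j) e)"
      using vJ fa by (subst ip_sym) (auto simp: ip_sum sum_in_fa)
    also have "\<dots> = 0"
      using s vJ fa(2) ip_sym by (intro sum.neutral) (simp add: e_def[symmetric])
    finally show ?thesis by simp
  qed
  have "ip (\<lambda>\<xi>. p \<xi> - c * e \<xi>) (v i) = 0" if i: "i \<in> insert k J" for i
  proof -
    have vi: "v i \<in> fa" using i insert.prems by auto
    have d: "ip (\<lambda>\<xi>. p \<xi> - c * e \<xi>) (v i) = ip p (v i) - c * ip e (v i)"
      using fa vi by (simp add: ip_diff ip_scale scale_in_fa)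
    show ?thesis
    proof (cases "i = k")
      case True
      show ?thesis
      proof (cases "e = (\<lambda>\<xi>. 0)")
        case e0: True
        then have vk_eq: "v k = (\<lambda>\<xi>. \<Sum>j\<in>J. s j * v j \<xi>)" by (simp add: e_def fun_eq_iff)
        have "ip p (v k) = (\<Sum>j\<in>J. s j * ip (v j) p)"
          unfolding vk_eq using vJ fa by (subst ip_sym) (auto simp: ip_sum sum_in_fa)
        also have "\<dots> = 0"
          using t vJ fa(1) ip_sym by (intro sum.neutral) (simp add: p_def[symmetric])
        finally show ?thesis using d True e0 ek vk ip_zero by simp
      next
        case False
        then have "0 < ip e (v k)" using ip_pos fa ek by simp
        then show ?thesis using d True by (simp add: c_def)
      qed
    next
      case False
      then show ?thesis using d i s t by (simp add: p_def[symmetric] e_def[symmetric])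
    qed
  qed
  then show ?case using comb by (intro exI[of _ r]) simp
qed

lemma coroot_projection:
  assumes J: "J \<subseteq> {1..l}" and x: "x \<in> fa"
  obtains t where "\<And>i. i \<in> J \<Longrightarrow> x (\<alpha> i) - (\<Sum>j\<in>J. t j * rcoroot (\<alpha> j) (\<alpha> i)) = 0"
proof -
  have J': "j \<in> J \<Longrightarrow> \<alpha> j \<in> roots G" for j using J by (intro simple_root) (rule subsetD)
  obtain t where t: "\<forall>i\<in>J. ip (\<lambda>\<xi>. x \<xi> - (\<Sum>j\<in>J. t j * rcoroot (\<alpha> j) \<xi>)) (rcoroot (\<alpha> i)) = 0"
    using orthogonal_projection[of J "\<lambda>j. rcoroot (\<alpha> j)" x] J J' x finite_subset[OF J] rcoroot_in_fa by auto
  show ?thesis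
  proof (rule that[of t])
    fix i assume i: "i \<in> J"
    let ?y = "\<lambda>\<xi>. x \<xi> - (\<Sum>j\<in>J. t j * rcoroot (\<alpha> j) \<xi>)"
    have y: "?y \<in> fa" using x J by (intro diff_in_fa coroot_comb_in_fa)
    have "ip (rcoroot (\<alpha> i)) (rcoroot (\<alpha> i)) * ?y (\<alpha> i) = 2 * ip (rcoroot (\<alpha> i)) ?y"
      using ip_coroot[OF J'[OF i] y] by simp
    also have "\<dots> = 0" using t i ip_sym[OF rcoroot_in_fa[OF J'[OF i]] y] by simp
    finally show "?y (\<alpha> i) = 0" using rcoroot_norm_pos[OF J'[OF i]] by simp
  qed
qed

text \<open>Definiteness of the inner product makes the Cartan matrix of any set of simple roots nonsingular. This
gives the uniqueness of the projection onto \<open>\<aa>_M\<close>, and the previous lemma gives its existence.\<close>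

lemma coroot_comb_orthogonal:
  assumes J: "J \<subseteq> {1..l}" and x: "x = (\<lambda>\<xi>. \<Sum>j\<in>J. t j * rcoroot (\<alpha> j) \<xi>)"
    and z: "\<And>i. i \<in> J \<Longrightarrow> x (\<alpha> i) = 0"
  shows "x = (\<lambda>\<xi>. 0)"
proof -
  have J': "j \<in> J \<Longrightarrow> \<alpha> j \<in> roots G" for j using J by (intro simple_root) (rule subsetD)
  have fa: "x \<in> fa" unfolding x using J by (rule coroot_comb_in_fa)
  have "ip x x = (\<Sum>j\<in>J. t j * ip (rcoroot (\<alpha> j)) x)"
    by (subst (1) x, rule ip_sum) (use J' rcoroot_in_fa fa in auto)
  also have "\<dots> = 0"
  proof (rule sum.neutral, rule ballI)
    fix j assume "j \<in> J"
    then have "2 * ip (rcoroot (\<alpha> j)) x = 0" using ip_coroot[OF J' fa] z by simp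
    then show "t j * ip (rcoroot (\<alpha> j)) x = 0" by simp
  qed
  finally show ?thesis using ip_le_zero[OF fa] by simp
qed

text \<open>The component of \<open>\<alpha>\<^sub>i\<^sup>\<or>\<close> orthogonal to all other simple coroots is, up to a scalar, the fundamental
coweight. The scalar is nonzero because otherwise a combination of simple coroots with coordinate \<open>1\<close>
at \<open>\<omega>\<^sub>i\<close> would be orthogonal to every simple coroot.\<close>

lemma coweight_exists:
  assumes i: "i \<in> {1..l}"
  shows "\<exists>x\<in>fa. (\<forall>j\<in>{1..l}. x (\<alpha> j) = (if j = i then 1 else 0)) \<and> (\<forall>j\<in>{l+1..n}. x (\<omega> j) = 0)"
proof -
  let ?J = "{1..l} - {i}"
  have J: "?J \<subseteq> {1..l}" by blast
  have ai: "\<alpha> i \<in> roots G" by (rule simple_root[OF i])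
  obtain t where t: "\<And>k. k \<in> ?J \<Longrightarrow> rcoroot (\<alpha> i) (\<alpha> k) - (\<Sum>j\<in>?J. t j * rcoroot (\<alpha> j) (\<alpha> k)) = 0"
    using coroot_projection[OF J rcoroot_in_fa[OF ai]] by metis
  define p where "p = (\<lambda>\<xi>. rcoroot (\<alpha> i) \<xi> - (\<Sum>j\<in>?J. t j * rcoroot (\<alpha> j) \<xi>))"
  have fa: "p \<in> fa" unfolding p_def using ai J by (intro diff_in_fa coroot_comb_in_fa rcoroot_in_fa)
  have pw: "p (\<omega> j) = rcoroot (\<alpha> i) (\<omega> j) - (if j \<in> ?J then t j else 0)" if "j \<in> {1..n}" for j
    unfolding p_def using coroot_comb_weight[OF J that, of t] by simp
  have pi1: "p (\<omega> i) = 1" using pw[of i] i l_le_n by (simp add: rcoroot_simple_weight)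
  have pc: "p (\<omega> j) = 0" if "j \<in> {l+1..n}" for j
    using pw[of j] that i by (simp add: rcoroot_simple_weight)
  have p0: "p (\<alpha> k) = 0" if "k \<in> ?J" for k using t[OF that] by (simp add: p_def)
  have nz: "p (\<alpha> i) \<noteq> 0"
  proof
    assume z: "p (\<alpha> i) = 0"
    have "p = (\<lambda>\<xi>. \<Sum>j\<in>{1..l}. p (\<omega> j) * rcoroot (\<alpha> j) \<xi>)"
      by (rule coroot_span[OF fa]) (use pc in auto)
    then have "p = (\<lambda>\<xi>. 0)"
      by (rule coroot_comb_orthogonal[OF order_refl]) (use p0 z in \<open>metis DiffI singletonD\<close>)
    then show False using pi1 by simp
  qed
  show ?thesis
  proof (intro bexI conjI ballI)
    show "(\<lambda>\<xi>. inverse (p (\<alpha> i)) * p \<xi>) \<in> fa" using fa by (rule scale_in_fa)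
  qed (use nz p0 pc in auto)
qed

definition coweight :: "nat \<Rightarrow> 'x \<Rightarrow> real" where
  "coweight i = (SOME x. x \<in> fa \<and> (\<forall>j\<in>{1..l}. x (\<alpha> j) = (if j = i then 1 else 0)) \<and> (\<forall>j\<in>{l+1..n}. x (\<omega> j) = 0))"

lemma coweight:
  assumes "i \<in> {1..l}"
  shows coweight_in_fa: "coweight i \<in> fa"
    and coweight_simple: "\<And>j. j \<in> {1..l} \<Longrightarrow> coweight i (\<alpha> j) = (if j = i then 1 else 0)"
    and coweight_central: "\<And>j. j \<in> {l+1..n} \<Longrightarrow> coweight i (\<omega> j) = 0"
  using someI_ex[OF coweight_exists[OF assms, unfolded Bex_def], folded coweight_def] by blast+

section \<open>Positive roots\<close>

lemma fa_separates:
  fixes \<xi> \<eta> :: "'x"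
  assumes "\<And>x. x \<in> fa \<Longrightarrow> x \<xi> = x \<eta>"
  shows "\<xi> = \<eta>"
proof -
  have "wcoord \<xi> i = wcoord \<eta> i" if i: "i \<in> {1..n}" for i
  proof -
    have c: "from_coords (\<lambda>j. if j = i then 1 else 0) \<zeta> = of_int (wcoord \<zeta> i)" for \<zeta>
      using i sum_mult_delta(1)[of "{1..n}" "\<lambda>j. of_int (wcoord \<zeta> j)" i]
      by (simp add: from_coords_def mult.commute)
    show ?thesis using assms[OF from_coords_in_fa[of "\<lambda>j. if j = i then 1 else 0"]] unfolding c by simp
  qed
  then have "(\<Sum>i=1..n. zmult (wcoord \<xi> i) (\<omega> i)) = (\<Sum>i=1..n. zmult (wcoord \<eta> i) (\<omega> i))"
    by (intro sum.cong) simp_all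
  then show ?thesis by (simp only: wcoord)
qed

text \<open>The value of a fundamental coweight at a root is a coefficient of its expansion in the simple roots, so
positivity can be stated without choosing an expansion.\<close>

definition pos_root :: "'x \<Rightarrow> bool" where
  "pos_root \<beta> \<longleftrightarrow> \<beta> \<in> roots G \<and> (\<forall>i\<in>{1..l}. 0 \<le> coweight i \<beta>)"

lemma root_coeffs:
  assumes "\<beta> \<in> roots G"
  obtains m where "\<beta> = (\<Sum>i=1..l. zmult (m i) (\<alpha> i))"
    and "\<And>i. i \<in> {1..l} \<Longrightarrow> coweight i \<beta> = of_int (m i)"
    and "(\<forall>i\<in>{1..l}. 0 \<le> m i) \<or> (\<forall>i\<in>{1..l}. m i \<le> 0)"
proof -
  obtain m where m: "\<beta> = (\<Sum>i=1..l. zmult (m i) (\<alpha> i))"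
      "(\<forall>i\<in>{1..l}. 0 \<le> m i) \<or> (\<forall>i\<in>{1..l}. m i \<le> 0)"
    using datum assms unfolding is_based_root_datum_def is_root_base_def by blast
  have "coweight i \<beta> = of_int (m i)" if i: "i \<in> {1..l}" for i
  proof -
    have "coweight i \<beta> = (\<Sum>j=1..l. of_int (m j) * coweight i (\<alpha> j))"
      unfolding m(1) using coweight_in_fa[OF i] by (simp add: fa_sum fa_zmult)
    also have "\<dots> = (\<Sum>j=1..l. of_int (m j) * (if j = i then 1 else 0))"
      using i by (intro sum.cong) (simp_all add: coweight_simple)
    also have "\<dots> = of_int (m i)" using i by (simp add: sum_mult_delta)
    finally show ?thesis .
  qed
  with m show ?thesis using that by blast
qed

lemma root_expansion:
  assumes "\<beta> \<in> roots G" "x \<in> fa"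
  shows "x \<beta> = (\<Sum>i=1..l. coweight i \<beta> * x (\<alpha> i))"
proof -
  obtain m where m: "\<beta> = (\<Sum>i=1..l. zmult (m i) (\<alpha> i))"
    and c: "\<And>i. i \<in> {1..l} \<Longrightarrow> coweight i \<beta> = of_int (m i)"
    using root_coeffs[OF assms(1)] by metis
  have "x \<beta> = (\<Sum>i=1..l. of_int (m i) * x (\<alpha> i))"
    by (subst m) (simp add: fa_sum fa_zmult assms(2))
  then show ?thesis using c by simp
qed

lemma pos_or_neg:
  assumes "\<beta> \<in> roots G"
  shows "(\<forall>i\<in>{1..l}. 0 \<le> coweight i \<beta>) \<or> (\<forall>i\<in>{1..l}. coweight i \<beta> \<le> 0)"
proof -
  obtain m where c: "\<And>i. i \<in> {1..l} \<Longrightarrow> coweight i \<beta> = of_int (m i)"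
    and s: "(\<forall>i\<in>{1..l}. 0 \<le> m i) \<or> (\<forall>i\<in>{1..l}. m i \<le> 0)"
    by (rule root_coeffs[OF assms]) blast
  from s show ?thesis
  proof
    assume "\<forall>i\<in>{1..l}. 0 \<le> m i"
    then have "\<forall>i\<in>{1..l}. 0 \<le> coweight i \<beta>" using c by (metis of_int_0_le_iff)
    then show ?thesis ..
  next
    assume "\<forall>i\<in>{1..l}. m i \<le> 0"
    then have "\<forall>i\<in>{1..l}. coweight i \<beta> \<le> 0" using c by (metis of_int_le_0_iff)
    then show ?thesis ..
  qed
qed

lemma simple_pos: "i \<in> {1..l} \<Longrightarrow> pos_root (\<alpha> i)"
  unfolding pos_root_def using coweight_simple simple_root by simp

lemma pos_eq_simple:
  assumes b: "pos_root \<beta>" and i: "i \<in> {1..l}" and z: "\<And>j. j \<in> {1..l} - {i} \<Longrightarrow> coweight j \<beta> = 0"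
  shows "\<beta> = \<alpha> i"
proof -
  have br: "\<beta> \<in> roots G" using b by (simp add: pos_root_def)
  obtain m where m: "\<beta> = (\<Sum>j=1..l. zmult (m j) (\<alpha> j))"
    and c: "\<And>j. j \<in> {1..l} \<Longrightarrow> coweight j \<beta> = of_int (m j)"
    using root_coeffs[OF br] by metis
  have "(\<Sum>j=1..l. zmult (m j) (\<alpha> j)) = (\<Sum>j\<in>{i}. zmult (m j) (\<alpha> j))"
    using i z c by (intro sum.mono_neutral_right) (force simp: zmult_0)+
  then have e: "\<beta> = zmult (m i) (\<alpha> i)" using m by simp
  then have "m i = 1 \<or> m i = - 1" using root_multiple[OF simple_root[OF i], of "m i"] br by simp
  moreover have "0 \<le> coweight i \<beta>" using b i by (simp add: pos_root_def)
  then have "0 \<le> m i" unfolding c[OF i] by simp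
  ultimately show ?thesis using e by (auto simp: zmult_1)
qed

lemma coweight_refl_simple:
  "i \<in> {1..l} \<Longrightarrow> j \<in> {1..l} \<Longrightarrow>
    coweight j (root_refl G (\<alpha> i) \<beta>) = coweight j \<beta> - (if i = j then rcoroot (\<alpha> i) \<beta> else 0)"
  by (simp only: fa_refl[OF coweight_in_fa] coweight_simple) simp

text \<open>The reflection in \<open>\<alpha>\<^sub>i\<close> changes only the coefficient of \<open>\<alpha>\<^sub>i\<close>. If the result were negative, all other
coefficients of \<open>\<beta>\<close> would vanish, and \<open>\<beta>\<close> would be the only positive multiple of \<open>\<alpha>\<^sub>i\<close> that is a root.\<close>

lemma refl_simple_pos:
  assumes b: "pos_root \<beta>" and i: "i \<in> {1..l}" and ne: "\<beta> \<noteq> \<alpha> i"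
  shows "pos_root (root_refl G (\<alpha> i) \<beta>)"
proof (rule ccontr)
  assume n: "\<not> ?thesis"
  have r: "root_refl G (\<alpha> i) \<beta> \<in> roots G"
    using b i by (intro refl_root simple_root) (simp_all add: pos_root_def)
  then have neg: "\<forall>j\<in>{1..l}. coweight j (root_refl G (\<alpha> i) \<beta>) \<le> 0"
    using n pos_or_neg[OF r] unfolding pos_root_def by blast
  have "coweight j \<beta> = 0" if j: "j \<in> {1..l} - {i}" for j
  proof -
    have "coweight j (root_refl G (\<alpha> i) \<beta>) = coweight j \<beta>" using coweight_refl_simple[OF i, of j \<beta>] j by auto
    then have "coweight j \<beta> \<le> 0" using neg j by (metis DiffD1)
    moreover have "0 \<le> coweight j \<beta>" using b j by (simp add: pos_root_def)
    ultimately show ?thesis by simp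
  qed
  from pos_eq_simple[OF b i this] ne show False by simp
qed

text \<open>Otherwise \<open>s\<^sub>j \<alpha>\<^sub>i\<close> would be a root with coefficients of both signs.\<close>

lemma cartan_nonpos:
  assumes i: "i \<in> {1..l}" and j: "j \<in> {1..l}" and ne: "i \<noteq> j"
  shows "rcoroot (\<alpha> j) (\<alpha> i) \<le> 0"
proof (rule ccontr)
  assume "\<not> ?thesis"
  then have "coweight j (root_refl G (\<alpha> j) (\<alpha> i)) < 0" "coweight i (root_refl G (\<alpha> j) (\<alpha> i)) > 0"
    using coweight_refl_simple[OF j j, of "\<alpha> i"] coweight_refl_simple[OF j i, of "\<alpha> i"] i j ne
    by (simp_all add: coweight_simple)
  then show False
    using pos_or_neg[OF refl_root[OF simple_root[OF j] simple_root[OF i]]] i j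
    by (meson linorder_not_le)
qed

section \<open>The Weyl group and its simple reflections\<close>

lemma rcoroot_refl_root:
  "\<gamma> \<in> roots G \<Longrightarrow> \<beta> \<in> roots G \<Longrightarrow> rcoroot (root_refl G \<gamma> \<beta>) \<xi> = rcoroot \<beta> (root_refl G \<gamma> \<xi>)"
  by (simp add: rcoroot_def coroot_refl_root)

lemma refl_conj:
  assumes c: "\<gamma> \<in> roots G" and b: "\<beta> \<in> roots G"
  shows "root_refl G (root_refl G \<gamma> \<beta>) = root_refl G \<gamma> \<circ> root_refl G \<beta> \<circ> root_refl G \<gamma>"
proof
  fix \<xi>
  show "root_refl G (root_refl G \<gamma> \<beta>) \<xi> = (root_refl G \<gamma> \<circ> root_refl G \<beta> \<circ> root_refl G \<gamma>) \<xi>"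
  proof (rule fa_separates)
    fix x :: "'x \<Rightarrow> real" assume x: "x \<in> fa"
    show "x (root_refl G (root_refl G \<gamma> \<beta>) \<xi>) = x ((root_refl G \<gamma> \<circ> root_refl G \<beta> \<circ> root_refl G \<gamma>) \<xi>)"
      using rcoroot_self[OF c] rcoroot_self[OF b]
      by (simp add: fa_refl[OF x] fa_refl[OF rcoroot_in_fa[OF b]] fa_refl[OF rcoroot_in_fa[OF c]]
          rcoroot_refl_root[OF c b] algebra_simps)
  qed
qed

primrec simple_word :: "nat list \<Rightarrow> 'x \<Rightarrow> 'x" where
  "simple_word [] = id"
| "simple_word (i # is) = root_refl G (\<alpha> i) \<circ> simple_word is"

lemma word_append: "simple_word (is @ js) = simple_word is \<circ> simple_word js"
  by (induction "is") (simp_all add: comp_assoc)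

text \<open>Induction on the height. A positive root \<open>\<beta>\<close> has positive pairing with some simple coroot, because
its pairing with its own coroot is positive. If \<open>\<beta>\<close> is not simple, the corresponding simple reflection
lowers the height, keeps \<open>\<beta>\<close> positive and conjugates the two reflections.\<close>

lemma refl_pos_word:
  assumes "pos_root \<beta>"
  shows "\<exists>is. set is \<subseteq> {1..l} \<and> root_refl G \<beta> = simple_word is"
proof -
  have "\<forall>\<beta>. pos_root \<beta> \<longrightarrow> (\<Sum>i=1..l. coweight i \<beta>) < real k \<longrightarrow>
      (\<exists>is. set is \<subseteq> {1..l} \<and> root_refl G \<beta> = simple_word is)" for k
  proof (induction k)
    case 0
    have "0 \<le> (\<Sum>i=1..l. coweight i \<beta>)" if "pos_root \<beta>" for \<beta>
      using that by (intro sum_nonneg) (simp add: pos_root_def)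
    then show ?case by force
  next
    case (Suc k)
    show ?case
    proof (intro allI impI)
      fix \<beta> assume b: "pos_root \<beta>" and h: "(\<Sum>i=1..l. coweight i \<beta>) < real (Suc k)"
      have br: "\<beta> \<in> roots G" using b by (simp add: pos_root_def)
      show "\<exists>is. set is \<subseteq> {1..l} \<and> root_refl G \<beta> = simple_word is"
      proof (cases "\<exists>i\<in>{1..l}. \<beta> = \<alpha> i")
        case True
        then obtain i where "i \<in> {1..l}" "\<beta> = \<alpha> i" by blast
        then show ?thesis by (intro exI[of _ "[i]"]) simp
      next
        case False
        have "\<exists>i\<in>{1..l}. 0 < rcoroot \<beta> (\<alpha> i)"
        proof (rule ccontr)
          assume "\<not> ?thesis"
          then have "(\<Sum>i=1..l. coweight i \<beta> * rcoroot \<beta> (\<alpha> i)) \<le> 0"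
            using b by (intro sum_nonpos mult_nonneg_nonpos) (auto simp: pos_root_def not_less)
          then show False
            using root_expansion[OF br rcoroot_in_fa[OF br]] rcoroot_self[OF br] by simp
        qed
        then obtain i where i: "i \<in> {1..l}" and p: "0 < rcoroot \<beta> (\<alpha> i)" by blast
        have ai: "\<alpha> i \<in> roots G" by (rule simple_root[OF i])
        have "ip (rcoroot (\<alpha> i)) (rcoroot (\<alpha> i)) * rcoroot \<beta> (\<alpha> i) = ip (rcoroot \<beta>) (rcoroot \<beta>) * rcoroot (\<alpha> i) \<beta>"
          using ip_coroot[OF ai rcoroot_in_fa[OF br]] ip_coroot[OF br rcoroot_in_fa[OF ai]]
            ip_sym[OF rcoroot_in_fa[OF ai] rcoroot_in_fa[OF br]] by simp
        then have "0 < ip (rcoroot \<beta>) (rcoroot \<beta>) * rcoroot (\<alpha> i) \<beta>"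
          using p rcoroot_norm_pos[OF ai] by (metis mult_pos_pos)
        then have "0 < rcoroot (\<alpha> i) \<beta>" using rcoroot_norm_pos[OF br] by (simp add: zero_less_mult_iff)
        then have c: "1 \<le> rcoroot (\<alpha> i) \<beta>" unfolding rcoroot_def by simp
        define \<gamma> where "\<gamma> = root_refl G (\<alpha> i) \<beta>"
        have g: "pos_root \<gamma>" unfolding \<gamma>_def using refl_simple_pos[OF b i] False i by blast
        have "(\<Sum>j=1..l. coweight j \<gamma>) = (\<Sum>j=1..l. coweight j \<beta> - (if i = j then rcoroot (\<alpha> i) \<beta> else 0))"
          unfolding \<gamma>_def by (intro sum.cong refl coweight_refl_simple[OF i])
        also have "\<dots> = (\<Sum>j=1..l. coweight j \<beta>) - rcoroot (\<alpha> i) \<beta>"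
          using i by (simp add: sum_subtractf)
        finally have "(\<Sum>j=1..l. coweight j \<gamma>) < real k" using h c by simp
        then obtain "is" where w: "set is \<subseteq> {1..l}" "root_refl G \<gamma> = simple_word is"
          using Suc.IH g by blast
        have "root_refl G (\<alpha> i) \<gamma> = \<beta>" unfolding \<gamma>_def by (rule refl_refl[OF ai])
        then have "root_refl G \<beta> = root_refl G (\<alpha> i) \<circ> root_refl G \<gamma> \<circ> root_refl G (\<alpha> i)"
          using refl_conj[OF ai, of \<gamma>] g by (simp add: pos_root_def)
        also have "\<dots> = simple_word (i # is @ [i])" by (simp add: word_append w comp_assoc)
        finally show ?thesis using w i by (intro exI[of _ "i # is @ [i]"]) simp
      qed
    qed
  qed
  moreover obtain k where "(\<Sum>i=1..l. coweight i \<beta>) < real k" using reals_Archimedean2 by blast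
  ultimately show ?thesis using assms by blast
qed

lemma refl_word:
  assumes b: "\<beta> \<in> roots G"
  shows "\<exists>is. set is \<subseteq> {1..l} \<and> root_refl G \<beta> = simple_word is"
proof (cases "pos_root \<beta>")
  case True
  then show ?thesis by (rule refl_pos_word)
next
  case False
  let ?b = "root_refl G \<beta> \<beta>"
  have r: "?b \<in> roots G" using b b by (rule refl_root)
  have "coweight i ?b = - coweight i \<beta>" if "i \<in> {1..l}" for i
    using that by (simp add: fa_refl coweight_in_fa rcoroot_self[OF b])
  then have "pos_root ?b" using pos_or_neg[OF b] False r b by (auto simp: pos_root_def)
  moreover have "root_refl G ?b = root_refl G \<beta>"
    unfolding refl_conj[OF b b] by (rule ext) (simp add: refl_refl[OF b])
  ultimately show ?thesis using refl_pos_word by metis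
qed

lemma weyl_word: "w \<in> weyl_group G \<Longrightarrow> \<exists>is. set is \<subseteq> {1..l} \<and> w = simple_word is"
proof (induction rule: weyl_group.induct)
  case one
  show ?case by (intro exI[of _ "[]"]) simp
next
  case (step w \<beta>)
  then obtain "is" js where "set is \<subseteq> {1..l}" "w = simple_word is" "set js \<subseteq> {1..l}" "root_refl G \<beta> = simple_word js"
    using refl_word by blast
  then show ?case by (intro exI[of _ "js @ is"]) (simp add: word_append)
qed

lemma word_weyl: "set is \<subseteq> {1..l} \<Longrightarrow> simple_word is \<in> weyl_group G"
proof (induction "is")
  case Nil
  show ?case unfolding simple_word.simps by (rule weyl_group.one)
next
  case (Cons i "is")
  then have "simple_word is \<in> weyl_group G" "\<alpha> i \<in> roots G" using simple_root[of i] by simp_all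
  then show ?case unfolding simple_word.simps by (rule weyl_group.step)
qed

lemma weyl_comp: "w \<in> weyl_group G \<Longrightarrow> v \<in> weyl_group G \<Longrightarrow> w \<circ> v \<in> weyl_group G"
  by (induction rule: weyl_group.induct) (simp_all add: comp_assoc weyl_group.step)

lemma weyl_fa: "w \<in> weyl_group G \<Longrightarrow> x \<in> fa \<Longrightarrow> (\<lambda>\<xi>. x (w \<xi>)) \<in> fa"
proof (induction arbitrary: x rule: weyl_group.induct)
  case one
  then show ?case by simp
next
  case (step w \<beta>)
  from step.IH[OF refl_fa_in_fa[OF step.hyps(2) step.prems]] show ?case by simp
qed

lemma weyl_root: "w \<in> weyl_group G \<Longrightarrow> \<beta> \<in> roots G \<Longrightarrow> w \<beta> \<in> roots G"
  by (induction rule: weyl_group.induct) (simp_all add: refl_root)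

lemma weyl_rcoroot: "w \<in> weyl_group G \<Longrightarrow> \<beta> \<in> roots G \<Longrightarrow> rcoroot (w \<beta>) (w \<xi>) = rcoroot \<beta> \<xi>"
  by (induction rule: weyl_group.induct) (simp_all add: rcoroot_refl_root weyl_root refl_refl)

lemma weyl_inverse: "w \<in> weyl_group G \<Longrightarrow> \<exists>v\<in>weyl_group G. v \<circ> w = id \<and> w \<circ> v = id"
proof (induction rule: weyl_group.induct)
  case one
  show ?case by (intro bexI[of _ id]) (simp_all add: weyl_group.one)
next
  case (step w \<beta>)
  then obtain v where v: "v \<in> weyl_group G" "v \<circ> w = id" "w \<circ> v = id" by blast
  have "(v \<circ> root_refl G \<beta>) \<circ> (root_refl G \<beta> \<circ> w) = id" "(root_refl G \<beta> \<circ> w) \<circ> (v \<circ> root_refl G \<beta>) = id"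
    using v(2,3) refl_refl[OF step.hyps(2)] by (simp_all add: fun_eq_iff)
  moreover have "v \<circ> root_refl G \<beta> \<in> weyl_group G"
    using v(1) refl_in_weyl[OF step.hyps(2)] by (rule weyl_comp)
  ultimately show ?case by blast
qed

lemma weyl_refl_conj:
  assumes w: "w \<in> weyl_group G" and b: "\<beta> \<in> roots G"
  shows "root_refl G (w \<beta>) (w \<xi>) = w (root_refl G \<beta> \<xi>)"
proof (rule fa_separates)
  fix x :: "'x \<Rightarrow> real" assume x: "x \<in> fa"
  show "x (root_refl G (w \<beta>) (w \<xi>)) = x (w (root_refl G \<beta> \<xi>))"
    using fa_refl[OF x, of "w \<beta>" "w \<xi>"] fa_refl[OF weyl_fa[OF w x], of \<beta> \<xi>] weyl_rcoroot[OF w b] by simp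
qed

text \<open>If the word sends \<open>\<alpha>\<^sub>i\<close> to a negative root, then going through its letters from the right there is a first
letter \<open>j\<close> at which \<open>\<alpha>\<^sub>i\<close> turns negative. Just before it the image of \<open>\<alpha>\<^sub>i\<close> is \<open>\<alpha>\<^sub>j\<close>, and
the reflection \<open>s\<^sub>i\<close> can be moved through the word to cancel that letter.\<close>

lemma exchange:
  assumes "set is \<subseteq> {1..l}" "i \<in> {1..l}" "\<not> pos_root (simple_word is (\<alpha> i))"
  shows "\<exists>js. set js \<subseteq> {1..l} \<and> length js < length is \<and> simple_word js = simple_word is \<circ> root_refl G (\<alpha> i)"
  using assms(1,3)
proof (induction "is")
  case Nil
  then show ?case using simple_pos[OF assms(2)] by simp
next
  case (Cons j "is")
  have j: "j \<in> {1..l}" and s: "set is \<subseteq> {1..l}" using Cons.prems by auto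
  show ?case
  proof (cases "pos_root (simple_word is (\<alpha> i))")
    case False
    then obtain js where "set js \<subseteq> {1..l}" "length js < length is" "simple_word js = simple_word is \<circ> root_refl G (\<alpha> i)"
      using Cons.IH s by blast
    then show ?thesis using j by (intro exI[of _ "j # js"]) (simp add: comp_assoc)
  next
    case True
    then have e: "simple_word is (\<alpha> i) = \<alpha> j"
      using refl_simple_pos[OF True j] Cons.prems(2) by auto
    have "simple_word is = simple_word (j # is) \<circ> root_refl G (\<alpha> i)"
    proof
      fix \<xi>
      have "root_refl G (\<alpha> j) (simple_word is \<xi>) = simple_word is (root_refl G (\<alpha> i) \<xi>)"
        using weyl_refl_conj[OF word_weyl[OF s] simple_root[OF assms(2)]] e by simp
      then have "root_refl G (\<alpha> j) (simple_word is (root_refl G (\<alpha> i) \<xi>)) = simple_word is \<xi>"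
        using refl_refl[OF simple_root[OF j]] by metis
      then show "simple_word is \<xi> = (simple_word (j # is) \<circ> root_refl G (\<alpha> i)) \<xi>" by simp
    qed
    then show ?thesis using s by (intro exI[of _ "is"] conjI) (assumption | simp del: simple_word.simps)+
  qed
qed

text \<open>In a shortest word for \<open>w\<close> the last letter is an ascending step, since otherwise the exchange
property would give a shorter word.\<close>

lemma weyl_ascending_induct [consumes 1, case_names id step]:
  assumes "w \<in> weyl_group G"
    and base: "P id"
    and ascend: "\<And>v i. v \<in> weyl_group G \<Longrightarrow> i \<in> {1..l} \<Longrightarrow> pos_root (v (\<alpha> i)) \<Longrightarrow> P v
      \<Longrightarrow> P (v \<circ> root_refl G (\<alpha> i))"
  shows "P w"
proof -
  have "set is \<subseteq> {1..l} \<Longrightarrow> P (simple_word is)" for "is"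
  proof (induction "is" rule: length_induct)
    case (1 "is")
    show ?case
    proof (cases "is" rule: rev_cases)
      case Nil
      then show ?thesis using base by (simp only: simple_word.simps)
    next
      case (snoc js i)
      have js: "set js \<subseteq> {1..l}" and i: "i \<in> {1..l}" using 1(2) snoc by auto
      have w: "simple_word is = simple_word js \<circ> root_refl G (\<alpha> i)" by (simp add: snoc word_append)
      show ?thesis
      proof (cases "pos_root (simple_word js (\<alpha> i))")
        case True
        have "P (simple_word js)" using 1(1) js snoc by simp
        then show ?thesis unfolding w using word_weyl[OF js] i True by (intro ascend)
      next
        case False
        then obtain ks where "set ks \<subseteq> {1..l}" "length ks < length js" "simple_word ks = simple_word is"
          using exchange[OF js i] w by auto
        then show ?thesis using 1(1) snoc by (metis length_append_singleton less_SucI)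
      qed
    qed
  qed
  then show ?thesis using weyl_word[OF assms(1)] by blast
qed

section \<open>Dominant elements in Weyl orbits\<close>

lemma weyl_diff_span:
  assumes "w \<in> weyl_group G" "x \<in> fa"
  shows "\<exists>t. \<forall>\<xi>. x (w \<xi>) - x \<xi> = (\<Sum>\<beta>\<in>roots G. t \<beta> * rcoroot \<beta> \<xi>)"
  using assms
proof (induction arbitrary: x rule: weyl_group.induct)
  case one
  show ?case by (intro exI[of _ "\<lambda>\<beta>. 0"]) simp
next
  case (step w \<gamma>)
  let ?y = "\<lambda>\<xi>. x (root_refl G \<gamma> \<xi>)"
  obtain t where t: "\<And>\<xi>. ?y (w \<xi>) - ?y \<xi> = (\<Sum>\<beta>\<in>roots G. t \<beta> * rcoroot \<beta> \<xi>)"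
    using step.IH[OF refl_fa_in_fa[OF step.hyps(2) step.prems]] by blast
  have "x (root_refl G \<gamma> (w \<xi>)) - x \<xi> = (\<Sum>\<beta>\<in>roots G. (t \<beta> + (if \<beta> = \<gamma> then - x \<gamma> else 0)) * rcoroot \<beta> \<xi>)" for \<xi>
  proof -
    have "x (root_refl G \<gamma> (w \<xi>)) - x \<xi> = (\<Sum>\<beta>\<in>roots G. t \<beta> * rcoroot \<beta> \<xi>) - x \<gamma> * rcoroot \<gamma> \<xi>"
      using t[of \<xi>] fa_refl[OF step.prems, of \<gamma> \<xi>] by (simp add: algebra_simps)
    also have "\<dots> = (\<Sum>\<beta>\<in>roots G. t \<beta> * rcoroot \<beta> \<xi>) + (\<Sum>\<beta>\<in>roots G. if \<beta> = \<gamma> then - x \<gamma> * rcoroot \<gamma> \<xi> else 0)"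
      using finite_roots step.hyps(2) by simp
    also have "\<dots> = (\<Sum>\<beta>\<in>roots G. (t \<beta> + (if \<beta> = \<gamma> then - x \<gamma> else 0)) * rcoroot \<beta> \<xi>)"
      unfolding sum.distrib[symmetric] by (intro sum.cong) (auto simp: algebra_simps)
    finally show ?thesis .
  qed
  then show ?case
    unfolding comp_def by (intro exI[of _ "\<lambda>\<beta>. t \<beta> + (if \<beta> = \<gamma> then - x \<gamma> else 0)"] allI)
qed

text \<open>For \<open>x\<close> in \<open>\<aa>\<close> the difference \<open>x \<circ> w - x\<close> is a combination of coroots and vanishes at all roots, so it is
orthogonal to itself.\<close>

lemma weyl_fixing_roots:
  assumes w: "w \<in> weyl_group G" and fix_roots: "\<And>\<beta>. \<beta> \<in> roots G \<Longrightarrow> w \<beta> = \<beta>"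
  shows "w = id"
proof
  fix \<xi>
  have "w \<xi> = \<xi>"
  proof (rule fa_separates)
    fix x :: "'x \<Rightarrow> real" assume x: "x \<in> fa"
    define y where "y = (\<lambda>\<xi>. x (w \<xi>) - x \<xi>)"
    have y: "y \<in> fa" unfolding y_def by (intro diff_in_fa weyl_fa[OF w x] x)
    obtain t where t: "y = (\<lambda>\<xi>. \<Sum>\<beta>\<in>roots G. t \<beta> * rcoroot \<beta> \<xi>)"
      using weyl_diff_span[OF w x] unfolding y_def by blast
    have "ip (rcoroot \<beta>) y = 0" if "\<beta> \<in> roots G" for \<beta>
      using ip_coroot[OF that y] fix_roots[OF that] by (simp add: y_def)
    then have "ip y y = 0"
      by (subst (1) t) (simp add: ip_sum rcoroot_in_fa y)
    then have "y = (\<lambda>\<xi>. 0)" using ip_le_zero[OF y] by simp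
    then show "x (w \<xi>) = x \<xi>" by (simp add: y_def fun_eq_iff)
  qed
  then show "w \<xi> = id \<xi>" by simp
qed

text \<open>An element of the Weyl group is determined by its permutation of the finite set of roots.\<close>

lemma finite_weyl: "finite (weyl_group G)"
proof (rule inj_on_finite)
  show "(\<lambda>w. restrict w (roots G)) ` weyl_group G \<subseteq> roots G \<rightarrow>\<^sub>E roots G"
    by (auto simp: weyl_root)
  show "finite (roots G \<rightarrow>\<^sub>E roots G)" using finite_roots by (intro finite_PiE) auto
  show "inj_on (\<lambda>w. restrict w (roots G)) (weyl_group G)"
  proof (rule inj_onI)
    fix w v assume w: "w \<in> weyl_group G" and v: "v \<in> weyl_group G"
      and e: "restrict w (roots G) = restrict v (roots G)"
    obtain u where u: "u \<in> weyl_group G" "u \<circ> v = id" "v \<circ> u = id" using weyl_inverse[OF v] by blast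
    have "(u \<circ> w) \<beta> = \<beta>" if "\<beta> \<in> roots G" for \<beta>
      using that u(2) fun_cong[OF e, of \<beta>] by (simp add: fun_eq_iff)
    then have "u \<circ> w = id" by (intro weyl_fixing_roots weyl_comp u w)
    then show "w = v" using u(3) by (metis comp_assoc comp_id id_comp)
  qed
qed

lemma fa_domD: "y \<in> fa_dom G \<Longrightarrow> y \<in> fa" "y \<in> fa_dom G \<Longrightarrow> i \<in> {1..l} \<Longrightarrow> 0 \<le> y (\<alpha> i)"
  by (simp_all add: fa_dom_def)

lemma dominant_pos: "y \<in> fa_dom G \<Longrightarrow> pos_root \<beta> \<Longrightarrow> 0 \<le> y \<beta>"
  using root_expansion[of \<beta> y]
  by (auto simp: pos_root_def fa_domD intro!: sum_nonneg mult_nonneg_nonneg)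

lemma weyl_central_weight:
  assumes w: "w \<in> weyl_group G" and j: "j \<in> {l+1..n}"
  shows "w (\<omega> j) = \<omega> j"
  using w
proof (induction rule: weyl_ascending_induct)
  case id
  show ?case by simp
next
  case (step v i)
  have "root_refl G (\<alpha> i) (\<omega> j) = \<omega> j"
    using rcoroot_central_weight[OF step.hyps(2) j] by (simp add: root_refl_def rcoroot_def zmult_0)
  then show ?case using step.IH by simp
qed

text \<open>At an ascending step \<open>v \<circ> s\<^sub>j\<close> the value drops by a non-negative multiple of the value of \<open>y\<close> at the
positive root \<open>v \<alpha>\<^sub>j\<close>.\<close>

lemma dominant_weyl_weight_le:
  assumes w: "w \<in> weyl_group G" and y: "y \<in> fa_dom G" and i: "i \<in> {1..l}"
  shows "y (w (\<omega> i)) \<le> y (\<omega> i)"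
  using w
proof (induction rule: weyl_ascending_induct)
  case id
  show ?case by simp
next
  case (step v j)
  have "y (v (root_refl G (\<alpha> j) (\<omega> i))) = y (v (\<omega> i)) - rcoroot (\<alpha> j) (\<omega> i) * y (v (\<alpha> j))"
    by (rule fa_refl[OF weyl_fa[OF step.hyps(1) fa_domD(1)[OF y]]])
  moreover have "0 \<le> rcoroot (\<alpha> j) (\<omega> i) * y (v (\<alpha> j))"
    using dominant_pos[OF y step.hyps(3)] rcoroot_weight[OF i step.hyps(2)] by simp
  ultimately show ?case using step.IH by simp
qed

text \<open>Only steps with \<open>j = i\<close> move \<open>\<omega>\<^sub>i\<close>. At the first of them the drop is \<open>y \<gamma>\<close> for a positive root \<open>\<gamma>\<close> whose
coroot pairs to \<open>1\<close> with \<open>\<omega>\<^sub>i\<close>. Such a root involves \<open>\<alpha>\<^sub>i\<close>, because a root in the span of the other simple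
roots has its coroot in the span of the other simple coroots. Hence \<open>y \<gamma> > 0\<close>.\<close>

lemma dominant_weyl_weight_less:
  assumes w: "w \<in> weyl_group G" and y: "y \<in> fa_dom G" and i: "i \<in> {1..l}" and p: "0 < y (\<alpha> i)"
  shows "w (\<omega> i) = \<omega> i \<or> y (w (\<omega> i)) < y (\<omega> i)"
  using w
proof (induction rule: weyl_ascending_induct)
  case id
  show ?case by simp
next
  case (step v j)
  have e: "y (v (root_refl G (\<alpha> j) (\<omega> i))) = y (v (\<omega> i)) - rcoroot (\<alpha> j) (\<omega> i) * y (v (\<alpha> j))"
    by (rule fa_refl[OF weyl_fa[OF step.hyps(1) fa_domD(1)[OF y]]])
  show ?case
  proof (cases "j = i")
    case False
    then have "root_refl G (\<alpha> j) (\<omega> i) = \<omega> i"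
      using rcoroot_weight[OF i step.hyps(2)] by (simp add: root_refl_def rcoroot_def zmult_0)
    then show ?thesis using step.IH by simp
  next
    case True
    define \<gamma> where "\<gamma> = v (\<alpha> i)"
    have g: "pos_root \<gamma>" using step.hyps(3) True by (simp add: \<gamma>_def)
    then have gr: "\<gamma> \<in> roots G" by (simp add: pos_root_def)
    have e': "y ((v \<circ> root_refl G (\<alpha> j)) (\<omega> i)) = y (v (\<omega> i)) - y \<gamma>"
      using e True rcoroot_weight[OF i i] by (simp add: \<gamma>_def)
    have g0: "0 \<le> y \<gamma>" using dominant_pos[OF y g] .
    show ?thesis
    proof (cases "v (\<omega> i) = \<omega> i")
      case False
      then show ?thesis using step.IH e' g0 by simp
    next
      case fixed: True
      have "rcoroot \<gamma> (\<omega> i) = 1"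
        using weyl_rcoroot[OF step.hyps(1) simple_root[OF i], of "\<omega> i"] fixed rcoroot_weight[OF i i]
        by (simp add: \<gamma>_def)
      have "coweight i \<gamma> \<noteq> 0"
      proof
        assume z: "coweight i \<gamma> = 0"
        (* The coefficients of the coroot of \<gamma> in the simple coroots, if \<gamma> is expanded in simple roots. *)
        let ?c = "\<lambda>j. coweight j \<gamma> * ip (rcoroot \<gamma>) (rcoroot \<gamma>) / ip (rcoroot (\<alpha> j)) (rcoroot (\<alpha> j))"
        define u where "u = (\<lambda>\<xi>. rcoroot \<gamma> \<xi> - (\<Sum>j\<in>{1..l}. ?c j * rcoroot (\<alpha> j) \<xi>))"
        have u: "u \<in> fa" unfolding u_def by (intro diff_in_fa rcoroot_in_fa gr coroot_comb_in_fa order_refl)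
        have "2 * (\<Sum>j\<in>{1..l}. ?c j * ip (rcoroot (\<alpha> j)) u) = ip (rcoroot \<gamma>) (rcoroot \<gamma>) * (\<Sum>j\<in>{1..l}. coweight j \<gamma> * u (\<alpha> j))"
          unfolding sum_distrib_left
        proof (rule sum.cong[OF refl])
          fix j assume j: "j \<in> {1..l}"
          have "2 * ip (rcoroot (\<alpha> j)) u = ip (rcoroot (\<alpha> j)) (rcoroot (\<alpha> j)) * u (\<alpha> j)"
            by (rule ip_coroot[OF simple_root[OF j] u])
          then show "2 * (?c j * ip (rcoroot (\<alpha> j)) u) = ip (rcoroot \<gamma>) (rcoroot \<gamma>) * (coweight j \<gamma> * u (\<alpha> j))"
            using rcoroot_norm_pos[OF simple_root[OF j]] by (simp add: field_simps)
        qed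
        also have "\<dots> = 2 * ip (rcoroot \<gamma>) u"
          using ip_coroot[OF gr u] root_expansion[OF gr u] by simp
        finally have s: "(\<Sum>j\<in>{1..l}. ?c j * ip (rcoroot (\<alpha> j)) u) = ip (rcoroot \<gamma>) u" by simp
        have "ip u u = ip (rcoroot \<gamma>) u - ip (\<lambda>\<xi>. \<Sum>j\<in>{1..l}. ?c j * rcoroot (\<alpha> j) \<xi>) u"
          by (subst (1) u_def) (rule ip_diff[OF rcoroot_in_fa[OF gr] coroot_comb_in_fa[OF order_refl] u])
        also have "ip (\<lambda>\<xi>. \<Sum>j\<in>{1..l}. ?c j * rcoroot (\<alpha> j) \<xi>) u = (\<Sum>j\<in>{1..l}. ?c j * ip (rcoroot (\<alpha> j)) u)"
          by (rule ip_sum[OF rcoroot_in_fa[OF simple_root] u])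
        finally have "ip u u \<le> 0" using s by simp
        then have "u (\<omega> i) = 0" using ip_le_zero[OF u] by simp
        then have "rcoroot \<gamma> (\<omega> i) = ?c i"
          using coroot_comb_weight[OF order_refl, of i ?c] i l_le_n by (simp add: u_def)
        then show False using z \<open>rcoroot \<gamma> (\<omega> i) = 1\<close> by simp
      qed
      then have "0 < coweight i \<gamma> * y (\<alpha> i)" using g i p by (simp add: pos_root_def less_le)
      also have "\<dots> \<le> (\<Sum>j=1..l. coweight j \<gamma> * y (\<alpha> j))"
        using g fa_domD(2)[OF y] i by (intro member_le_sum) (auto simp: pos_root_def)
      also have "\<dots> = y \<gamma>" using root_expansion[OF gr fa_domD(1)[OF y]] by simp
      finally show ?thesis using e' fixed by simp
    qed
  qed
qed

lemma weyl_act_inverse: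
  assumes "w \<in> weyl_group G"
  obtains v where "v \<in> weyl_group G" "v \<circ> w = id" "w \<circ> v = id" "\<And>x. weyl_act w x = (\<lambda>\<xi>. x (v \<xi>))"
proof -
  obtain v where v: "v \<in> weyl_group G" "v \<circ> w = id" "w \<circ> v = id" using weyl_inverse[OF assms] by blast
  have "inv_into UNIV w = v" using v(2,3) by (intro inv_equality) (simp_all add: fun_eq_iff)
  then show ?thesis using that[OF v] by (simp add: weyl_act_def comp_def)
qed

text \<open>The action on \<open>\<aa>\<close> is by inverses. Since the Weyl group is closed under inverses, orbits can be computed
with plain composition.\<close>

lemma weyl_orbit:
  "{weyl_act s x |s. s \<in> weyl_group G} = {\<lambda>\<xi>. x (w \<xi>) |w. w \<in> weyl_group G}"
proof (intro equalityI subsetI)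
  fix y assume "y \<in> {weyl_act s x |s. s \<in> weyl_group G}"
  then obtain s where s: "s \<in> weyl_group G" "y = weyl_act s x" by blast
  from s(1) show "y \<in> {\<lambda>\<xi>. x (w \<xi>) |w. w \<in> weyl_group G}"
    by (rule weyl_act_inverse) (use s(2) in blast)
next
  fix y assume "y \<in> {\<lambda>\<xi>. x (w \<xi>) |w. w \<in> weyl_group G}"
  then obtain w where w: "w \<in> weyl_group G" "y = (\<lambda>\<xi>. x (w \<xi>))" by blast
  obtain v where v: "v \<in> weyl_group G" "v \<circ> w = id" "w \<circ> v = id" using weyl_inverse[OF w(1)] by blast
  have "inv_into UNIV v = w" using v(2,3) by (intro inv_equality) (simp_all add: fun_eq_iff)
  then have "y = weyl_act v x" using w by (simp add: weyl_act_def comp_def)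
  then show "y \<in> {weyl_act s x |s. s \<in> weyl_group G}" using v(1) by blast
qed

text \<open>Choose \<open>w\<close> such that the sum of the values of \<open>x \<circ> w\<close> at \<open>\<omega>\<^sub>1, \<dots>, \<omega>\<^sub>l\<close> is as large as possible. The
reflection \<open>s\<^sub>i\<close> changes this sum by minus the value at \<open>\<alpha>\<^sub>i\<close>.\<close>

lemma dominant_in_orbit:
  assumes x: "x \<in> fa"
  obtains w where "w \<in> weyl_group G" "(\<lambda>\<xi>. x (w \<xi>)) \<in> fa_dom G"
proof -
  let ?f = "\<lambda>w. \<Sum>i=1..l. x (w (\<omega> i))"
  have ne: "weyl_group G \<noteq> {}" using weyl_group.one by blast
  have "Max (?f ` weyl_group G) \<in> ?f ` weyl_group G" using finite_weyl ne by (intro Max_in) auto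
  then obtain w where w: "w \<in> weyl_group G" and m: "Max (?f ` weyl_group G) = ?f w" by blast
  have mx: "?f v \<le> ?f w" if "v \<in> weyl_group G" for v
    unfolding m[symmetric] using finite_weyl that by (intro Max_ge finite_imageI imageI)
  let ?y = "\<lambda>\<xi>. x (w \<xi>)"
  have y: "?y \<in> fa" by (rule weyl_fa[OF w x])
  have "0 \<le> ?y (\<alpha> i)" if i: "i \<in> {1..l}" for i
  proof -
    let ?v = "w \<circ> root_refl G (\<alpha> i)"
    have "x (?v (\<omega> j)) = ?y (\<omega> j) - (if j = i then ?y (\<alpha> i) else 0)" if j: "j \<in> {1..l}" for j
      using fa_refl[OF y, of "\<alpha> i" "\<omega> j"] rcoroot_weight[OF j i] by simp
    then have "?f ?v = (\<Sum>j=1..l. ?y (\<omega> j) - (if j = i then ?y (\<alpha> i) else 0))"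
      by (intro sum.cong) auto
    also have "\<dots> = ?f w - ?y (\<alpha> i)" using i by (simp add: sum_subtractf)
    finally show ?thesis
      using mx[OF weyl_comp[OF w refl_in_weyl[OF simple_root[OF i]]]] by simp
  qed
  then have "?y \<in> fa_dom G" using y by (simp add: fa_dom_def)
  with w show ?thesis by (rule that)
qed

text \<open>Each of two dominant elements of an orbit is at most the other in every coordinate.\<close>

lemma dominant_unique:
  assumes y: "y \<in> fa_dom G" and w: "w \<in> weyl_group G" and z: "(\<lambda>\<xi>. y (w \<xi>)) \<in> fa_dom G"
  shows "(\<lambda>\<xi>. y (w \<xi>)) = y"
proof (rule fa_eqI[OF fa_domD(1)[OF z] fa_domD(1)[OF y]])
  fix i assume i: "i \<in> {1..n}"
  obtain v where v: "v \<in> weyl_group G" "w \<circ> v = id" using weyl_inverse[OF w] by blast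
  show "y (w (\<omega> i)) = y (\<omega> i)"
  proof (cases "i \<le> l")
    case True
    then have il: "i \<in> {1..l}" using i by simp
    have "y (w (v (\<omega> i))) \<le> y (w (\<omega> i))" by (rule dominant_weyl_weight_le[OF v(1) z il])
    moreover have "w (v (\<omega> i)) = \<omega> i" using v(2) by (simp add: fun_eq_iff)
    ultimately show ?thesis using dominant_weyl_weight_le[OF w y il] by simp
  next
    case False
    then show ?thesis using weyl_central_weight[OF w, of i] i by simp
  qed
qed

section \<open>The least dominant majorant\<close>

lemma ip_coroot_comb:
  assumes J: "J \<subseteq> {1..l}" and y: "y \<in> fa"
  shows "2 * ip (\<lambda>\<xi>. \<Sum>j\<in>J. t j * rcoroot (\<alpha> j) \<xi>) y = (\<Sum>j\<in>J. t j * ip (rcoroot (\<alpha> j)) (rcoroot (\<alpha> j)) * y (\<alpha> j))"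
proof -
  have J': "j \<in> J \<Longrightarrow> \<alpha> j \<in> roots G" for j using J by (intro simple_root) (rule subsetD)
  have "2 * ip (\<lambda>\<xi>. \<Sum>j\<in>J. t j * rcoroot (\<alpha> j) \<xi>) y = (\<Sum>j\<in>J. t j * (2 * ip (rcoroot (\<alpha> j)) y))"
    by (subst ip_sum) (simp_all add: J' rcoroot_in_fa y sum_distrib_left algebra_simps)
  also have "\<dots> = (\<Sum>j\<in>J. t j * ip (rcoroot (\<alpha> j)) (rcoroot (\<alpha> j)) * y (\<alpha> j))"
    by (intro sum.cong refl) (simp only: ip_coroot[OF J' y] mult.assoc)
  finally show ?thesis .
qed

text \<open>Split \<open>x = p - m\<close> into the parts with non-negative and with negative coefficients. Dominance gives
\<open>ip m x \<ge> 0\<close>, obtuseness of the simple coroots gives \<open>ip m p \<le> 0\<close>, and so \<open>ip m m \<le> 0\<close>.\<close>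

lemma dominant_coroot_comb_nonneg:
  assumes x: "x \<in> fa_dom G" and c: "\<And>j. j \<in> {l+1..n} \<Longrightarrow> x (\<omega> j) = 0" and i: "i \<in> {1..l}"
  shows "0 \<le> x (\<omega> i)"
proof (rule ccontr)
  assume neg: "\<not> ?thesis"
  define N where "N = {i\<in>{1..l}. x (\<omega> i) < 0}"
  define N' where "N' = {i\<in>{1..l}. 0 \<le> x (\<omega> i)}"
  have N: "N \<subseteq> {1..l}" "N' \<subseteq> {1..l}" "N \<union> N' = {1..l}" "N \<inter> N' = {}" "finite N" "finite N'"
    by (auto simp: N_def N'_def)
  have xf: "x \<in> fa" by (rule fa_domD(1)[OF x])
  let ?m = "\<lambda>\<xi>. \<Sum>j\<in>N. - x (\<omega> j) * rcoroot (\<alpha> j) \<xi>"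
  let ?p = "\<lambda>\<xi>. \<Sum>j\<in>N'. x (\<omega> j) * rcoroot (\<alpha> j) \<xi>"
  have m: "?m \<in> fa" by (rule coroot_comb_in_fa[OF N(1)])
  have p: "?p \<in> fa" by (rule coroot_comb_in_fa[OF N(2)])
  have xe: "x = (\<lambda>\<xi>. \<Sum>j\<in>{1..l}. x (\<omega> j) * rcoroot (\<alpha> j) \<xi>)"
    by (rule coroot_span[OF xf]) (use c in auto)
  have pe: "?p \<xi> = x \<xi> + ?m \<xi>" for \<xi>
  proof -
    have "x \<xi> = (\<Sum>j\<in>N \<union> N'. x (\<omega> j) * rcoroot (\<alpha> j) \<xi>)" unfolding N(3) by (rule fun_cong[OF xe])
    also have "\<dots> = (\<Sum>j\<in>N. x (\<omega> j) * rcoroot (\<alpha> j) \<xi>) + ?p \<xi>"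
      by (rule sum.union_disjoint[OF N(5,6,4)])
    finally show ?thesis by (simp add: sum_negf)
  qed
  have norm: "0 \<le> ip (rcoroot (\<alpha> j)) (rcoroot (\<alpha> j))" if "j \<in> N" for j
    using rcoroot_norm_pos[OF simple_root[of j]] that N(1) by (meson less_imp_le subsetD)
  have mx: "0 \<le> 2 * ip ?m x"
    unfolding ip_coroot_comb[OF N(1) xf]
    by (intro sum_nonneg mult_nonneg_nonneg norm fa_domD(2)[OF x]) (auto simp: N_def)
  have pneg: "?p (\<alpha> j) \<le> 0" if j: "j \<in> N" for j
  proof (rule sum_nonpos)
    fix k assume k: "k \<in> N'"
    then have "rcoroot (\<alpha> k) (\<alpha> j) \<le> 0" using j N by (intro cartan_nonpos) auto
    then show "x (\<omega> k) * rcoroot (\<alpha> k) (\<alpha> j) \<le> 0" using k by (simp add: N'_def mult_nonneg_nonpos)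
  qed
  have mp: "2 * ip ?m ?p \<le> 0"
    unfolding ip_coroot_comb[OF N(1) p]
    by (intro sum_nonpos mult_nonneg_nonpos mult_nonneg_nonneg norm pneg) (auto simp: N_def)
  have "ip ?m ?p = ip ?m x + ip ?m ?m"
    unfolding pe by (rule ip_add_right[OF xf m m])
  then have "ip ?m ?m \<le> 0" using mx mp by simp
  then have z: "?m = (\<lambda>\<xi>. 0)" by (rule ip_le_zero[OF m])
  have "?m (\<omega> i) = - x (\<omega> i)"
    using coroot_comb_weight[OF N(1), of i "\<lambda>j. - x (\<omega> j)"] i neg l_le_n by (simp add: N_def)
  then have "x (\<omega> i) = 0" using fun_cong[OF z, of "\<omega> i"] by simp
  then show False using neg by simp
qed

text \<open>The form in which the signs of the Cartan matrix are used: only the diagonal entry \<open>2\<close> contributes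
positively.\<close>

lemma coroot_comb_simple_le:
  assumes x: "x \<in> fa" and c: "\<And>j. j \<in> {l+1..n} \<Longrightarrow> x (\<omega> j) = 0"
    and p: "\<And>j. j \<in> {1..l} \<Longrightarrow> 0 \<le> x (\<omega> j)" and i: "i \<in> {1..l}"
  shows "x (\<alpha> i) \<le> 2 * x (\<omega> i)"
proof -
  have xe: "x = (\<lambda>\<xi>. \<Sum>j\<in>{1..l}. x (\<omega> j) * rcoroot (\<alpha> j) \<xi>)"
    by (rule coroot_span[OF x]) (use c in auto)
  have "x (\<alpha> i) = (\<Sum>j\<in>{1..l}. x (\<omega> j) * rcoroot (\<alpha> j) (\<alpha> i))" by (rule fun_cong[OF xe])
  also have "\<dots> = x (\<omega> i) * rcoroot (\<alpha> i) (\<alpha> i) + (\<Sum>j\<in>{1..l}-{i}. x (\<omega> j) * rcoroot (\<alpha> j) (\<alpha> i))"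
    using i by (intro sum.remove) auto
  also have "(\<Sum>j\<in>{1..l}-{i}. x (\<omega> j) * rcoroot (\<alpha> j) (\<alpha> i)) \<le> 0"
  proof (intro sum_nonpos mult_nonneg_nonpos)
    fix j assume j: "j \<in> {1..l} - {i}"
    then show "0 \<le> x (\<omega> j)" by (intro p) simp
    show "rcoroot (\<alpha> j) (\<alpha> i) \<le> 0" using i j by (intro cartan_nonpos) auto
  qed
  finally show ?thesis using rcoroot_self[OF simple_root[OF i]] by simp
qed

lemma central_exists:
  "\<exists>z\<in>fa. (\<forall>i\<in>{1..l}. z (\<alpha> i) = 0) \<and> (\<forall>j\<in>{l+1..n}. z (\<omega> j) = v j)"
proof -
  let ?x = "from_coords v"
  obtain t where t: "\<And>i. i \<in> {1..l} \<Longrightarrow> ?x (\<alpha> i) - (\<Sum>j\<in>{1..l}. t j * rcoroot (\<alpha> j) (\<alpha> i)) = 0"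
    using coroot_projection[OF order_refl from_coords_in_fa] by blast
  let ?z = "\<lambda>\<xi>. ?x \<xi> - (\<Sum>j\<in>{1..l}. t j * rcoroot (\<alpha> j) \<xi>)"
  show ?thesis
  proof (intro bexI[of _ ?z] conjI ballI)
    show "?z \<in> fa" by (intro diff_in_fa from_coords_in_fa coroot_comb_in_fa order_refl)
    fix j assume j: "j \<in> {l+1..n}"
    then show "?z (\<omega> j) = v j"
      using coroot_comb_weight[OF order_refl, of j t] from_coords_weight[of j v] by simp
  qed (rule t)
qed

text \<open>Together with the coweights these are a basis of \<open>\<aa>\<close> adapted to the decomposition into centre and coroot span:
they allow the central coordinates of a dominant point to be moved without affecting dominance.\<close>

definition central_coweight :: "nat \<Rightarrow> 'x \<Rightarrow> real" where
  "central_coweight j = (SOME z. z \<in> fa \<and> (\<forall>i\<in>{1..l}. z (\<alpha> i) = 0) \<and> (\<forall>k\<in>{l+1..n}. z (\<omega> k) = (if k = j then 1 else 0)))"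

lemma central_coweight:
  shows central_coweight_in_fa: "central_coweight j \<in> fa"
    and central_coweight_simple: "\<And>i. i \<in> {1..l} \<Longrightarrow> central_coweight j (\<alpha> i) = 0"
    and central_coweight_weight: "\<And>k. k \<in> {l+1..n} \<Longrightarrow> central_coweight j (\<omega> k) = (if k = j then 1 else 0)"
  using someI_ex[OF central_exists[unfolded Bex_def, of "\<lambda>k. if k = j then 1 else 0"], folded central_coweight_def]
  by blast+

definition central :: "(nat \<Rightarrow> real) \<Rightarrow> 'x \<Rightarrow> real" where
  "central v \<xi> = (\<Sum>j\<in>{l+1..n}. v j * central_coweight j \<xi>)"

lemma central_in_fa: "central v \<in> fa"
  using sum_in_fa[of "{l+1..n}" central_coweight v] central_coweight_in_fa unfolding central_def[abs_def] by blast

lemma central_simple: "i \<in> {1..l} \<Longrightarrow> central v (\<alpha> i) = 0"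
  unfolding central_def by (intro sum.neutral) (simp add: central_coweight_simple)

lemma central_weight: "j \<in> {l+1..n} \<Longrightarrow> central v (\<omega> j) = v j"
proof -
  assume j: "j \<in> {l+1..n}"
  have "central v (\<omega> j) = (\<Sum>k\<in>{l+1..n}. v k * (if j = k then 1 else 0))"
    unfolding central_def using j by (intro sum.cong refl) (simp add: central_coweight_weight)
  then show ?thesis using j by (simp add: sum_mult_delta)
qed

text \<open>A strictly dominant vector with all semisimple coordinates positive and all central ones zero, used to
enlarge dominant points.\<close>

definition rho :: "'x \<Rightarrow> real" where
  "rho \<xi> = (\<Sum>i\<in>{1..l}. 1 * coweight i \<xi>)"

lemma rho_in_fa: "rho \<in> fa"
  using sum_in_fa[of "{1..l}" coweight "\<lambda>_. 1"] coweight_in_fa unfolding rho_def[abs_def] by blast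

lemma rho_simple: "i \<in> {1..l} \<Longrightarrow> rho (\<alpha> i) = 1"
proof -
  assume i: "i \<in> {1..l}"
  have "rho (\<alpha> i) = (\<Sum>k\<in>{1..l}. 1 * (if i = k then 1 else 0))"
    unfolding rho_def using i by (intro sum.cong refl) (simp add: coweight_simple)
  then show ?thesis using i by (simp add: sum_mult_delta)
qed

lemma rho_central: "j \<in> {l+1..n} \<Longrightarrow> rho (\<omega> j) = 0"
  unfolding rho_def by (intro sum.neutral) (simp add: coweight_central)

lemma rho_weight:
  assumes i: "i \<in> {1..l}" shows "1 / 2 \<le> rho (\<omega> i)"
proof -
  have d: "rho \<in> fa_dom G" using rho_in_fa rho_simple by (simp add: fa_dom_def)
  have "rho (\<alpha> i) \<le> 2 * rho (\<omega> i)"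
    by (rule coroot_comb_simple_le[OF rho_in_fa rho_central _ i])
      (auto intro!: dominant_coroot_comb_nonneg[OF d] rho_central)
  then show ?thesis using rho_simple[OF i] by simp
qed

definition dom_majorants :: "(nat \<Rightarrow> ereal) \<Rightarrow> ('x \<Rightarrow> real) set" where
  "dom_majorants d = {y\<in>fa_dom G. (\<forall>i\<in>{1..l}. d i \<le> ereal (y (\<omega> i))) \<and> (\<forall>j\<in>{l+1..n}. d j = ereal (y (\<omega> j)))}"

lemma dom_majorantsD:
  assumes "y \<in> dom_majorants d"
  shows "y \<in> fa_dom G" "i \<in> {1..l} \<Longrightarrow> d i \<le> ereal (y (\<omega> i))" "j \<in> {l+1..n} \<Longrightarrow> d j = ereal (y (\<omega> j))"
  using assms unfolding dom_majorants_def by blast+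

definition least_dom :: "(nat \<Rightarrow> ereal) \<Rightarrow> 'x \<Rightarrow> real" where
  "least_dom d = from_coords (\<lambda>i. Inf ((\<lambda>y. y (\<omega> i)) ` dom_majorants d))"

lemma ext_spaceD:
  assumes "d \<in> ext_space l n"
  shows "i \<in> {1..l} \<Longrightarrow> d i \<noteq> \<infinity>"
    and "j \<in> {l+1..n} \<Longrightarrow> ereal (real_of_ereal (d j)) = d j"
proof -
  show "d i \<noteq> \<infinity>" if "i \<in> {1..l}"
    using assms that l_le_n by (force simp: ext_space_def PiE_iff)
  show "ereal (real_of_ereal (d j)) = d j" if "j \<in> {l+1..n}"
    using PiE_mem[OF assms[unfolded ext_space_def], of j] that by (cases "d j") auto
qed

lemma dom_majorants_shift:
  assumes y: "y \<in> fa_dom G" and e: "0 \<le> e"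
  shows "(\<lambda>\<xi>. y \<xi> + (e * rho \<xi> + central v \<xi>)) \<in> fa_dom G"
  using y e by (auto simp: fa_dom_def rho_simple central_simple
      intro!: add_in_fa scale_in_fa rho_in_fa central_in_fa)

lemma dom_majorants_nonempty:
  assumes d: "d \<in> ext_space l n"
  shows "dom_majorants d \<noteq> {}"
proof -
  define z where "z = central (\<lambda>j. real_of_ereal (d j))"
  define e where "e = 2 * (\<Sum>i\<in>{1..l}. max 0 (real_of_ereal (d i) - z (\<omega> i)))"
  have e: "0 \<le> e" unfolding e_def by (intro mult_nonneg_nonneg sum_nonneg) auto
  let ?y = "\<lambda>\<xi>. 0 + (e * rho \<xi> + z \<xi>)"
  have 0: "(\<lambda>\<xi>. 0) \<in> fa_dom G" by (simp add: fa_dom_def zero_in_fa)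
  have "?y \<in> dom_majorants d"
    unfolding dom_majorants_def
  proof (intro CollectI conjI ballI)
    show "?y \<in> fa_dom G" unfolding z_def by (rule dom_majorants_shift[OF 0 e])
    fix i assume i: "i \<in> {1..l}"
    have "real_of_ereal (d i) - z (\<omega> i) \<le> max 0 (real_of_ereal (d i) - z (\<omega> i))" by simp
    also have "\<dots> \<le> (\<Sum>i\<in>{1..l}. max 0 (real_of_ereal (d i) - z (\<omega> i)))"
      using i by (intro member_le_sum) auto
    also have "\<dots> = e * (1 / 2)" by (simp add: e_def)
    also have "\<dots> \<le> e * rho (\<omega> i)" using rho_weight[OF i] e by (rule mult_left_mono)
    finally have "real_of_ereal (d i) \<le> ?y (\<omega> i)" by simp
    then show "d i \<le> ereal (?y (\<omega> i))" using ext_spaceD(1)[OF d i] by (cases "d i") auto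
  next
    fix j assume j: "j \<in> {l+1..n}"
    then show "d j = ereal (?y (\<omega> j))"
      using ext_spaceD(2)[OF d j] by (simp add: rho_central z_def central_weight)
  qed
  then show ?thesis by blast
qed

text \<open>The difference to the central vector with the same central coordinates is a dominant combination of
simple coroots. This is what bounds the majorants from below when coordinates of \<open>d\<close> are \<open>-\<infinity>\<close>.\<close>

lemma dominant_ge_central:
  assumes y: "y \<in> fa_dom G" and i: "i \<in> {1..l}"
  shows "central (\<lambda>j. y (\<omega> j)) (\<omega> i) \<le> y (\<omega> i)"
proof -
  let ?x = "\<lambda>\<xi>. y \<xi> - central (\<lambda>j. y (\<omega> j)) \<xi>"
  have "?x \<in> fa_dom G"
    using y by (auto simp: fa_dom_def central_simple intro!: diff_in_fa central_in_fa)
  then have "0 \<le> ?x (\<omega> i)"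
    by (rule dominant_coroot_comb_nonneg) (use i in \<open>simp_all add: central_weight\<close>)
  then show ?thesis by simp
qed

lemma dom_majorants_bdd_below:
  assumes i: "i \<in> {1..n}"
  shows "bdd_below ((\<lambda>y. y (\<omega> i)) ` dom_majorants d)"
proof (cases "i \<le> l")
  case True
  then have il: "i \<in> {1..l}" using i by simp
  have "central (\<lambda>j. real_of_ereal (d j)) (\<omega> i) \<le> y (\<omega> i)" if y: "y \<in> dom_majorants d" for y
  proof -
    have "central (\<lambda>j. real_of_ereal (d j)) (\<omega> i) = central (\<lambda>j. y (\<omega> j)) (\<omega> i)"
      unfolding central_def using y by (intro sum.cong refl) (simp add: dom_majorants_def)
    also have "\<dots> \<le> y (\<omega> i)" using y il by (intro dominant_ge_central) (auto simp: dom_majorants_def)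
    finally show ?thesis .
  qed
  then show ?thesis by (intro bdd_belowI2)
next
  case False
  have "real_of_ereal (d i) \<le> y (\<omega> i)" if y: "y \<in> dom_majorants d" for y
    using y False i by (simp add: dom_majorants_def)
  then show ?thesis by (intro bdd_belowI2)
qed

lemma least_dom_in_fa: "least_dom d \<in> fa"
  unfolding least_dom_def by (rule from_coords_in_fa)

lemma least_dom_weight: "i \<in> {1..n} \<Longrightarrow> least_dom d (\<omega> i) = Inf ((\<lambda>y. y (\<omega> i)) ` dom_majorants d)"
  unfolding least_dom_def by (rule from_coords_weight)

lemma least_dom_le: "y \<in> dom_majorants d \<Longrightarrow> i \<in> {1..n} \<Longrightarrow> least_dom d (\<omega> i) \<le> y (\<omega> i)"
  by (simp only: least_dom_weight) (intro cInf_lower dom_majorants_bdd_below imageI)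

lemma least_dom_central:
  assumes d: "d \<in> ext_space l n" and j: "j \<in> {l+1..n}"
  shows "ereal (least_dom d (\<omega> j)) = d j"
proof -
  have "(\<lambda>y. y (\<omega> j)) ` dom_majorants d = {real_of_ereal (d j)}"
    using dom_majorants_nonempty[OF d] j by (fastforce simp: dom_majorants_def)
  then show ?thesis using least_dom_weight[of j d] j ext_spaceD(2)[OF d j] by simp
qed

text \<open>Dominance survives the infimum: a majorant \<open>y\<close> that is \<open>e/2\<close>-close to the infimum in the \<open>i\<close>-th coordinate
exceeds it by a vector with non-negative coordinates, whose value at \<open>\<alpha>\<^sub>i\<close> is at most \<open>e\<close>.\<close>

lemma least_dom_in_majorants:
  assumes d: "d \<in> ext_space l n"
  shows "least_dom d \<in> dom_majorants d"
proof -
  have "0 \<le> least_dom d (\<alpha> i)" if i: "i \<in> {1..l}" for i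
  proof (rule field_le_epsilon)
    fix e :: real assume e: "0 < e"
    have iN: "i \<in> {1..n}" using i l_le_n by simp
    have "\<exists>r\<in>(\<lambda>y. y (\<omega> i)) ` dom_majorants d. r < least_dom d (\<omega> i) + e / 2"
      unfolding least_dom_weight[OF iN]
      using dom_majorants_nonempty[OF d] dom_majorants_bdd_below[OF iN] e by (intro cInf_lessD) auto
    then obtain y where y: "y \<in> dom_majorants d" and lt: "y (\<omega> i) < least_dom d (\<omega> i) + e / 2" by blast
    have yf: "y \<in> fa" using y by (simp add: dom_majorants_def fa_dom_def)
    let ?x = "\<lambda>\<xi>. y \<xi> - least_dom d \<xi>"
    have "?x (\<alpha> i) \<le> 2 * ?x (\<omega> i)"
    proof (rule coroot_comb_simple_le[OF diff_in_fa[OF yf least_dom_in_fa] _ _ i])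
      fix j assume j: "j \<in> {l+1..n}"
      have "ereal (least_dom d (\<omega> j)) = ereal (y (\<omega> j))"
        using least_dom_central[OF d j] y j by (simp add: dom_majorants_def)
      then show "?x (\<omega> j) = 0" by simp
    next
      fix j assume "j \<in> {1..l}"
      then show "0 \<le> ?x (\<omega> j)" using least_dom_le[OF y, of j] l_le_n by simp
    qed
    moreover have "0 \<le> y (\<alpha> i)" using y i by (simp add: dom_majorants_def fa_dom_def)
    ultimately show "0 \<le> least_dom d (\<alpha> i) + e" using lt by simp
  qed
  then have dom: "least_dom d \<in> fa_dom G" by (simp add: fa_dom_def least_dom_in_fa)
  have "d i \<le> ereal (least_dom d (\<omega> i))" if i: "i \<in> {1..l}" for i
  proof (cases "d i")
    case (real r)
    have iN: "i \<in> {1..n}" using i l_le_n by simp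
    have "r \<le> least_dom d (\<omega> i)"
      unfolding least_dom_weight[OF iN]
    proof (rule cInf_greatest)
      fix s assume "s \<in> (\<lambda>y. y (\<omega> i)) ` dom_majorants d"
      then show "r \<le> s" using dom_majorantsD(2)[OF _ i, of _ d] real by auto
    qed (use dom_majorants_nonempty[OF d] in simp)
    then show ?thesis using real by simp
  qed (use ext_spaceD(1)[OF d i] in auto)
  then show ?thesis using dom least_dom_central[OF d] by (simp add: dom_majorants_def)
qed

text \<open>If \<open>\<alpha>\<^sub>i\<close> is positive at the least majorant and its \<open>i\<close>-th coordinate is not forced, subtracting a small
multiple of \<open>\<alpha>\<^sub>i\<^sup>\<or>\<close> gives a smaller majorant: the values at the other simple roots only increase.\<close>

lemma least_dom_complementary:
  assumes d: "d \<in> ext_space l n" and i: "i \<in> {1..l}" and p: "least_dom d (\<alpha> i) \<noteq> 0"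
  shows "d i = ereal (least_dom d (\<omega> i))"
proof (rule ccontr)
  assume ne: "\<not> ?thesis"
  let ?m = "least_dom d"
  have f: "?m \<in> dom_majorants d" by (rule least_dom_in_majorants[OF d])
  then have mdom: "?m \<in> fa_dom G" by (simp add: dom_majorants_def)
  have "d i < ereal (?m (\<omega> i))" using f i ne by (auto simp: dom_majorants_def less_le)
  then obtain r where r: "d i < ereal r" "r < ?m (\<omega> i)"
    using ereal_dense2 by (metis less_ereal.simps(1))
  have pp: "0 < ?m (\<alpha> i)" using p fa_domD(2)[OF mdom i] by simp
  (* The value of the coroot at its own root is 2, hence the division by 2. *)
  define e where "e = min (?m (\<omega> i) - r) (?m (\<alpha> i) / 2)"
  have e: "0 < e" "e \<le> ?m (\<omega> i) - r" "2 * e \<le> ?m (\<alpha> i)" using r pp by (auto simp: e_def min_def)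
  let ?y = "\<lambda>\<xi>. ?m \<xi> - e * rcoroot (\<alpha> i) \<xi>"
  have "?y \<in> dom_majorants d"
    unfolding dom_majorants_def fa_dom_def
  proof (intro CollectI conjI ballI)
    show "?y \<in> fa" by (intro diff_in_fa scale_in_fa rcoroot_in_fa simple_root i least_dom_in_fa)
    fix j assume j: "j \<in> {1..l}"
    show "0 \<le> ?y (\<alpha> j)"
    proof (cases "j = i")
      case True
      then show ?thesis using e rcoroot_self[OF simple_root[OF i]] by simp
    next
      case False
      then have "e * rcoroot (\<alpha> i) (\<alpha> j) \<le> 0"
        using cartan_nonpos[OF j i] e by (intro mult_nonneg_nonpos) auto
      then show ?thesis using fa_domD(2)[OF mdom j] by simp
    qed
  next
    fix j assume j: "j \<in> {1..l}"
    show "d j \<le> ereal (?y (\<omega> j))"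
    proof (cases "j = i")
      case True
      have "d i \<le> ereal r" using r by simp
      also have "ereal r \<le> ereal (?y (\<omega> i))" using e rcoroot_weight[OF i i] by simp
      finally show ?thesis using True by simp
    next
      case False
      then show ?thesis using rcoroot_weight[OF j i] f j by (simp add: dom_majorants_def)
    qed
  next
    fix j assume j: "j \<in> {l+1..n}"
    then show "d j = ereal (?y (\<omega> j))"
      using rcoroot_central_weight[OF i j] least_dom_central[OF d j] by simp
  qed
  from least_dom_le[OF this, of i] i l_le_n e(1) rcoroot_weight[OF i i] show False by simp
qed

text \<open>For \<open>x\<close> the difference of \<open>y\<close> and the least majorant, \<open>ip x x\<close> is a sum of terms with the signs of
\<open>x(\<omega>\<^sub>i) x(\<alpha>\<^sub>i)\<close>. Where \<open>x(\<omega>\<^sub>i) > 0\<close>, complementarity gives \<open>y(\<alpha>\<^sub>i) = 0\<close> and hence \<open>x(\<alpha>\<^sub>i) \<le> 0\<close>.\<close>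

lemma least_dom_unique:
  assumes d: "d \<in> ext_space l n" and y: "y \<in> dom_majorants d"
    and c: "\<And>i. i \<in> {1..l} \<Longrightarrow> y (\<alpha> i) = 0 \<or> d i = ereal (y (\<omega> i))"
  shows "least_dom d = y"
proof -
  let ?m = "least_dom d"
  have m: "?m \<in> dom_majorants d" by (rule least_dom_in_majorants[OF d])
  have mdom: "?m \<in> fa_dom G" and ydom: "y \<in> fa_dom G" using m y by (auto simp: dom_majorants_def)
  note fa = fa_domD(1)[OF ydom] fa_domD(1)[OF mdom]
  let ?x = "\<lambda>\<xi>. y \<xi> - ?m \<xi>"
  have x: "?x \<in> fa" using fa by (rule diff_in_fa)
  have cen: "?x (\<omega> j) = 0" if j: "j \<in> {l+1..n}" for j
  proof -
    have "ereal (?m (\<omega> j)) = ereal (y (\<omega> j))" using least_dom_central[OF d j] y j by (simp add: dom_majorants_def)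
    then show ?thesis by simp
  qed
  have xe: "?x = (\<lambda>\<xi>. \<Sum>i\<in>{1..l}. ?x (\<omega> i) * rcoroot (\<alpha> i) \<xi>)"
    by (rule coroot_span[OF x]) (use cen in auto)
  have "2 * ip ?x ?x = (\<Sum>i\<in>{1..l}. ?x (\<omega> i) * ip (rcoroot (\<alpha> i)) (rcoroot (\<alpha> i)) * ?x (\<alpha> i))"
    by (subst (1) xe) (rule ip_coroot_comb[OF order_refl x])
  also have "\<dots> \<le> 0"
  proof (rule sum_nonpos)
    fix i assume i: "i \<in> {1..l}"
    have le: "?m (\<omega> i) \<le> y (\<omega> i)" using least_dom_le[OF y, of i] i l_le_n by simp
    show "?x (\<omega> i) * ip (rcoroot (\<alpha> i)) (rcoroot (\<alpha> i)) * ?x (\<alpha> i) \<le> 0"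
    proof (cases "?m (\<omega> i) = y (\<omega> i)")
      case False
      have "d i \<le> ereal (?m (\<omega> i))" using m i by (simp add: dom_majorants_def)
      then have "d i \<noteq> ereal (y (\<omega> i))" using le False by auto
      then have "?x (\<alpha> i) \<le> 0" using c[OF i] fa_domD(2)[OF mdom i] by auto
      then show ?thesis
        using le rcoroot_norm_pos[OF simple_root[OF i]] by (intro mult_nonneg_nonpos mult_nonneg_nonneg) auto
    qed simp
  qed
  finally have "?x = (\<lambda>\<xi>. 0)" using ip_le_zero[OF x] by simp
  then show ?thesis by (simp add: fun_eq_iff)
qed

lemma least_dom_iff:
  assumes d: "d \<in> ext_space l n"
  shows "least_dom d = y \<longleftrightarrow> y \<in> dom_majorants d \<and> (\<forall>i\<in>{1..l}. y (\<alpha> i) = 0 \<or> d i = ereal (y (\<omega> i)))"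
  using least_dom_in_majorants[OF d] least_dom_complementary[OF d] least_dom_unique[OF d] by blast

section \<open>The retraction onto the dominant cone\<close>

lemma coords_ext_space: "coords n \<omega> x \<in> ext_space l n"
  by (auto simp: coords_def ext_space_def)

text \<open>With \<open>t = y - x\<close> for the least majorant \<open>y\<close>, complementarity gives \<open>ip t y = 0\<close>, while
\<open>ip t z \<ge> 0\<close> for all dominant \<open>z\<close>. The angle at \<open>y\<close> is therefore never acute, and the squared distance
from \<open>x\<close> to \<open>z\<close> exceeds the one to \<open>y\<close> by at least the squared distance from \<open>y\<close> to \<open>z\<close>.\<close>

lemma retr_eq_least_dom:
  assumes x: "x \<in> fa"
  shows "retr G ip x = least_dom (coords n \<omega> x)"
proof -
  let ?d = "coords n \<omega> x"
  let ?y = "least_dom ?d"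
  let ?sq = "\<lambda>z. ip (\<lambda>\<xi>. x \<xi> - z \<xi>) (\<lambda>\<xi>. x \<xi> - z \<xi>)"
  have d: "?d \<in> ext_space l n" by (rule coords_ext_space)
  have dv: "?d i = ereal (x (\<omega> i))" if "i \<in> {1..n}" for i using that by (simp add: coords_def)
  have f: "?y \<in> dom_majorants ?d" by (rule least_dom_in_majorants[OF d])
  have ydom: "?y \<in> fa_dom G" using f by (simp add: dom_majorants_def)
  have y: "?y \<in> fa" by (rule least_dom_in_fa)
  define t where "t = (\<lambda>\<xi>. ?y \<xi> - x \<xi>)"
  have tf: "t \<in> fa" unfolding t_def using y x by (rule diff_in_fa)
  have tc: "t (\<omega> j) = 0" if j: "j \<in> {l+1..n}" for j
    using least_dom_central[OF d j] dv[of j] j by (simp add: t_def)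
  have tn: "0 \<le> t (\<omega> i)" if i: "i \<in> {1..l}" for i
    using dom_majorantsD(2)[OF f i] dv[of i] i l_le_n by (simp add: t_def)
  have te: "t = (\<lambda>\<xi>. \<Sum>i\<in>{1..l}. t (\<omega> i) * rcoroot (\<alpha> i) \<xi>)"
    by (rule coroot_span[OF tf]) (use tc in auto)
  have ipt: "2 * ip t z = (\<Sum>i\<in>{1..l}. t (\<omega> i) * ip (rcoroot (\<alpha> i)) (rcoroot (\<alpha> i)) * z (\<alpha> i))" if "z \<in> fa" for z
    by (subst te) (rule ip_coroot_comb[OF order_refl that])
  have "2 * ip t ?y = 0"
    unfolding ipt[OF y]
  proof (intro sum.neutral ballI)
    fix i assume i: "i \<in> {1..l}"
    have "?y (\<alpha> i) = 0 \<or> t (\<omega> i) = 0"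
    proof (cases "?y (\<alpha> i) = 0")
      case False
      then have "ereal (x (\<omega> i)) = ereal (?y (\<omega> i))"
        using least_dom_complementary[OF d i] dv[of i] i l_le_n by simp
      then show ?thesis by (simp add: t_def)
    qed simp
    then show "t (\<omega> i) * ip (rcoroot (\<alpha> i)) (rcoroot (\<alpha> i)) * ?y (\<alpha> i) = 0" by auto
  qed
  then have ty: "ip t ?y = 0" by simp
  have tz: "0 \<le> ip t z" if z: "z \<in> fa_dom G" for z
  proof -
    have "0 \<le> 2 * ip t z"
      unfolding ipt[OF fa_domD(1)[OF z]]
      using rcoroot_norm_pos[OF simple_root] by (intro sum_nonneg mult_nonneg_nonneg tn fa_domD(2)[OF z] less_imp_le)
    then show ?thesis by simp
  qed
  have ineq: "?sq ?y + ip (\<lambda>\<xi>. ?y \<xi> - z \<xi>) (\<lambda>\<xi>. ?y \<xi> - z \<xi>) \<le> ?sq z" if z: "z \<in> fa_dom G" for z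
  proof -
    have zf: "z \<in> fa" by (rule fa_domD(1)[OF z])
    let ?u = "\<lambda>\<xi>. ?y \<xi> - z \<xi>"
    have u: "?u \<in> fa" using y zf by (rule diff_in_fa)
    have e1: "(\<lambda>\<xi>. x \<xi> - z \<xi>) = (\<lambda>\<xi>. ?u \<xi> - t \<xi>)" and e2: "(\<lambda>\<xi>. x \<xi> - ?y \<xi>) = (\<lambda>\<xi>. (-1) * t \<xi>)"
      by (simp_all add: t_def)
    have "?sq ?y = ip t t"
      unfolding e2 using tf by (simp only: ip_scale ip_scale_right scale_in_fa)
    moreover have "?sq z = ip ?u ?u - 2 * ip t ?u + ip t t"
      unfolding e1 using tf u by (simp add: ip_diff ip_diff_right diff_in_fa ip_sym[of ?u t])
    moreover have "ip t ?u \<le> 0" using ty tz[OF z] tf y zf by (simp add: ip_diff_right)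
    ultimately show ?thesis by simp
  qed
  have nonneg: "0 \<le> ip u u" if "u \<in> fa" for u
    using ip_pos[OF that] ip_zero[OF zero_in_fa] by fastforce
  show ?thesis
    unfolding retr_def
  proof (rule the_equality)
    show "?y \<in> fa_dom G \<and> (\<forall>z\<in>fa_dom G. ?sq ?y \<le> ?sq z)"
    proof (intro conjI ballI ydom)
      fix z assume z: "z \<in> fa_dom G"
      show "?sq ?y \<le> ?sq z"
        using ineq[OF z] nonneg[OF diff_in_fa[OF y fa_domD(1)[OF z]]] by simp
    qed
    fix z assume z: "z \<in> fa_dom G \<and> (\<forall>z'\<in>fa_dom G. ?sq z \<le> ?sq z')"
    then have zd: "z \<in> fa_dom G" and le: "?sq z \<le> ?sq ?y" using ydom by blast+
    have "(\<lambda>\<xi>. ?y \<xi> - z \<xi>) = (\<lambda>\<xi>. 0)"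
      using ineq[OF zd] le by (intro ip_le_zero diff_in_fa y fa_domD(1)[OF zd]) simp
    then show "z = ?y" by (simp add: fun_eq_iff)
  qed
qed

section \<open>Continuity of the least dominant majorant\<close>

lemma central_bound:
  assumes "\<And>j. j \<in> {l+1..n} \<Longrightarrow> \<bar>v j\<bar> \<le> e"
  shows "\<bar>central v \<xi>\<bar> \<le> e * (\<Sum>j\<in>{l+1..n}. \<bar>central_coweight j \<xi>\<bar>)"
proof -
  have "\<bar>central v \<xi>\<bar> \<le> (\<Sum>j\<in>{l+1..n}. \<bar>v j * central_coweight j \<xi>\<bar>)"
    unfolding central_def by (rule sum_abs)
  also have "\<dots> \<le> (\<Sum>j\<in>{l+1..n}. e * \<bar>central_coweight j \<xi>\<bar>)"
    using assms by (intro sum_mono) (simp add: abs_mult mult_right_mono)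
  finally show ?thesis by (simp add: sum_distrib_left)
qed

text \<open>A Lipschitz estimate in one direction. A majorant of \<open>d'\<close> is obtained from the least majorant of \<open>d\<close> by
correcting the central coordinates and adding a multiple of \<open>rho\<close> large enough to absorb that correction.
The bound on \<open>d'\<close> is in terms of the least majorant of \<open>d\<close> and not of \<open>d\<close> itself, so that it can be used
near coordinates \<open>-\<infinity>\<close>.\<close>

lemma least_dom_perturb:
  obtains K where "\<And>i. i \<in> {1..l} \<Longrightarrow> 0 \<le> K i"
    and "\<And>d d' e i. d \<in> ext_space l n \<Longrightarrow> d' \<in> ext_space l n \<Longrightarrow> 0 \<le> e \<Longrightarrow>
      (\<And>i. i \<in> {1..l} \<Longrightarrow> d' i \<le> ereal (least_dom d (\<omega> i) + e)) \<Longrightarrow>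
      (\<And>j. j \<in> {l+1..n} \<Longrightarrow> \<bar>real_of_ereal (d' j) - real_of_ereal (d j)\<bar> \<le> e) \<Longrightarrow>
      i \<in> {1..l} \<Longrightarrow> least_dom d' (\<omega> i) \<le> least_dom d (\<omega> i) + e * K i"
proof -
  define B where "B i = (\<Sum>j\<in>{l+1..n}. \<bar>central_coweight j (\<omega> i)\<bar>)" for i
  (* The factor 2 compensates the lower bound 1/2 for the coordinates of rho. *)
  define C where "C = 2 * (1 + (\<Sum>i\<in>{1..l}. B i))"
  define K where "K i = C * rho (\<omega> i) + B i" for i
  have B: "0 \<le> B i" for i unfolding B_def by (intro sum_nonneg) simp
  have C: "0 \<le> C" unfolding C_def using B by (simp add: sum_nonneg)
  have Crho: "1 + B i \<le> C * rho (\<omega> i)" if i: "i \<in> {1..l}" for i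
  proof -
    have "B i \<le> (\<Sum>i\<in>{1..l}. B i)" using i B by (intro member_le_sum) auto
    then have "1 + B i \<le> C * (1 / 2)" by (simp add: C_def)
    also have "\<dots> \<le> C * rho (\<omega> i)" using rho_weight[OF i] C by (rule mult_left_mono)
    finally show ?thesis .
  qed
  show ?thesis
  proof (rule that[of K])
    show "0 \<le> K i" if "i \<in> {1..l}" for i
      using Crho[OF that] B[of i] by (simp add: K_def)
  next
    fix d d' e i
    assume d: "d \<in> ext_space l n" and d': "d' \<in> ext_space l n" and e: "0 \<le> (e::real)"
      and u: "\<And>i. i \<in> {1..l} \<Longrightarrow> d' i \<le> ereal (least_dom d (\<omega> i) + e)"
      and c: "\<And>j. j \<in> {l+1..n} \<Longrightarrow> \<bar>real_of_ereal (d' j) - real_of_ereal (d j)\<bar> \<le> e"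
      and i: "i \<in> {1..l}"
    define v where "v j = real_of_ereal (d' j) - real_of_ereal (d j)" for j
    have b: "\<bar>central v (\<omega> i)\<bar> \<le> e * B i" for i
      unfolding B_def by (rule central_bound) (use c in \<open>simp add: v_def\<close>)
    let ?y = "\<lambda>\<xi>. least_dom d \<xi> + ((e * C) * rho \<xi> + central v \<xi>)"
    have "?y \<in> dom_majorants d'"
      unfolding dom_majorants_def
    proof (intro CollectI conjI ballI)
      show "?y \<in> fa_dom G"
        using dom_majorantsD(1)[OF least_dom_in_majorants[OF d]] e C by (intro dom_majorants_shift) simp_all
      fix i assume i: "i \<in> {1..l}"
      have "e * (1 + B i) \<le> e * (C * rho (\<omega> i))" using Crho[OF i] e by (rule mult_left_mono)
      then have "e \<le> (e * C) * rho (\<omega> i) + central v (\<omega> i)" using b[of i] by (simp add: algebra_simps)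
      then have "ereal (least_dom d (\<omega> i) + e) \<le> ereal (?y (\<omega> i))" by simp
      with u[OF i] show "d' i \<le> ereal (?y (\<omega> i))" by (rule order_trans)
    next
      fix j assume j: "j \<in> {l+1..n}"
      have "?y (\<omega> j) = real_of_ereal (d' j)"
        using rho_central[OF j] central_weight[OF j, of v] arg_cong[OF least_dom_central[OF d j], of real_of_ereal]
        by (simp add: v_def)
      then show "d' j = ereal (?y (\<omega> j))" using ext_spaceD(2)[OF d' j] by simp
    qed
    then have "least_dom d' (\<omega> i) \<le> ?y (\<omega> i)" using i l_le_n by (intro least_dom_le) auto
    also have "\<dots> \<le> least_dom d (\<omega> i) + e * K i" using b[of i] by (simp add: K_def algebra_simps)
    finally show "least_dom d' (\<omega> i) \<le> least_dom d (\<omega> i) + e * K i" .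
  qed
qed

lemma tendsto_coordinate: "((\<lambda>d. d k) \<longlongrightarrow> d k) (at d within S)"
  for d :: "nat \<Rightarrow> ereal"
  using continuous_on_product_coordinates[of k] unfolding continuous_on_def
  by (metis UNIV_I subset_UNIV tendsto_within_subset)

text \<open>The perturbation estimate is applied from \<open>d\<close> to a nearby \<open>d'\<close> and back. The upper bounds it needs on \<open>d'\<close>
hold near \<open>d\<close> because they hold strictly at \<open>d\<close>, and those on \<open>d\<close> are vacuous where \<open>d\<close> is \<open>-\<infinity>\<close>.\<close>

lemma least_dom_tendsto_weight:
  assumes d: "d \<in> ext_space l n" and i: "i \<in> {1..n}"
  shows "((\<lambda>d. least_dom d (\<omega> i)) \<longlongrightarrow> least_dom d (\<omega> i)) (at d within ext_space l n)"
  unfolding tendsto_iff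
proof (intro allI impI)
  fix r :: real assume r: "0 < r"
  obtain K where K: "\<And>i. i \<in> {1..l} \<Longrightarrow> 0 \<le> K i"
    and pert: "\<And>d d' e i. d \<in> ext_space l n \<Longrightarrow> d' \<in> ext_space l n \<Longrightarrow> 0 \<le> e \<Longrightarrow>
      (\<And>i. i \<in> {1..l} \<Longrightarrow> d' i \<le> ereal (least_dom d (\<omega> i) + e)) \<Longrightarrow>
      (\<And>j. j \<in> {l+1..n} \<Longrightarrow> \<bar>real_of_ereal (d' j) - real_of_ereal (d j)\<bar> \<le> e) \<Longrightarrow>
      i \<in> {1..l} \<Longrightarrow> least_dom d' (\<omega> i) \<le> least_dom d (\<omega> i) + e * K i"
    by (rule least_dom_perturb) blast
  (* Small enough that both e and e * K i are below r; the first is needed for central coordinates. *)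
  define e where "e = r / (2 + \<bar>K i\<bar>)"
  have e: "0 < e" "e < r" "e * \<bar>K i\<bar> < r" using r by (auto simp: e_def field_simps add_pos_nonneg)
  let ?F = "at d within ext_space l n"
  have up: "eventually (\<lambda>d'. \<forall>k\<in>{1..l}. d' k \<le> ereal (least_dom d (\<omega> k) + e)) ?F"
  proof (rule eventually_ball_finite; (intro ballI)?)
    fix k assume k: "k \<in> {1..l}"
    have "d k \<le> ereal (least_dom d (\<omega> k))" by (rule dom_majorantsD(2)[OF least_dom_in_majorants[OF d] k])
    also have "\<dots> < ereal (least_dom d (\<omega> k) + e)" using e by simp
    finally show "eventually (\<lambda>d'. d' k \<le> ereal (least_dom d (\<omega> k) + e)) ?F"
      by (rule eventually_mono[OF order_tendstoD(2)[OF tendsto_coordinate]]) simp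
  qed simp
  have low: "eventually (\<lambda>d'. \<forall>k\<in>{1..l}. d k - ereal e \<le> d' k) ?F"
  proof (rule eventually_ball_finite; (intro ballI)?)
    fix k assume k: "k \<in> {1..l}"
    show "eventually (\<lambda>d'. d k - ereal e \<le> d' k) ?F"
    proof (cases "d k")
      case (real s)
      then have "d k - ereal e < d k" using e by simp
      then show ?thesis
        by (rule eventually_mono[OF order_tendstoD(1)[OF tendsto_coordinate]]) simp
    next
      case PInf
      then show ?thesis using ext_spaceD(1)[OF d k] by simp
    qed simp
  qed simp
  have cen: "eventually (\<lambda>d'. \<forall>j\<in>{l+1..n}. \<bar>real_of_ereal (d' j) - real_of_ereal (d j)\<bar> \<le> e) ?F"
  proof (rule eventually_ball_finite; (intro ballI)?)
    fix j assume j: "j \<in> {l+1..n}"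
    obtain s where s: "d j = ereal s" using ext_spaceD(2)[OF d j] by metis
    have "eventually (\<lambda>d'. ereal (s - e) < d' j) ?F" "eventually (\<lambda>d'. d' j < ereal (s + e)) ?F"
      using e s by (intro order_tendstoD[OF tendsto_coordinate]; simp)+
    then show "eventually (\<lambda>d'. \<bar>real_of_ereal (d' j) - real_of_ereal (d j)\<bar> \<le> e) ?F"
    proof eventually_elim
      case (elim d')
      then obtain s' where "d' j = ereal s'" by (cases "d' j") auto
      then show ?case using elim s by auto
    qed
  qed simp
  have mem: "eventually (\<lambda>d'. d' \<in> ext_space l n) ?F" by (simp add: eventually_at_filter)
  show "eventually (\<lambda>d'. dist (least_dom d' (\<omega> i)) (least_dom d (\<omega> i)) < r) ?F"
    using up low cen mem
  proof eventually_elim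
    case (elim d')
    show ?case
    proof (cases "i \<le> l")
      case True
      then have il: "i \<in> {1..l}" using i by simp
      have "least_dom d' (\<omega> i) \<le> least_dom d (\<omega> i) + e * K i"
        by (rule pert[OF d elim(4)]) (use elim(1,3) e il in auto)
      moreover have "least_dom d (\<omega> i) \<le> least_dom d' (\<omega> i) + e * K i"
      proof (rule pert[OF elim(4) d])
        fix k assume k: "k \<in> {1..l}"
        have "d k - ereal e \<le> ereal (least_dom d' (\<omega> k))"
          using elim(2) k dom_majorantsD(2)[OF least_dom_in_majorants[OF elim(4)] k] by (meson order_trans)
        then show "d k \<le> ereal (least_dom d' (\<omega> k) + e)"
          by (cases "d k") auto
      next
        fix j assume "j \<in> {l+1..n}"
        then show "\<bar>real_of_ereal (d j) - real_of_ereal (d' j)\<bar> \<le> e"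
          using elim(3) by (metis abs_minus_commute)
      qed (use e il in auto)
      ultimately show ?thesis using e K[OF il] by (simp add: dist_real_def)
    next
      case False
      then have j: "i \<in> {l+1..n}" using i by simp
      have "\<bar>least_dom d' (\<omega> i) - least_dom d (\<omega> i)\<bar> \<le> e"
        using elim(3) j least_dom_central[OF d j] least_dom_central[OF elim(4) j]
        by (metis real_of_ereal.simps(1))
      then show ?thesis using e by (simp add: dist_real_def)
    qed
  qed
qed

lemma least_dom_continuous: "continuous_on (ext_space l n) least_dom"
proof (rule continuous_on_coordinatewise_then_product)
  fix \<xi>
  have "continuous_on (ext_space l n) (\<lambda>d. least_dom d (\<omega> i))" if "i \<in> {1..n}" for i
    unfolding continuous_on_def using least_dom_tendsto_weight[OF _ that] by blast
  then show "continuous_on (ext_space l n) (\<lambda>d. least_dom d \<xi>)"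
    unfolding fa_expand[OF least_dom_in_fa, of _ \<xi>] by (intro continuous_on_sum continuous_on_mult_right continuous_on_const)
qed

text \<open>Truncate the coordinates from below at \<open>-m\<close>.\<close>

lemma coords_dense:
  assumes d: "d \<in> ext_space l n"
  obtains x where "\<And>m. x m \<in> fa" "(\<lambda>m :: nat. coords n \<omega> (x m)) \<longlonglongrightarrow> d"
proof -
  define x where "x m = from_coords (\<lambda>i. real_of_ereal (if i \<le> l then max (d i) (ereal (- real m)) else d i))" for m
  have c: "coords n \<omega> (x m) i = (if i \<in> {1..l} then max (d i) (ereal (- real m)) else d i)" for m i
  proof (cases "i \<in> {1..n}")
    case True
    show ?thesis
    proof (cases "i \<le> l")
      case il: True
      then have "d i \<noteq> \<infinity>" using ext_spaceD(1)[OF d, of i] True by simp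
      then show ?thesis using True il by (cases "d i") (auto simp: coords_def x_def from_coords_weight max_def)
    next
      case False
      then show ?thesis using True ext_spaceD(2)[OF d, of i]
        by (simp add: coords_def x_def from_coords_weight)
    qed
  next
    case False
    then have "d i = undefined" by (rule PiE_arb[OF d[unfolded ext_space_def]])
    then show ?thesis using False l_le_n by (auto simp: coords_def)
  qed
  have "(\<lambda>m. coords n \<omega> (x m) i) \<longlonglongrightarrow> d i" for i
  proof (cases "i \<in> {1..l}")
    case True
    have "(\<lambda>m. ereal (- real m)) \<longlonglongrightarrow> -\<infinity>"
      unfolding tendsto_MInfty
    proof
      fix r
      have "eventually (\<lambda>m. - r < real m) sequentially"
        using filterlim_real_sequentially by (simp add: filterlim_at_top_dense)
      then show "eventually (\<lambda>m. ereal (- real m) < ereal r) sequentially"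
        by (rule eventually_mono) simp
    qed
    then have "(\<lambda>m. max (d i) (ereal (- real m))) \<longlonglongrightarrow> max (d i) (-\<infinity>)"
      by (intro tendsto_max tendsto_const)
    then show ?thesis using True by (simp add: c max_def)
  next
    case False
    then show ?thesis by (auto simp: c)
  qed
  then have "limitin (product_topology (\<lambda>i. euclidean) UNIV) (\<lambda>m. coords n \<omega> (x m)) d sequentially"
    by (simp add: limitin_componentwise)
  then have "(\<lambda>m. coords n \<omega> (x m)) \<longlonglongrightarrow> d" by (simp add: euclidean_product_topology)
  then show ?thesis using that[of x] from_coords_in_fa by (simp add: x_def)
qed

text \<open>The least dominant majorant is one continuous extension of the retraction, and by density there is no
other.\<close>

lemma retr_ext_eq:
  assumes d: "d \<in> ext_space l n"
  shows "retr_ext G n \<omega> ip d = least_dom d"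
proof
  fix \<xi>
  let ?S = "ext_space l n"
  let ?P = "\<lambda>f. continuous_on ?S f \<and> f ` ?S \<subseteq> fa_dom G \<and> (\<forall>x\<in>fa. f (coords n \<omega> x) = retr G ip x)"
  define f where "f = retr_ext G n \<omega> ip"
  have "?P least_dom"
    using least_dom_continuous dom_majorantsD(1)[OF least_dom_in_majorants] retr_eq_least_dom by auto
  then have f: "?P f" unfolding f_def retr_ext_def by (rule someI[of ?P])
  obtain x where x: "\<And>m. x m \<in> fa" and lim: "(\<lambda>m. coords n \<omega> (x m)) \<longlonglongrightarrow> d"
    by (rule coords_dense[OF d]) blast
  have tends: "(\<lambda>m. g (coords n \<omega> (x m)) \<xi>) \<longlonglongrightarrow> g d \<xi>"
    if "continuous_on ?S g" for g :: "(nat \<Rightarrow> ereal) \<Rightarrow> 'x \<Rightarrow> real"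
    by (rule continuous_on_tendsto_compose[OF continuous_on_product_then_coordinatewise[OF that] lim d])
      (simp add: coords_ext_space)
  have "(\<lambda>m. f (coords n \<omega> (x m)) \<xi>) = (\<lambda>m. least_dom (coords n \<omega> (x m)) \<xi>)"
    using f x retr_eq_least_dom by auto
  then have "f d \<xi> = least_dom d \<xi>"
    using tends[of f] tends[OF least_dom_continuous] f by (metis LIMSEQ_unique)
  then show "retr_ext G n \<omega> ip d \<xi> = least_dom d \<xi>" by (simp add: f_def)
qed

end

section \<open>Valuations\<close>

text \<open>A unit generates the unit ideal, which is not maximal.\<close>

lemma dvr_not_unit:
  assumes "is_dvr (\<pi> :: 'o::idom)"
  shows "\<not> \<pi> dvd 1"
proof
  assume "\<pi> dvd 1"
  then obtain u where u: "u * \<pi> = 1" by (metis dvd_def mult.commute)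
  let ?R = "ring_of_type_algebra :: 'o ring"
  have "maximalideal (PIdl\<^bsub>?R\<^esub> \<pi>) ?R" using assms unfolding is_dvr_def by blast
  then have ne: "carrier ?R \<noteq> PIdl\<^bsub>?R\<^esub> \<pi>" by (rule maximalideal.I_notcarr)
  have "x \<in> PIdl\<^bsub>?R\<^esub> \<pi>" for x
  proof -
    have "\<exists>z. x = z * \<pi>" by (rule exI[of _ "x * u"]) (simp add: mult.assoc u)
    then show ?thesis unfolding cgenideal_def ring_of_type_algebra_def by simp
  qed
  then show False using ne by (auto simp: ring_of_type_algebra_def)
qed

lemma Fract_power: "Fract a 1 ^ k = Fract (a ^ k) (1 :: 'o::idom)"
  by (induction k) (simp_all add: One_fract_def)

lemma unit_eq_uniformizer_power:
  assumes dvr: "is_dvr (\<pi> :: 'o::idom)" and u: "u dvd 1" and e: "Fract \<pi> 1 powi m = Fract u 1"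
  shows "m = 0"
proof (rule ccontr)
  assume "m \<noteq> 0"
  have p: "\<pi> \<noteq> 0" using dvr by (simp add: is_dvr_def)
  have nu: "\<not> \<pi> dvd 1" by (rule dvr_not_unit[OF dvr])
  from \<open>m \<noteq> 0\<close> consider "0 < m" | "m < 0" by linarith
  then show False
  proof cases
    case 1
    then have "Fract (\<pi> ^ nat m) 1 = Fract u 1" using e by (simp add: power_int_def Fract_power)
    then have "\<pi> ^ nat m = u" by (simp add: eq_fract)
    moreover have "\<pi> dvd \<pi> ^ nat m" using 1 by (intro dvd_power) simp
    ultimately show False using u nu dvd_trans by blast
  next
    case 2
    have "inverse (Fract \<pi> 1) ^ nat (- m) = Fract u 1"
      using e 2 by (simp add: power_int_def del: inverse_fract)
    then have "inverse (Fract (\<pi> ^ nat (- m)) 1) = Fract u 1"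
      by (simp only: power_inverse Fract_power)
    then have "Fract 1 (\<pi> ^ nat (- m)) = Fract u 1" by simp
    then have "1 = u * \<pi> ^ nat (- m)" using p by (simp add: eq_fract)
    moreover have "\<pi> dvd \<pi> ^ nat (- m)" using 2 by (intro dvd_power) simp
    ultimately have "\<pi> dvd 1" by (metis dvd_mult)
    then show False using nu by simp
  qed
qed

lemma uniformizer_nonzero: "is_dvr \<pi> \<Longrightarrow> Fract \<pi> 1 \<noteq> 0"
  by (simp add: is_dvr_def Zero_fract_def eq_fract)

lemma valF_uniformizer_power:
  assumes dvr: "is_dvr (\<pi> :: 'o::idom)"
  shows "valF \<pi> (Fract \<pi> 1 powi (- k)) = ereal (of_int k)"
proof -
  let ?p = "Fract \<pi> 1"
  have p: "?p \<noteq> 0" by (rule uniformizer_nonzero[OF dvr])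
  have "(THE j::int. \<exists>u. u dvd 1 \<and> ?p powi (- k) = Fract u 1 * ?p powi (- j)) = k"
  proof (rule the_equality)
    show "\<exists>u. u dvd 1 \<and> ?p powi (- k) = Fract u 1 * ?p powi (- k)"
      by (intro exI[of _ 1]) (simp add: One_fract_def[symmetric])
  next
    fix j assume "\<exists>u. u dvd 1 \<and> ?p powi (- k) = Fract u 1 * ?p powi (- j)"
    then obtain u where u: "u dvd 1" and e: "?p powi (- k) = Fract u 1 * ?p powi (- j)" by blast
    have "?p powi (j - k) = ?p powi (- k) * ?p powi j"
      using p by (simp add: power_int_add[symmetric])
    also have "\<dots> = Fract u 1"
      unfolding e using p by (simp add: mult.assoc power_int_add[symmetric])
    finally show "j = k" using unit_eq_uniformizer_power[OF dvr u, of "j - k"] by simp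
  qed
  then show ?thesis using p by (simp add: valF_def)
qed

lemma valF_zero: "valF \<pi> 0 = -\<infinity>"
  by (simp add: valF_def)

lemma valF_nonzero: "x \<noteq> 0 \<Longrightarrow> \<exists>k::int. valF \<pi> x = ereal (of_int k)"
  unfolding valF_def by auto

context
  fixes \<pi> :: "'o::idom" and w :: "'o fract alg_closure \<Rightarrow> ereal"
  assumes w: "extends_val \<pi> w"
begin

lemma val_zero: "w 0 = -\<infinity>"
  and val_finite: "x \<noteq> 0 \<Longrightarrow> \<exists>q. w x = ereal q"
  and val_mult: "w (x * y) = w x + w y"
  and val_add_le: "w (x + y) \<le> max (w x) (w y)"
  and val_to_ac: "w (to_ac c) = valF \<pi> c"
  using w unfolding extends_val_def by blast+

text \<open>Since \<open>1\<close> and \<open>-1\<close> square to \<open>1\<close>, both have valuation \<open>0\<close>.\<close>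

lemma val_uminus: "w (- x) = w x"
proof -
  obtain q where q: "w 1 = ereal q" using val_finite[of 1] by auto
  obtain q' where q': "w (- 1) = ereal q'" using val_finite[of "- 1"] by auto
  have "q = 0" using val_mult[of 1 1] q by simp
  then have "q' = 0" using val_mult[of "- 1" "- 1"] q q' by simp
  then show ?thesis using val_mult[of "- 1" x] q' by (cases "w x") simp_all
qed

lemma val_sum_le:
  assumes "\<And>i. i \<in> I \<Longrightarrow> w (f i) \<le> M"
  shows "w (\<Sum>i\<in>I. f i) \<le> M"
  using assms
proof (induction I rule: infinite_finite_induct)
  case (insert i I)
  have "w (f i + (\<Sum>i\<in>I. f i)) \<le> max (w (f i)) (w (\<Sum>i\<in>I. f i))" by (rule val_add_le)
  also have "\<dots> \<le> M" using insert by simp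
  finally show ?case using insert by simp
qed (simp_all add: val_zero)

lemma val_sum_less:
  assumes "\<And>i. i \<in> I \<Longrightarrow> w (f i) < M" "-\<infinity> < M"
  shows "w (\<Sum>i\<in>I. f i) < M"
  using assms(1)
proof (induction I rule: infinite_finite_induct)
  case (insert i I)
  have "w (f i + (\<Sum>i\<in>I. f i)) \<le> max (w (f i)) (w (\<Sum>i\<in>I. f i))" by (rule val_add_le)
  also have "\<dots> < M" using insert by simp
  finally show ?case using insert by simp
qed (use assms(2) in \<open>simp_all add: val_zero\<close>)

text \<open>The ultrametric inequality for \<open>x = (x + y) - y\<close>.\<close>

lemma val_add_dominant:
  assumes "w y < w x"
  shows "w (x + y) = w x"
proof (rule antisym)
  show "w (x + y) \<le> w x" using val_add_le[of x y] assms by simp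
  have "w x \<le> max (w (x + y)) (w y)" using val_add_le[of "x + y" "- y"] by (simp add: val_uminus)
  then show "w x \<le> w (x + y)" using assms by (auto simp: max_def split: if_splits)
qed

lemma nu_val: "a \<in> torus \<Longrightarrow> w (a \<xi>) = ereal (nu w a \<xi>)"
  using val_finite[of "a \<xi>"] by (auto simp: torus_def nu_def)

lemma nu_in_fa: "a \<in> torus \<Longrightarrow> nu w a \<in> fa"
proof -
  assume a: "a \<in> torus"
  have "ereal (nu w a (\<xi> + \<eta>)) = ereal (nu w a \<xi> + nu w a \<eta>)" for \<xi> \<eta>
    using a val_mult[of "a \<xi>" "a \<eta>"] unfolding plus_ereal.simps(1)[symmetric] nu_val[OF a, symmetric]
    by (simp add: torus_def)
  then show ?thesis by (simp add: fa_def)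
qed

end

context weighted_datum begin

section \<open>Valuations of orbit sums\<close>

text \<open>Twisting by \<open>s\<close> turns the valuations of the terms into the values of a dominant \<open>y\<close> on the orbit of \<open>\<omega>\<^sub>i\<close>,
and the term for \<open>s \<omega>\<^sub>i\<close> is the largest. Whenever it is strictly the largest it determines the valuation of
the sum.\<close>

lemma orbit_sum_val:
  fixes \<pi> :: "'o::idom"
  assumes w: "extends_val \<pi> w" and a: "a \<in> torus" and s: "s \<in> weyl_group G"
    and dom: "(\<lambda>\<xi>. nu w a (s \<xi>)) \<in> fa_dom G" and i: "i \<in> {1..n}"
  shows "w (orbit_sum G \<omega> i a) \<le> ereal (nu w a (s (\<omega> i)))"
    and "i \<in> {1..l} \<Longrightarrow> nu w a (s (\<alpha> i)) = 0 \<or> w (orbit_sum G \<omega> i a) = ereal (nu w a (s (\<omega> i)))"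
    and "i \<in> {l+1..n} \<Longrightarrow> w (orbit_sum G \<omega> i a) = ereal (nu w a (s (\<omega> i)))"
proof -
  let ?O = "(\<lambda>v. v (\<omega> i)) ` weyl_group G"
  let ?y = "\<lambda>\<xi>. nu w a (s \<xi>)"
  let ?x0 = "s (\<omega> i)"
  have fin: "finite ?O" using finite_weyl by simp
  have x0: "?x0 \<in> ?O" using s by blast
  obtain u where u: "u \<in> weyl_group G" "u \<circ> s = id" "s \<circ> u = id" using weyl_inverse[OF s] by blast
  have su: "s (u \<xi>) = \<xi>" for \<xi> using u(3) by (simp add: fun_eq_iff)
  have le: "nu w a \<xi> \<le> nu w a ?x0" if x: "\<xi> \<in> ?O" for \<xi>
  proof -
    obtain v where v: "v \<in> weyl_group G" "\<xi> = v (\<omega> i)" using x by blast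
    have uv: "u \<circ> v \<in> weyl_group G" using u(1) v(1) by (rule weyl_comp)
    have "?y ((u \<circ> v) (\<omega> i)) \<le> ?y (\<omega> i)"
    proof (cases "i \<le> l")
      case True
      then show ?thesis using dominant_weyl_weight_le[OF uv dom, of i] i by simp
    next
      case False
      then show ?thesis using weyl_central_weight[OF uv, of i] i by simp
    qed
    then show ?thesis using v(2) su by simp
  qed
  show "w (orbit_sum G \<omega> i a) \<le> ereal (nu w a ?x0)"
    unfolding orbit_sum_def by (rule val_sum_le[OF w]) (simp add: nu_val[OF w a] le)
  have eq: "w (orbit_sum G \<omega> i a) = ereal (nu w a ?x0)"
    if lt: "\<And>\<xi>. \<xi> \<in> ?O \<Longrightarrow> \<xi> \<noteq> ?x0 \<Longrightarrow> nu w a \<xi> < nu w a ?x0"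
  proof -
    have "orbit_sum G \<omega> i a = a ?x0 + (\<Sum>\<xi>\<in>?O - {?x0}. a \<xi>)"
      unfolding orbit_sum_def by (rule sum.remove[OF fin x0])
    moreover have "w (\<Sum>\<xi>\<in>?O - {?x0}. a \<xi>) < w (a ?x0)"
    proof (rule val_sum_less[OF w])
      fix \<xi> assume "\<xi> \<in> ?O - {?x0}"
      then show "w (a \<xi>) < w (a ?x0)" using lt[of \<xi>] by (simp add: nu_val[OF w a])
    qed (simp add: nu_val[OF w a])
    ultimately show ?thesis using val_add_dominant[OF w] by (simp add: nu_val[OF w a])
  qed
  show "nu w a (s (\<alpha> i)) = 0 \<or> w (orbit_sum G \<omega> i a) = ereal (nu w a ?x0)" if il: "i \<in> {1..l}"
  proof (cases "?y (\<alpha> i) = 0")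
    case False
    then have p: "0 < ?y (\<alpha> i)" using fa_domD(2)[OF dom il] by simp
    have "w (orbit_sum G \<omega> i a) = ereal (nu w a ?x0)"
    proof (rule eq)
      fix \<xi> assume x: "\<xi> \<in> ?O" and ne: "\<xi> \<noteq> ?x0"
      obtain v where v: "v \<in> weyl_group G" "\<xi> = v (\<omega> i)" using x by blast
      have uv: "u \<circ> v \<in> weyl_group G" using u(1) v(1) by (rule weyl_comp)
      have "(u \<circ> v) (\<omega> i) \<noteq> \<omega> i" using ne v(2) su[of \<xi>] by auto
      then show "nu w a \<xi> < nu w a ?x0"
        using dominant_weyl_weight_less[OF uv dom il p] v(2) su by simp
    qed
    then show ?thesis ..
  qed simp
  show "w (orbit_sum G \<omega> i a) = ereal (nu w a ?x0)" if ic: "i \<in> {l+1..n}"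
  proof (rule eq)
    fix \<xi> assume x: "\<xi> \<in> ?O" and ne: "\<xi> \<noteq> ?x0"
    then obtain v where v: "v \<in> weyl_group G" "\<xi> = v (\<omega> i)" by blast
    then have False using weyl_central_weight[OF v(1) ic] weyl_central_weight[OF s ic] ne by simp
    then show "nu w a \<xi> < nu w a ?x0" ..
  qed
qed

lemma orbit_dominant:
  assumes x: "x \<in> fa" and s: "s \<in> weyl_group G" and dom: "(\<lambda>\<xi>. x (s \<xi>)) \<in> fa_dom G"
  shows "{weyl_act s x |s. s \<in> weyl_group G} \<inter> fa_dom G = {\<lambda>\<xi>. x (s \<xi>)}"
  unfolding weyl_orbit
proof (intro equalityI subsetI)
  fix z assume z: "z \<in> {\<lambda>\<xi>. x (v \<xi>) |v. v \<in> weyl_group G} \<inter> fa_dom G"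
  then obtain v where v: "v \<in> weyl_group G" "z = (\<lambda>\<xi>. x (v \<xi>))" by blast
  obtain u where u: "u \<in> weyl_group G" "s \<circ> u = id" using weyl_inverse[OF s] by blast
  have e: "z = (\<lambda>\<xi>. x (s ((u \<circ> v) \<xi>)))" using u(2) v(2) by (simp add: fun_eq_iff)
  have "z \<in> fa_dom G" using z by (rule IntD2)
  then have "(\<lambda>\<xi>. x (s ((u \<circ> v) \<xi>))) \<in> fa_dom G" by (simp only: e)
  then have "(\<lambda>\<xi>. x (s ((u \<circ> v) \<xi>))) = (\<lambda>\<xi>. x (s \<xi>))"
    by (rule dominant_unique[OF dom weyl_comp[OF u(1) v(1)]])
  then show "z \<in> {\<lambda>\<xi>. x (s \<xi>)}" using e by simp
qed (use s dom in blast)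

section \<open>The strata of the adjoint quotient\<close>

lemma proj_M_eq:
  assumes J: "J \<subseteq> {1..l}" and y: "y \<in> fa_M G J"
    and t: "\<And>\<xi>. x \<xi> - y \<xi> = (\<Sum>i\<in>J. t i * rcoroot (\<alpha> i) \<xi>)"
  shows "proj_M G J x = y"
  unfolding proj_M_def
proof (rule the_equality)
  show "y \<in> fa_M G J \<and> (\<exists>t. \<forall>\<xi>. x \<xi> - y \<xi> = (\<Sum>i\<in>J. t i * of_int (coroot G (\<alpha> i) \<xi>)))"
    using y t unfolding rcoroot_def by blast
  fix z assume "z \<in> fa_M G J \<and> (\<exists>t. \<forall>\<xi>. x \<xi> - z \<xi> = (\<Sum>i\<in>J. t i * of_int (coroot G (\<alpha> i) \<xi>)))"
  then obtain t' where z: "z \<in> fa_M G J" and t': "\<And>\<xi>. x \<xi> - z \<xi> = (\<Sum>i\<in>J. t' i * rcoroot (\<alpha> i) \<xi>)"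
    unfolding rcoroot_def by blast
  have "(\<lambda>\<xi>. z \<xi> - y \<xi>) = (\<lambda>\<xi>. \<Sum>i\<in>J. (t i - t' i) * rcoroot (\<alpha> i) \<xi>)"
  proof
    fix \<xi>
    have "z \<xi> - y \<xi> = (\<Sum>i\<in>J. t i * rcoroot (\<alpha> i) \<xi>) - (\<Sum>i\<in>J. t' i * rcoroot (\<alpha> i) \<xi>)"
      using t[of \<xi>] t'[of \<xi>] by simp
    then show "z \<xi> - y \<xi> = (\<Sum>i\<in>J. (t i - t' i) * rcoroot (\<alpha> i) \<xi>)"
      by (simp add: left_diff_distrib sum_subtractf)
  qed
  then have "(\<lambda>\<xi>. z \<xi> - y \<xi>) = (\<lambda>\<xi>. 0)"
    by (rule coroot_comb_orthogonal[OF J]) (use y z in \<open>simp add: fa_M_def\<close>)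
  then show "z = y" by (simp add: fun_eq_iff)
qed

lemma proj_M_spec:
  assumes J: "J \<subseteq> {1..l}" and x: "x \<in> fa"
  shows "proj_M G J x \<in> fa_M G J"
    and "i \<in> {1..n} - J \<Longrightarrow> proj_M G J x (\<omega> i) = x (\<omega> i)"
proof -
  obtain t where t: "\<And>i. i \<in> J \<Longrightarrow> x (\<alpha> i) - (\<Sum>j\<in>J. t j * rcoroot (\<alpha> j) (\<alpha> i)) = 0"
    using coroot_projection[OF J x] by blast
  define y where "y = (\<lambda>\<xi>. x \<xi> - (\<Sum>j\<in>J. t j * rcoroot (\<alpha> j) \<xi>))"
  have y: "y \<in> fa_M G J"
    unfolding fa_M_def y_def using t by (auto intro!: diff_in_fa x coroot_comb_in_fa[OF J])
  have p: "proj_M G J x = y" by (rule proj_M_eq[OF J y]) (simp add: y_def)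
  show "proj_M G J x \<in> fa_M G J" using p y by simp
  show "proj_M G J x (\<omega> i) = x (\<omega> i)" if "i \<in> {1..n} - J"
    unfolding p y_def using coroot_comb_weight[OF J, of i t] that by simp
qed

text \<open>Projecting to \<open>\<aa>_M\<close> along the coroots of \<open>M\<close> keeps the coordinates outside \<open>J\<close>, and these are arbitrary
integers for lattice points. The parabolic that belongs to \<open>\<mu>\<close> is the one with \<open>J = I_\<mu>\<close>.\<close>

lemma NG_iff: "\<mu> \<in> NG G \<longleftrightarrow> \<mu> \<in> fa_dom G \<and> (\<forall>i\<in>{1..n} - I_mu G \<mu>. \<mu> (\<omega> i) \<in> \<int>)"
proof
  assume "\<mu> \<in> NG G"
  then obtain J where J: "J \<subseteq> {1..l}" and L: "\<mu> \<in> Lambda_M G J" and P: "\<mu> \<in> fa_P_plus G J"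
    unfolding NG_def by blast
  obtain y where y: "y \<in> cochars" and m: "\<mu> = proj_M G J (\<lambda>\<xi>. of_int (y \<xi>))"
    using L unfolding Lambda_M_def fa_lattice_def by blast
  have yf: "(\<lambda>\<xi>. of_int (y \<xi>)) \<in> fa" using y by (simp add: fa_def cochars_def)
  have mf: "\<mu> \<in> fa" and m0: "\<And>i. i \<in> J \<Longrightarrow> \<mu> (\<alpha> i) = 0" and mp: "\<And>i. i \<in> {1..l} - J \<Longrightarrow> 0 < \<mu> (\<alpha> i)"
    using P by (auto simp: fa_P_plus_def fa_M_def)
  have "0 \<le> \<mu> (\<alpha> i)" if "i \<in> {1..l}" for i using m0[of i] mp[of i] that by (cases "i \<in> J") auto
  moreover have "J \<subseteq> I_mu G \<mu>" using J m0 by (auto simp: I_mu_def)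
  moreover have "\<mu> (\<omega> i) \<in> \<int>" if "i \<in> {1..n} - J" for i
    unfolding m using proj_M_spec(2)[OF J yf that] by simp
  ultimately show "\<mu> \<in> fa_dom G \<and> (\<forall>i\<in>{1..n} - I_mu G \<mu>. \<mu> (\<omega> i) \<in> \<int>)"
    using mf unfolding fa_dom_def by blast
next
  assume r: "\<mu> \<in> fa_dom G \<and> (\<forall>i\<in>{1..n} - I_mu G \<mu>. \<mu> (\<omega> i) \<in> \<int>)"
  let ?J = "I_mu G \<mu>"
  have J: "?J \<subseteq> {1..l}" by (auto simp: I_mu_def)
  have mf: "\<mu> \<in> fa" using r by (simp add: fa_dom_def)
  define y where "y \<xi> = (\<Sum>i=1..n. \<lfloor>\<mu> (\<omega> i)\<rfloor> * wcoord \<xi> i)" for \<xi>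
  have y: "y \<in> cochars"
    by (simp add: cochars_def y_def wcoord_add distrib_left sum.distrib)
  have yr: "(\<lambda>\<xi>. of_int (y \<xi>)) = from_coords (\<lambda>i. of_int \<lfloor>\<mu> (\<omega> i)\<rfloor>)"
    by (simp add: y_def from_coords_def fun_eq_iff)
  let ?d = "\<lambda>\<xi>. of_int (y \<xi>) - \<mu> \<xi>"
  have df: "?d \<in> fa" using yr from_coords_in_fa mf by (metis diff_in_fa)
  have dz: "?d (\<omega> i) = 0" if i: "i \<in> {1..n} - ?J" for i
  proof -
    have "of_int (y (\<omega> i)) = (of_int \<lfloor>\<mu> (\<omega> i)\<rfloor> :: real)"
      using fun_cong[OF yr, of "\<omega> i"] i by (simp add: from_coords_weight)
    also have "\<dots> = \<mu> (\<omega> i)" using r i by (auto elim: Ints_cases)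
    finally show ?thesis by simp
  qed
  have dJ: "?d = (\<lambda>\<xi>. \<Sum>i\<in>?J. ?d (\<omega> i) * rcoroot (\<alpha> i) \<xi>)" by (rule coroot_span[OF df J dz])
  have mM: "\<mu> \<in> fa_M G ?J" using mf by (simp add: fa_M_def I_mu_def)
  have "proj_M G ?J (\<lambda>\<xi>. of_int (y \<xi>)) = \<mu>"
    by (rule proj_M_eq[OF J mM]) (rule fun_cong[OF dJ])
  then have "\<mu> \<in> Lambda_M G ?J"
    unfolding Lambda_M_def fa_lattice_def image_image using y by (intro image_eqI[of _ _ y]) simp_all
  moreover have "\<mu> \<in> fa_P_plus G ?J"
    using mM r unfolding fa_P_plus_def I_mu_def fa_dom_def by (auto simp: less_le)
  ultimately show "\<mu> \<in> NG G" using J unfolding NG_def by blast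
qed

lemma least_dom_eq_iff:
  assumes "\<mu> \<in> fa_dom G" "d \<in> ext_space l n"
  shows "least_dom d = \<mu> \<longleftrightarrow> (\<forall>i\<in>I_mu G \<mu>. d i \<le> ereal (\<mu> (\<omega> i))) \<and> (\<forall>i\<in>{1..n} - I_mu G \<mu>. d i = ereal (\<mu> (\<omega> i)))"
proof -
  have split: "{1..n} - I_mu G \<mu> = ({1..l} - I_mu G \<mu>) \<union> {l+1..n}"
    using l_le_n by (auto simp: I_mu_def)
  have key: "(\<forall>i\<in>L. le i) \<and> (\<forall>i\<in>L. z i \<or> eq i) \<longleftrightarrow>
      (\<forall>i\<in>{i\<in>L. z i}. le i) \<and> (\<forall>i\<in>L - {i\<in>L. z i}. eq i)"
    if "\<And>i. eq i \<Longrightarrow> le i" for L :: "nat set" and le z eq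
    using that by blast
  have "(\<forall>i\<in>{1..l}. d i \<le> ereal (\<mu> (\<omega> i))) \<and> (\<forall>i\<in>{1..l}. \<mu> (\<alpha> i) = 0 \<or> d i = ereal (\<mu> (\<omega> i))) \<longleftrightarrow>
      (\<forall>i\<in>I_mu G \<mu>. d i \<le> ereal (\<mu> (\<omega> i))) \<and> (\<forall>i\<in>{1..l} - I_mu G \<mu>. d i = ereal (\<mu> (\<omega> i)))"
    unfolding I_mu_def by (rule key) simp
  then show ?thesis
    using assms(1) unfolding least_dom_iff[OF assms(2)] dom_majorants_def split ball_Un mem_Collect_eq by argo
qed

lemma dom_le_least_dom_iff:
  assumes m: "\<mu> \<in> fa_dom G" and d: "d \<in> ext_space l n"
  shows "dom_le G (least_dom d) \<mu> \<longleftrightarrow> \<mu> \<in> dom_majorants d"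
proof
  assume "dom_le G (least_dom d) \<mu>"
  then have le: "\<And>i. i \<in> {1..l} \<Longrightarrow> least_dom d (\<omega> i) \<le> \<mu> (\<omega> i)" "\<And>i. i \<in> {l+1..n} \<Longrightarrow> least_dom d (\<omega> i) = \<mu> (\<omega> i)"
    unfolding dom_le_iff[OF least_dom_in_fa fa_domD(1)[OF m]] by blast+
  have "d i \<le> ereal (\<mu> (\<omega> i))" if i: "i \<in> {1..l}" for i
    using dom_majorantsD(2)[OF least_dom_in_majorants[OF d] i] le(1)[OF i] by (meson ereal_less_eq(3) order_trans)
  then show "\<mu> \<in> dom_majorants d" using m le(2) least_dom_central[OF d] unfolding dom_majorants_def by simp
next
  assume f: "\<mu> \<in> dom_majorants d"
  have "least_dom d (\<omega> j) = \<mu> (\<omega> j)" if j: "j \<in> {l+1..n}" for j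
    using least_dom_central[OF d j] dom_majorantsD(3)[OF f j] by simp
  then show "dom_le G (least_dom d) \<mu>"
    unfolding dom_le_iff[OF least_dom_in_fa fa_domD(1)[OF m]] using least_dom_le[OF f] l_le_n by simp
qed

lemma dvec_ext_space:
  fixes \<pi> :: "'o::idom"
  assumes "c \<in> adj_quot l n"
  shows "dvec \<pi> n c \<in> ext_space l n"
  unfolding dvec_def ext_space_def
proof (rule PiE_I)
  fix i assume i: "i \<in> {1..n}"
  show "(\<lambda>i\<in>{1..n}. valF \<pi> (c i)) i \<in> (if i \<le> l then - {\<infinity>} else range ereal)"
    using PiE_mem[OF assms[unfolded adj_quot_def] i] i valF_nonzero[of "c i" \<pi>] valF_zero[of \<pi>]
    by (cases "c i = 0") (auto split: if_splits)
qed auto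

text \<open>By complementarity the coordinates outside \<open>I_\<mu>\<close> are values of the valuation of \<open>F\<close>, hence integers.\<close>

lemma least_dom_dvec_NG:
  fixes \<pi> :: "'o::idom"
  assumes c: "c \<in> adj_quot l n"
  shows "least_dom (dvec \<pi> n c) \<in> NG G"
proof -
  let ?d = "dvec \<pi> n c"
  have d: "?d \<in> ext_space l n" by (rule dvec_ext_space[OF c])
  have dom: "least_dom ?d \<in> fa_dom G" by (rule dom_majorantsD(1)[OF least_dom_in_majorants[OF d]])
  have "least_dom ?d (\<omega> i) \<in> \<int>" if i: "i \<in> {1..n} - I_mu G (least_dom ?d)" for i
  proof -
    have "?d i = ereal (least_dom ?d (\<omega> i))"
      using least_dom_eq_iff[OF dom d] i by blast
    then have e: "valF \<pi> (c i) = ereal (least_dom ?d (\<omega> i))" using i by (simp add: dvec_def)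
    then have "c i \<noteq> 0" using valF_zero[of \<pi>] by auto
    then obtain k :: int where "valF \<pi> (c i) = ereal (of_int k)" using valF_nonzero by blast
    then have "least_dom ?d (\<omega> i) = of_int k" using e by simp
    then show ?thesis by simp
  qed
  then show ?thesis using dom by (simp add: NG_iff)
qed

lemma mem_AF_eq:
  fixes \<pi> :: "'o::idom"
  shows "c \<in> AF_eq \<pi> G n \<omega> ip \<mu> \<longleftrightarrow> c \<in> adj_quot l n \<and> least_dom (dvec \<pi> n c) = \<mu>"
  unfolding AF_eq_def using retr_ext_eq[OF dvec_ext_space[of c \<pi>]] by auto

lemma mem_AF_le:
  fixes \<pi> :: "'o::idom"
  shows "c \<in> AF_le \<pi> G n \<omega> ip \<mu> \<longleftrightarrow> c \<in> adj_quot l n \<and> dom_le G (least_dom (dvec \<pi> n c)) \<mu>"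
  unfolding AF_le_def using retr_ext_eq[OF dvec_ext_space[of c \<pi>]] by auto

lemma NG_dominant: "\<mu> \<in> NG G \<Longrightarrow> \<mu> \<in> fa_dom G"
  by (simp add: NG_iff)

lemma AF_eq_explicit:
  fixes \<pi> :: "'o::idom"
  assumes "\<mu> \<in> NG G"
  shows "AF_eq \<pi> G n \<omega> ip \<mu> =
    {c\<in>adj_quot l n. (\<forall>i\<in>I_mu G \<mu>. valF \<pi> (c i) \<le> ereal (\<mu> (\<omega> i))) \<and>
       (\<forall>i\<in>{1..n} - I_mu G \<mu>. valF \<pi> (c i) = ereal (\<mu> (\<omega> i)))}"
proof -
  have d: "dvec \<pi> n c i = valF \<pi> (c i)" if "i \<in> {1..n}" for c i using that by (simp add: dvec_def)
  have I: "i \<in> {1..n}" if "i \<in> I_mu G \<mu>" for i using that l_le_n by (simp add: I_mu_def)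
  have "c \<in> AF_eq \<pi> G n \<omega> ip \<mu> \<longleftrightarrow> c \<in> adj_quot l n \<and>
      (\<forall>i\<in>I_mu G \<mu>. valF \<pi> (c i) \<le> ereal (\<mu> (\<omega> i))) \<and>
      (\<forall>i\<in>{1..n} - I_mu G \<mu>. valF \<pi> (c i) = ereal (\<mu> (\<omega> i)))" for c
    unfolding mem_AF_eq using least_dom_eq_iff[OF NG_dominant[OF assms] dvec_ext_space, of c \<pi>] d[of _ c] I
    by (metis DiffD1)
  then show ?thesis by blast
qed

lemma AF_le_explicit:
  fixes \<pi> :: "'o::idom"
  assumes "\<mu> \<in> NG G"
  shows "AF_le \<pi> G n \<omega> ip \<mu> =
    {c\<in>adj_quot l n. (\<forall>i\<in>{1..l}. valF \<pi> (c i) \<le> ereal (\<mu> (\<omega> i))) \<and>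
       (\<forall>i\<in>{l+1..n}. valF \<pi> (c i) = ereal (\<mu> (\<omega> i)))}"
proof -
  have m: "\<mu> \<in> fa_dom G" by (rule NG_dominant[OF assms])
  have "\<mu> \<in> dom_majorants (dvec \<pi> n c) \<longleftrightarrow> (\<forall>i\<in>{1..l}. valF \<pi> (c i) \<le> ereal (\<mu> (\<omega> i))) \<and>
      (\<forall>i\<in>{l+1..n}. valF \<pi> (c i) = ereal (\<mu> (\<omega> i)))" for c
    using m l_le_n by (simp add: dom_majorants_def dvec_def)
  then show ?thesis
    using mem_AF_le[of _ \<pi>] dom_le_least_dom_iff[OF m dvec_ext_space[of _ \<pi>]] by blast
qed

lemma AF_eq_nonempty:
  fixes \<pi> :: "'o::idom"
  assumes dvr: "is_dvr \<pi>" and m: "\<mu> \<in> NG G"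
  shows "AF_eq \<pi> G n \<omega> ip \<mu> \<noteq> {}"
proof -
  define c where "c = (\<lambda>i\<in>{1..n}. if i \<in> I_mu G \<mu> then 0 else Fract \<pi> 1 powi (- \<lfloor>\<mu> (\<omega> i)\<rfloor>))"
  have "c \<in> adj_quot l n"
    unfolding adj_quot_def
  proof (rule PiE_I)
    fix i assume "i \<in> {1..n}"
    then show "c i \<in> (if i \<le> l then UNIV else - {0})"
      using uniformizer_nonzero[OF dvr] by (auto simp: c_def I_mu_def)
  qed (auto simp: c_def)
  moreover have "valF \<pi> (c i) \<le> ereal (\<mu> (\<omega> i))" if "i \<in> I_mu G \<mu>" for i
    using that l_le_n by (simp add: c_def I_mu_def valF_def)
  moreover have "valF \<pi> (c i) = ereal (\<mu> (\<omega> i))" if i: "i \<in> {1..n} - I_mu G \<mu>" for i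
  proof -
    have "\<mu> (\<omega> i) \<in> \<int>" using m i by (simp add: NG_iff)
    then have "of_int \<lfloor>\<mu> (\<omega> i)\<rfloor> = \<mu> (\<omega> i)" by (auto elim: Ints_cases)
    moreover have "valF \<pi> (c i) = ereal (of_int \<lfloor>\<mu> (\<omega> i)\<rfloor>)"
      using i valF_uniformizer_power[OF dvr] by (simp add: c_def)
    ultimately show ?thesis by simp
  qed
  ultimately have "c \<in> AF_eq \<pi> G n \<omega> ip \<mu>" unfolding AF_eq_explicit[OF m] by blast
  then show ?thesis by blast
qed

lemma adj_quot_eq_Union:
  fixes \<pi> :: "'o::idom"
  shows "adj_quot l n = (\<Union>\<mu>\<in>NG G. AF_eq \<pi> G n \<omega> ip \<mu>)"
proof (intro equalityI subsetI)
  fix c :: "nat \<Rightarrow> 'o fract" assume c: "c \<in> adj_quot l n"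
  then have "c \<in> AF_eq \<pi> G n \<omega> ip (least_dom (dvec \<pi> n c))" by (simp add: mem_AF_eq)
  with least_dom_dvec_NG[OF c, of \<pi>] show "c \<in> (\<Union>\<mu>\<in>NG G. AF_eq \<pi> G n \<omega> ip \<mu>)" by blast
next
  fix c :: "nat \<Rightarrow> 'o fract" assume "c \<in> (\<Union>\<mu>\<in>NG G. AF_eq \<pi> G n \<omega> ip \<mu>)"
  then show "c \<in> adj_quot l n" by (rule UN_E) (simp add: mem_AF_eq)
qed

lemma AF_le_eq_Union:
  fixes \<pi> :: "'o::idom"
  shows "AF_le \<pi> G n \<omega> ip \<mu> = (\<Union>\<nu>\<in>{\<nu>\<in>NG G. dom_le G \<nu> \<mu>}. AF_eq \<pi> G n \<omega> ip \<nu>)"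
proof (intro equalityI subsetI)
  fix c :: "nat \<Rightarrow> 'o fract" assume "c \<in> AF_le \<pi> G n \<omega> ip \<mu>"
  then have c: "c \<in> adj_quot l n" and le: "dom_le G (least_dom (dvec \<pi> n c)) \<mu>"
    by (simp_all add: mem_AF_le)
  have "c \<in> AF_eq \<pi> G n \<omega> ip (least_dom (dvec \<pi> n c))" using c by (simp add: mem_AF_eq)
  moreover have "least_dom (dvec \<pi> n c) \<in> {\<nu>\<in>NG G. dom_le G \<nu> \<mu>}"
    using least_dom_dvec_NG[OF c, of \<pi>] le by simp
  ultimately show "c \<in> (\<Union>\<nu>\<in>{\<nu>\<in>NG G. dom_le G \<nu> \<mu>}. AF_eq \<pi> G n \<omega> ip \<nu>)" by blast
next
  fix c :: "nat \<Rightarrow> 'o fract"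
  assume "c \<in> (\<Union>\<nu>\<in>{\<nu>\<in>NG G. dom_le G \<nu> \<mu>}. AF_eq \<pi> G n \<omega> ip \<nu>)"
  then show "c \<in> AF_le \<pi> G n \<omega> ip \<mu>" by (rule UN_E) (auto simp: mem_AF_eq mem_AF_le)
qed

lemma AF_eq_disjoint: "disjoint_family_on (AF_eq \<pi> G n \<omega> ip) S"
  for \<pi> :: "'o::idom"
  by (auto simp: disjoint_family_on_def mem_AF_eq)

lemma least_dom_dvec_eq_dominant_nu:
  fixes \<pi> :: "'o::idom"
  assumes w: "extends_val \<pi> w" and c: "c \<in> adj_quot l n" and a: "a \<in> torus"
    and eq: "adj_map G n \<omega> a = (\<lambda>i\<in>{1..n}. to_ac (c i))"
    and s: "s \<in> weyl_group G" and dom: "(\<lambda>\<xi>. nu w a (s \<xi>)) \<in> fa_dom G"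
  shows "least_dom (dvec \<pi> n c) = (\<lambda>\<xi>. nu w a (s \<xi>))"
proof -
  have d: "dvec \<pi> n c \<in> ext_space l n" by (rule dvec_ext_space[OF c])
  have v: "dvec \<pi> n c i = w (orbit_sum G \<omega> i a)" if "i \<in> {1..n}" for i
    using fun_cong[OF eq, of i] that val_to_ac[OF w, of "c i"] by (simp add: adj_map_def dvec_def)
  note o = orbit_sum_val[OF w a s dom]
  show ?thesis
  proof (rule least_dom_unique[OF d])
    show "(\<lambda>\<xi>. nu w a (s \<xi>)) \<in> dom_majorants (dvec \<pi> n c)"
      unfolding dom_majorants_def
    proof (intro CollectI conjI ballI dom)
      fix i assume "i \<in> {1..l}"
      then have i: "i \<in> {1..n}" using l_le_n by simp
      show "dvec \<pi> n c i \<le> ereal (nu w a (s (\<omega> i)))" unfolding v[OF i] by (rule o(1)[OF i])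
    next
      fix i assume j: "i \<in> {l+1..n}"
      then have i: "i \<in> {1..n}" by simp
      show "dvec \<pi> n c i = ereal (nu w a (s (\<omega> i)))" unfolding v[OF i] by (rule o(3)[OF i j])
    qed
    fix j assume j: "j \<in> {1..l}"
    then have i: "j \<in> {1..n}" using l_le_n by simp
    show "nu w a (s (\<alpha> j)) = 0 \<or> dvec \<pi> n c j = ereal (nu w a (s (\<omega> j)))"
      unfolding v[OF i] by (rule o(2)[OF i j])
  qed
qed

lemma mem_AF_eq_iff_nu:
  fixes \<pi> :: "'o::idom"
  assumes w: "extends_val \<pi> w" and c: "c \<in> adj_quot l n" and a: "a \<in> torus"
    and eq: "adj_map G n \<omega> a = (\<lambda>i\<in>{1..n}. to_ac (c i))"
  shows "c \<in> AF_eq \<pi> G n \<omega> ip \<mu> \<longleftrightarrow> {weyl_act s (nu w a) |s. s \<in> weyl_group G} \<inter> fa_dom G = {\<mu>}"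
proof -
  have nu: "nu w a \<in> fa" by (rule nu_in_fa[OF w a])
  obtain s where s: "s \<in> weyl_group G" and dom: "(\<lambda>\<xi>. nu w a (s \<xi>)) \<in> fa_dom G"
    by (rule dominant_in_orbit[OF nu])
  have l: "least_dom (dvec \<pi> n c) = (\<lambda>\<xi>. nu w a (s \<xi>))"
    by (rule least_dom_dvec_eq_dominant_nu[OF w c a eq s dom])
  show ?thesis unfolding orbit_dominant[OF nu s dom] mem_AF_eq l using c by simp
qed

end

theorem theorem1p5p2:
  fixes \<pi> :: "'o::idom"
    and G :: "'x::ab_group_add based_root_datum"
    and n :: nat
    and \<omega> :: "nat \<Rightarrow> 'x"
    and ip :: "('x \<Rightarrow> real) \<Rightarrow> ('x \<Rightarrow> real) \<Rightarrow> real"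
  assumes dvr: "is_dvr \<pi>"
    and complete: "adically_complete \<pi>"
    and residue_field: "algebraically_closed (residue_ring_at \<pi>)"
    and datum: "is_based_root_datum G n"
    and sc: "simply_connected_derived G"
    and weights: "is_weight_choice G n \<omega>"
    and inner: "is_invariant_inner G ip"
  shows
    "((\<forall>\<mu>\<in>NG G. AF_eq \<pi> G n \<omega> ip \<mu> \<noteq> {}) \<and>
      adj_quot (ssrank G) n = (\<Union>\<mu>\<in>NG G. AF_eq \<pi> G n \<omega> ip \<mu>) \<and>
      disjoint_family_on (AF_eq \<pi> G n \<omega> ip) (NG G)) \<and>
     (\<forall>\<mu>\<in>NG G.
      AF_le \<pi> G n \<omega> ip \<mu> = (\<Union>\<nu>\<in>{\<nu>\<in>NG G. dom_le G \<nu> \<mu>}. AF_eq \<pi> G n \<omega> ip \<nu>) \<and>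
      disjoint_family_on (AF_eq \<pi> G n \<omega> ip) {\<nu>\<in>NG G. dom_le G \<nu> \<mu>}) \<and>
     (\<forall>\<mu>\<in>NG G.
      AF_le \<pi> G n \<omega> ip \<mu> =
        {c\<in>adj_quot (ssrank G) n.
           (\<forall>i\<in>{1..ssrank G}. valF \<pi> (c i) \<le> ereal (\<mu> (\<omega> i))) \<and>
           (\<forall>i\<in>{ssrank G + 1..n}. valF \<pi> (c i) = ereal (\<mu> (\<omega> i)))}) \<and>
     (\<forall>\<mu>\<in>NG G.
      AF_eq \<pi> G n \<omega> ip \<mu> =
        {c\<in>adj_quot (ssrank G) n.
           (\<forall>i\<in>I_mu G \<mu>. valF \<pi> (c i) \<le> ereal (\<mu> (\<omega> i))) \<and>
           (\<forall>i\<in>{1..n} - I_mu G \<mu>. valF \<pi> (c i) = ereal (\<mu> (\<omega> i)))}) \<and>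
     (\<forall>w. extends_val \<pi> w \<longrightarrow>
      (\<forall>\<mu>\<in>NG G. \<forall>c\<in>adj_quot (ssrank G) n. \<forall>a\<in>torus.
         adj_map G n \<omega> a = (\<lambda>i\<in>{1..n}. to_ac (c i)) \<longrightarrow>
         (c \<in> AF_eq \<pi> G n \<omega> ip \<mu> \<longleftrightarrow>
          {weyl_act s (nu w a) |s. s \<in> weyl_group G} \<inter> fa_dom G = {\<mu>})))"
proof -
  interpret weighted_datum G n \<omega> ip
    using datum weights inner by unfold_locales
  show ?thesis
    by (intro conjI ballI allI impI AF_eq_nonempty[OF dvr] adj_quot_eq_Union AF_le_eq_Union
        AF_eq_disjoint AF_le_explicit AF_eq_explicit mem_AF_eq_iff_nu)
qed

end
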